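(* If the Riemann Conjecture is true, then $$f(z)=\sum_{n=0}^\infty\frac{n!\,\hat b_n z^n}{(2n)!}\in\overline{\mathcal{PN}}_\infty(q)\subset\overline{\mathcal{LC}^{+}}_\infty\quad\text{for all } q\in(0,1].$$
   Context: Here $\hat b_n=\int_0^\infty t^{2n}\Phi(t)\,dt$ for $n\in\mathbb{N}_0$, where $\Phi(t)=\sum_{n=1}^\infty(2n^4\pi^2e^{9t}-3n^2\pi e^{5t})e^{-n^2\pi e^{4t}}$. It is well known that the Riemann Conjecture (all non-trivial zeros of the Riemann zeta function have real part $1/2$) is equivalent to the statement that $F(z)=\sum_{n=0}^\infty\frac{\hat b_nz^n}{(2n)!}$ belongs to the class $\overline{\mathcal{N}}_\infty(1)$ defined below. A finite or infinite sequence $\{x_k\}$ of real numbers is $q$-separated if $x_k/x_l\le q$ for all indices $k\ne l$ with $x_l\le x_k<0$ or $0<x_k\le x_l$. For $q\in(0,1)$, $\overline{\mathcal{N}}_\infty(q)$ is the set of entire functions $az^m\prod_{j=1}^{n}(1-z/x_j)$ with $a\in\mathbb{R}$, $m\in\mathbb{N}_0$, $n\in\mathbb{N}_0\cup\{\infty\}$ and $\{x_j\}_{j=1}^n$ a $q$-separated sequence of negative reals with $\inf_j|x_j|>0$. $\overline{\mathcal{N}}_\infty(1)$ is the closure, under uniform convergence on compact subsets of $\mathbb{C}$, of the set of real polynomials with all zeros in $(-\infty,0]$ (zero polynomial included). Let $C_k^\infty(q)=\prod_{j=1}^k\frac{q^{j-1}}{1-q^j}$ for $q\in(0,1)$ and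 $C_k^\infty(1)=1/k!$. Then $\overline{\mathcal{PN}}_\infty(q)$ is the set of formal power series $\sum_ka_kz^k$ such that $\sum_kC_k^\infty(q)a_kz^k$ belongs to $\overline{\mathcal{N}}_\infty(q)$. $\mathcal{LC}^{+}_\infty$ is the set of real formal power series $\sum_{k\ge0}a_kz^k$ with either all $a_k\ge0$ or all $a_k\le0$, and with $a_k^2>a_{k-1}a_{k+1}$ (where $a_{-1}=0$) for all $k\ge0$ for which there are $l\le k$ and $m\ge k$ with $a_l\neq0$, $a_m\ne0$; $\overline{\mathcal{LC}^{+}}_\infty$ is its closure with respect to coefficientwise convergence. *)

theory Defs
  imports "HOL-Complex_Analysis.Complex_Analysis" "HOL-Library.Extended_Nat"
begin

text \<open>The analytic continuation is unique away from the pole at 1; the value at 1 is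
  arbitrary and is never used.\<close>

definition zeta :: "complex \<Rightarrow> complex" where
  "zeta = (SOME Z. Z holomorphic_on (- {1}) \<and>
     (\<forall>s. Re s > 1 \<longrightarrow> (\<lambda>n. of_nat (Suc n) powr (- s)) sums Z s))"

text \<open>The trivial zeros are the negative even integers.\<close>

definition Riemann_conjecture :: bool where
  "Riemann_conjecture \<longleftrightarrow>
     (\<forall>s. s \<noteq> 1 \<and> zeta s = 0 \<and> (\<nexists>n::nat. s = - 2 * of_nat (Suc n)) \<longrightarrow> Re s = 1 / 2)"

definition Phi :: "real \<Rightarrow> real" where
  "Phi t = (\<Sum>i. let n = real (Suc i) in
      (2 * n ^ 4 * pi\<^sup>2 * exp (9 * t) - 3 * n\<^sup>2 * pi * exp (5 * t)) * exp (- n\<^sup>2 * pi * exp (4 * t)))"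

definition b_hat :: "nat \<Rightarrow> real" where
  "b_hat n = set_lebesgue_integral lborel {0..} (\<lambda>t. t ^ (2 * n) * Phi t)"

text \<open>A finite or infinite sequence of length \<open>n\<close> is given by the values \<open>x j\<close> with
  \<open>enat j < n\<close>; the other values of \<open>x\<close> are irrelevant.\<close>

definition q_separated :: "real \<Rightarrow> enat \<Rightarrow> (nat \<Rightarrow> real) \<Rightarrow> bool" where
  "q_separated q n x \<longleftrightarrow>
     (\<forall>k l. enat k < n \<longrightarrow> enat l < n \<longrightarrow> k \<noteq> l \<longrightarrow>
        (x l \<le> x k \<and> x k < 0 \<or> 0 < x k \<and> x k \<le> x l) \<longrightarrow> x k / x l \<le> q)"

definition N_bar_less_1 :: "real \<Rightarrow> (complex \<Rightarrow> complex) set" where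
  "N_bar_less_1 q =
     {f. \<exists>(a::real) (m::nat) (n::enat) (x::nat \<Rightarrow> real).
        (\<forall>j. enat j < n \<longrightarrow> x j < 0) \<and>
        q_separated q n x \<and>
        (\<exists>c>0. \<forall>j. enat j < n \<longrightarrow> c \<le> \<bar>x j\<bar>) \<and>
        (\<forall>z. \<exists>p. (\<lambda>j. if enat j < n then 1 - z / of_real (x j) else 1) has_prod p \<and>
               f z = of_real a * z ^ m * p)}"

definition nonpos_rooted_polys :: "real poly set" where
  "nonpos_rooted_polys =
     {p. p = 0 \<or> (\<forall>z::complex. poly (map_poly of_real p) z = 0 \<longrightarrow> z \<in> of_real ` {..0})}"

text \<open>Uniform convergence on compact sets is metrizable on continuous functions, so the
  closure is the set of limits of sequences.\<close>

definition N_bar_1 :: "(complex \<Rightarrow> complex) set" where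
  "N_bar_1 =
     {f. \<exists>P::nat \<Rightarrow> real poly. (\<forall>i. P i \<in> nonpos_rooted_polys) \<and>
        (\<forall>K. compact K \<longrightarrow>
           uniform_limit K (\<lambda>i z. poly (map_poly of_real (P i)) z) f sequentially)}"

text \<open>The following are meaningful for \<open>0 < q \<le> 1\<close> only.\<close>

definition N_bar :: "real \<Rightarrow> (complex \<Rightarrow> complex) set" where
  "N_bar q = (if q = 1 then N_bar_1 else N_bar_less_1 q)"

definition C_inf :: "real \<Rightarrow> nat \<Rightarrow> real" where
  "C_inf q k = (if q = 1 then 1 / fact k else (\<Prod>j=1..k. q ^ (j - 1) / (1 - q ^ j)))"

text \<open>Real coefficients lose no generality here: members of \<open>N_bar q\<close> have real Taylor
  coefficients at 0, and \<open>C_inf q k > 0\<close>.\<close>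

definition PN_bar :: "real \<Rightarrow> real fps set" where
  "PN_bar q =
     {A. \<exists>g\<in>N_bar q. \<forall>z. (\<lambda>k. of_real (C_inf q k * fps_nth A k) * z ^ k) sums g z}"

definition LC_plus :: "real fps set" where
  "LC_plus =
     {A. ((\<forall>k. fps_nth A k \<ge> 0) \<or> (\<forall>k. fps_nth A k \<le> 0)) \<and>
         (\<forall>k. (\<exists>l\<le>k. fps_nth A l \<noteq> 0) \<and> (\<exists>m\<ge>k. fps_nth A m \<noteq> 0) \<longrightarrow>
            (fps_nth A k)\<^sup>2 > (if k = 0 then 0 else fps_nth A (k - 1)) * fps_nth A (k + 1))}"

text \<open>The closure is taken in the product topology on \<open>nat \<Rightarrow> real\<close>, which is the topology of
  coefficientwise convergence. The library topology on \<open>real fps\<close> is finer: there,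
  convergence means that each coefficient is eventually constant.\<close>

definition LC_plus_bar :: "real fps set" where
  "LC_plus_bar = {A. fps_nth A \<in> closure (fps_nth ` LC_plus)}"

end

(*
  Put F(z) = sum b_n z^n / (2n)!, where the b_n are the even moments of Phi.  Since Phi is even
  (theta transformation), the Mellin transform of its series gives
  16 F((2s-1)^2) = s (s-1) pi^(-s/2) Gamma(s/2) zeta(s) for Re s > 1.  This yields the analytic
  continuation of zeta, and under the Riemann Conjecture all zeros of F are negative.  As
  F(z) = O(exp(|z|^(3/4))), dividing F by its zeros in a large disc and applying
  Borel-Caratheodory to the logarithm of the quotient shows that F is a limit of polynomials
  p_n with negative zeros.

  For q < 1 the generating function of C_k(q) is E(z) = prod (1 + q^i z), and
  E(z) + c E(qz) = (1 + c + z) E(qz) has no zero in the upper half-plane if Im c > 0.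
  Composition with p_n (sum a_k z^k, sum b_k z^k |-> sum k! a_k b_k z^k, that is
  prod (1 + r z d/dx) applied to E at x = 0) preserves this, so the composition G satisfies
  Im (G(z) / G(qz)) >= 0 there.  Following the argument of this quotient shows that the zeros
  of G are q-separated, a property that survives the limit.

  The inclusion in the closure of LC+ is the q-analogue of Newton's inequalities, proved by
  adding the zeros one at a time.
*)
theory Submission
  imports Defs "HOL-Computational_Algebra.Fundamental_Theorem_Algebra"
    "HOL-Probability.Characteristic_Functions"
begin

subsection \<open>Newton inequalities and log-concavity\<close>

text \<open>Since \<open>C_inf 1 k\<close> is 1/k!, the factor n! turns the case q = 1 into a
  statement about F itself; for q < 1 the series that has to lie in \<open>N_bar q\<close> is
  exactly the composition of F with E. The composition is studied on polynomials, where an argument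
  is a finite sum over zeros: E is replaced by its partial products and F by the p_n. The obstacle
  is the passage to the limit, because convergence of coefficients says nothing by itself about
  convergence of infinite products. Separation supplies the compactness: if the zeros are -1/r_j
  with r_j decreasing, then r_j is at most q^j times r_0, and r_0 is at most the sum of the r_j,
  which is the linear coefficient. One geometric series thus dominates all the products at once. The
  exponent 3/4 comes from a cubic exponential bound on Phi together with r t \<le> t^3 + r^(3/2),
  where r is the square root of |z|. An exponent below 1 is what lets the quotient of F by its zeros
  in growing discs tend to 1, so that no exponential factor is left over.\<close>

text \<open>The q-integer (1 - q^k) / (1 - q), written as a sum so that q = 1 is included and gives
  k.\<close>

definition qnum :: "real \<Rightarrow> nat \<Rightarrow> real" where
  "qnum q k = (\<Sum>i<k. q ^ i)"

lemma qnum_0 [simp]: "qnum q 0 = 0"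
  and qnum_Suc: "qnum q (Suc k) = 1 + q * qnum q k"
proof -
  show "qnum q 0 = 0" by (simp add: qnum_def)
  show "qnum q (Suc k) = 1 + q * qnum q k"
    by (simp add: qnum_def sum.lessThan_Suc_shift sum_distrib_left del: sum.lessThan_Suc)
qed

lemma qnum_nonneg: "0 < q \<Longrightarrow> 0 \<le> qnum q k"
  by (simp add: qnum_def sum_nonneg)

lemma qnum_pos: "0 < q \<Longrightarrow> 0 < qnum q (Suc k)"
  by (simp add: qnum_Suc qnum_nonneg add_pos_nonneg)

lemma power_eq_qnum: "q ^ k = 1 - (1 - q) * qnum q k"
proof (induction k)
  case (Suc k)
  have "q ^ Suc k = q * (1 - (1 - q) * qnum q k)" unfolding Suc[symmetric] by simp
  then show ?case by (simp add: qnum_Suc algebra_simps)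
qed simp

lemma C_inf_0 [simp]: "C_inf q 0 = 1"
  by (simp add: C_inf_def)

text \<open>Both branches of \<open>C_inf\<close> obey one recursion in q-integers. The remaining
  constant 1 - q cancels in the ratios of three consecutive terms that matter for
  log-concavity.\<close>

lemma C_inf_Suc:
  assumes "0 < q" "q \<le> 1"
  shows "C_inf q (Suc k) * qnum q (Suc k) = C_inf q k * q ^ k / (if q = 1 then 1 else 1 - q)"
proof (cases "q = 1")
  case True
  then show ?thesis by (simp add: C_inf_def qnum_def del: of_nat_Suc)
next
  case False
  have "1 - q ^ Suc k = (1 - q) * qnum q (Suc k)"
    using power_eq_qnum[of q "Suc k"] by simp
  moreover have "qnum q (Suc k) \<noteq> 0" using qnum_pos[of q k] assms by simp
  ultimately show ?thesis using False by (simp add: C_inf_def divide_simps del: power_Suc)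
qed

lemma C_inf_pos:
  assumes "0 < q" "q \<le> 1"
  shows "0 < C_inf q k"
proof (induction k)
  case (Suc k)
  have "0 < C_inf q (Suc k) * qnum q (Suc k)"
    unfolding C_inf_Suc[OF assms] using Suc assms by simp
  then show ?case using qnum_pos[OF assms(1), of k] zero_less_mult_pos2 by blast
qed simp

text \<open>Newton's inequalities for a generating function whose zeros are negative and
  \<open>q\<close>-separated; for \<open>q = 1\<close> they say that \<open>k! a\<^sub>k\<close> is log-concave.\<close>

definition q_newton :: "real \<Rightarrow> (nat \<Rightarrow> real) \<Rightarrow> bool" where
  "q_newton q a \<longleftrightarrow> (\<forall>k. 0 \<le> a k) \<and>
     (\<forall>l m. l < m \<longrightarrow> 0 < a l \<longrightarrow> 0 < a m \<longrightarrow> 0 < a (Suc l)) \<and>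
     (\<forall>k. qnum q (Suc (Suc k)) * (a k * a (Suc (Suc k))) \<le> q * qnum q (Suc k) * (a (Suc k))\<^sup>2)"

lemma q_newton_nonneg: "q_newton q a \<Longrightarrow> 0 \<le> a k"
  and q_newton_ineq: "q_newton q a \<Longrightarrow>
    qnum q (Suc (Suc k)) * (a k * a (Suc (Suc k))) \<le> q * qnum q (Suc k) * (a (Suc k))\<^sup>2"
  and q_newton_no_gap: "q_newton q a \<Longrightarrow> l < m \<Longrightarrow> 0 < a l \<Longrightarrow> 0 < a m \<Longrightarrow> 0 < a (Suc l)"
  unfolding q_newton_def by blast+

definition mul_linear :: "real \<Rightarrow> (nat \<Rightarrow> real) \<Rightarrow> nat \<Rightarrow> real" where
  "mul_linear r a k = a k + (case k of 0 \<Rightarrow> 0 | Suc l \<Rightarrow> r * a l)"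

text \<open>Multiplying a generating function by 1 + r z. With n the q-integer of k + 1, n times the
  new inequality is the sum of four nonnegative multiples: of two neighbouring old inequalities
  (\<open>E\<close>, \<open>A\<close>), of their combination \<open>VW\<close> (\<open>B\<close>),
  and of the separation hypothesis (\<open>D\<close>). What the first three leave open is exactly
  \<open>D\<close>, since 1 - (1 - q) n = q^(k+1). At q = 1 the hypothesis \<open>sep\<close> only
  says that r a_k is nonnegative.\<close>

lemma q_newton_mul_linear:
  assumes q: "0 < q" "q \<le> 1" and a: "q_newton q a" and r: "0 < r"
    and sep: "\<And>k. (1 - q) * qnum q (Suc k) * a (Suc k) \<le> q ^ Suc k * r * a k"
  shows "q_newton q (mul_linear r a)"
proof -
  note nn = q_newton_nonneg[OF a]
  note niz = q_newton_no_gap[OF a]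
  note newt = q_newton_ineq[OF a]
  let ?b = "mul_linear r a"
  have 1: "0 \<le> ?b k" for k
    using nn r by (simp add: mul_linear_def split: nat.split)
  have 2: "0 < ?b (Suc l)" if lm: "l < m" "0 < ?b l" "0 < ?b m" for l m
  proof (cases "a l = 0")
    case False
    then have "0 < a l" using nn[of l] by simp
    then show ?thesis using r nn[of "Suc l"] by (simp add: mul_linear_def add_nonneg_pos)
  next
    case True
    \<comment> \<open>The product has a positive coefficient at \<open>l\<close> although
      \<open>a l = 0\<close>, so it stems from \<open>a l'\<close> with \<open>l = Suc l'\<close>.
      The absence of gaps in \<open>a\<close> then forces \<open>a l\<close> to be positive, a
      contradiction.\<close>
    with that obtain l' where l': "l = Suc l'" "0 < a l'"
      using r by (cases l) (auto simp: mul_linear_def zero_less_mult_iff)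
    obtain m' where m': "m = Suc m'" using lm(1) by (cases m) auto
    have "0 < a m \<or> 0 < a m'"
      using that(3) m' r nn[of m] nn[of m'] by (auto simp: mul_linear_def zero_less_mult_iff less_le)
    then have "0 < a (Suc l')"
      using niz[of l' m] niz[of l' m'] l' m' that(1) by auto
    with True l' show ?thesis by simp
  qed
  have 3: "qnum q (Suc (Suc k)) * (?b k * ?b (Suc (Suc k))) \<le> q * qnum q (Suc k) * (?b (Suc k))\<^sup>2" for k
  proof -
    define n where "n = qnum q (Suc k)"
    have n: "n > 0" unfolding n_def by (rule qnum_pos[OF q(1)])
    define w where "w = a (Suc (Suc k))"
    define x where "x = a (Suc k)"
    define y where "y = a k"
    define v where "v = (case k of 0 \<Rightarrow> 0 | Suc l \<Rightarrow> a l)"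
    have pos: "0 \<le> w" "0 \<le> x" "0 \<le> y" "0 \<le> v"
      using nn by (auto simp: w_def x_def y_def v_def split: nat.split)
    have N: "(1 + q * n) * (y * w) \<le> q * n * x\<^sup>2"
      using newt[of k] by (simp add: n_def w_def x_def y_def qnum_Suc[of q "Suc k"])
    \<comment> \<open>The old inequality one index lower, where q times the q-integer of k equals n
      - 1. For k = 0 both sides vanish, because v = 0 and n = 1.\<close>
    have N': "n * (v * x) \<le> (n - 1) * y\<^sup>2"
    proof (cases k)
      case 0 then show ?thesis using q by (simp add: v_def n_def qnum_Suc)
    next
      case (Suc l)
      then show ?thesis using newt[of l] by (simp add: v_def n_def x_def y_def qnum_Suc[of q "Suc l"])
    qed
    have n1: "n \<ge> 1" using qnum_nonneg[OF q(1), of k] q by (simp add: n_def qnum_Suc)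
    \<comment> \<open>The product of \<open>N\<close> and \<open>N'\<close> divided by n x y. If x y
      = 0 this division is impossible, and v w = 0 follows instead from the absence of gaps.\<close>
    have VW: "(1 + q * n) * (v * w) \<le> q * (n - 1) * (x * y)"
    proof (cases "x = 0 \<or> y = 0")
      case True
      have "v * w = 0"
      proof (rule ccontr)
        assume vw: "v * w \<noteq> 0"
        then obtain l where l: "k = Suc l" by (cases k) (auto simp: v_def)
        have "0 < a l" "0 < a (Suc (Suc k))"
          using vw l nn[of l] nn[of "Suc (Suc k)"] by (auto simp: v_def w_def less_le)
        moreover from this have "0 < a k" using niz[of l "Suc (Suc k)"] l by simp
        moreover from this have "0 < a (Suc k)" using niz[of k "Suc (Suc k)"] calculation by simp
        ultimately show False using True by (simp add: x_def y_def)
      qed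
      then have "(1 + q * n) * (v * w) = 0" by simp
      then show ?thesis using pos q n1 by (metis diff_ge_0_iff_ge less_imp_le mult_nonneg_nonneg)
    next
      case False
      then have xy: "x * y > 0" using pos by (simp add: less_le)
      have "(1 + q * n) * (y * w) * (n * (v * x)) \<le> (q * n * x\<^sup>2) * ((n - 1) * y\<^sup>2)"
      proof (rule mult_mono[OF N N'])
        show "0 \<le> q * n * x\<^sup>2" using q n by simp
        show "0 \<le> n * (v * x)" using n pos by simp
      qed
      then have "((1 + q * n) * (v * w)) * (n * (x * y)) \<le> (q * (n - 1) * (x * y)) * (n * (x * y))"
        by (simp add: algebra_simps power2_eq_square)
      then show ?thesis using mult_pos_pos[OF n xy] by (simp add: mult_le_cancel_right_pos)
    qed
    have S: "(1 - q) * n * x \<le> (1 - (1 - q) * n) * r * y"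
      using sep[of k] unfolding power_eq_qnum[of q "Suc k"] by (simp add: n_def x_def y_def)
    have b: "?b k = y + r * v" "?b (Suc k) = x + r * y" "?b (Suc (Suc k)) = w + r * x"
      by (simp_all add: mul_linear_def v_def x_def y_def w_def split: nat.split)
    have A: "r\<^sup>2 * ((1 + q * n) * (n * (v * x))) \<le> r\<^sup>2 * ((1 + q * n) * ((n - 1) * y\<^sup>2))"
      using N' q n r by (intro mult_left_mono) auto
    have B: "(r * n) * ((1 + q * n) * (v * w)) \<le> (r * n) * (q * (n - 1) * (x * y))"
      using VW r n by (intro mult_left_mono) auto
    have D: "(r * y) * ((1 - q) * n * x) \<le> (r * y) * ((1 - (1 - q) * n) * r * y)"
      using S r pos by (intro mult_left_mono) auto
    have E: "n * ((1 + q * n) * (y * w)) \<le> n * (q * n * x\<^sup>2)"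
      using N n by (intro mult_left_mono) auto
    have "n * ((1 + q * n) * ((y + r * v) * (w + r * x))) \<le> n * (q * n * (x + r * y)\<^sup>2)"
      using A B D E by (simp add: algebra_simps power2_eq_square power3_eq_cube)
    then have "(1 + q * n) * ((y + r * v) * (w + r * x)) \<le> q * n * (x + r * y)\<^sup>2"
      using n by (simp add: mult_le_cancel_left_pos)
    then show ?thesis unfolding b qnum_Suc[of q "Suc k"] n_def[symmetric] .
  qed
  show ?thesis unfolding q_newton_def using 1 2 3 by blast
qed

text \<open>Multiplication by z moves every inequality up one index. The constants then change in
  the right direction because q-integers are log-concave: [n] [n+2] \<le> [n+1]^2.\<close>

lemma q_newton_shift:
  assumes q: "0 < q" and a: "q_newton q a"
  shows "q_newton q (case_nat 0 a)"
proof -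
  note nn = q_newton_nonneg[OF a]
  note niz = q_newton_no_gap[OF a]
  note newt = q_newton_ineq[OF a]
  have 3: "qnum q (Suc (Suc k)) * (case_nat 0 a k * case_nat 0 a (Suc (Suc k)))
      \<le> q * qnum q (Suc k) * (case_nat 0 a (Suc k))\<^sup>2" for k
  proof (cases k)
    case 0
    then show ?thesis using q qnum_nonneg[OF q, of "Suc 0"] by simp
  next
    case (Suc l)
    let ?n = "qnum q (Suc l)" and ?y = "a l * a (Suc (Suc l))" and ?x = "(a (Suc l))\<^sup>2"
    have n: "?n > 0" by (rule qnum_pos[OF q])
    have N: "(1 + q * ?n) * ?y \<le> q * ?n * ?x" using newt[of l] by (simp add: qnum_Suc[of q "Suc l"])
    have m: "qnum q (Suc (Suc l)) = 1 + q * ?n" "qnum q (Suc (Suc (Suc l))) = 1 + q * (1 + q * ?n)"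
      by (simp_all add: qnum_Suc[of q "Suc l"] qnum_Suc[of q "Suc (Suc l)"])
    have mono: "?n \<le> 1 + q * ?n" unfolding m(1)[symmetric] using q by (simp add: qnum_def)
    have "?n * (1 + q * (1 + q * ?n)) \<le> (1 + q * ?n) * (1 + q * ?n)"
      using mono by (simp add: algebra_simps)
    moreover have "0 \<le> ?y" using nn by simp
    ultimately have "?n * (1 + q * (1 + q * ?n)) * ?y \<le> (1 + q * ?n) * (1 + q * ?n) * ?y"
      by (rule mult_right_mono)
    also have "\<dots> \<le> (1 + q * ?n) * (q * ?n * ?x)"
      unfolding mult.assoc[of "1 + q * ?n"] using N q n by (intro mult_left_mono) auto
    finally have "?n * ((1 + q * (1 + q * ?n)) * ?y) \<le> ?n * (q * (1 + q * ?n) * ?x)"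
      by (simp add: algebra_simps)
    then show ?thesis unfolding Suc m using n by (simp add: mult_le_cancel_left_pos)
  qed
  have 2: "0 < case_nat 0 a (Suc l)" if lm: "l < m" "0 < case_nat 0 a l" "0 < case_nat 0 a m" for l m
  proof (cases l)
    case 0 then show ?thesis using lm by simp
  next
    case (Suc l')
    obtain m' where "m = Suc m'" using lm(1) by (cases m) auto
    then show ?thesis using Suc lm niz[of l' m'] by simp
  qed
  have 1: "0 \<le> case_nat 0 a k" for k by (simp add: nn split: nat.split)
  show ?thesis unfolding q_newton_def using 1 2 3 by blast
qed

lemma q_newton_no_internal_zeros:
  assumes "q_newton q a" "l \<le> k" "k \<le> m" "0 < a l" "0 < a m"
  shows "0 < a k"
  using assms(2,3)
proof (induction k rule: dec_induct)
  case base
  show ?case by (rule assms)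
next
  case (step n)
  then have "n < m" by simp
  then show ?case using assms(1,5) step.IH step.hyps unfolding q_newton_def by (meson Suc_leD step.prems)
qed

lemma LC_plus_bar_limit:
  assumes "\<And>n. A n \<in> LC_plus_bar" and "\<And>k. (\<lambda>n. fps_nth (A n) k) \<longlonglongrightarrow> fps_nth B k"
  shows "B \<in> LC_plus_bar"
proof -
  have "((\<lambda>n. fps_nth (A n)) \<longlongrightarrow> fps_nth B) sequentially"
    using assms(2) limitin_componentwise[of "\<lambda>_. euclidean :: real topology" UNIV "\<lambda>n. fps_nth (A n)" "fps_nth B" sequentially]
    by (simp add: euclidean_product_topology flip: limitin_canonical_iff)
  then have "fps_nth B \<in> closure (fps_nth ` LC_plus)"
    using assms(1) unfolding LC_plus_bar_def by (intro Lim_in_closed_set[OF closed_closure]) auto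
  then show ?thesis by (simp add: LC_plus_bar_def)
qed

lemma LC_plus_imp_LC_plus_bar: "A \<in> LC_plus \<Longrightarrow> A \<in> LC_plus_bar"
  unfolding LC_plus_bar_def by (auto intro: closure_subset[THEN subsetD])

text \<open>\<open>C_inf\<close> is the extremal sequence: it satisfies the inequalities of
  \<open>q_newton\<close> with equality. Dividing by it therefore turns \<open>q_newton\<close> into
  plain log-concavity.\<close>

lemma C_inf_ratio:
  assumes "0 < q" "q \<le> 1"
  shows "qnum q (Suc (Suc k)) * (C_inf q k * C_inf q (Suc (Suc k))) =
    q * qnum q (Suc k) * (C_inf q (Suc k))\<^sup>2"
proof -
  let ?d = "if q = 1 then 1 else 1 - q"
  have "qnum q (Suc (Suc k)) * (C_inf q k * C_inf q (Suc (Suc k))) =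
      C_inf q k * (C_inf q (Suc k) * q ^ Suc k / ?d)"
    unfolding C_inf_Suc[OF assms, symmetric] by (simp add: mult_ac)
  also have "\<dots> = q * C_inf q (Suc k) * (C_inf q k * q ^ k / ?d)" by simp
  also have "\<dots> = q * C_inf q (Suc k) * (C_inf q (Suc k) * qnum q (Suc k))"
    unfolding C_inf_Suc[OF assms] ..
  finally show ?thesis by (simp add: power2_eq_square mult_ac)
qed

text \<open>The factors \<open>exp (- k\<^sup>2 / (n + 1))\<close> make log-concavity strict.\<close>

lemma q_newton_LC_plus_bar:
  assumes q: "0 < q" "q \<le> 1" and a: "q_newton q a"
  shows "Abs_fps (\<lambda>k. c * a k / C_inf q k) \<in> LC_plus_bar"
proof (rule LC_plus_bar_limit)
  define w where "w n k = exp (- (real k)\<^sup>2 / real (Suc n))" for n k :: nat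
  note nn = q_newton_nonneg[OF a]
  note newt = q_newton_ineq[OF a]
  have C: "0 < C_inf q k" for k by (rule C_inf_pos[OF q])
  have w: "w n k > 0" for n k by (simp add: w_def)
  have w2: "w n k * w n (Suc (Suc k)) < (w n (Suc k))\<^sup>2" for n k
  proof -
    have "w n k * w n (Suc (Suc k)) = exp (- ((real k)\<^sup>2 + (real k + 2)\<^sup>2) / real (Suc n))"
      unfolding w_def exp_add[symmetric] by (simp add: add_divide_distrib diff_divide_distrib add_ac)
    also have "\<dots> < exp (- (2 * (real k + 1)\<^sup>2) / real (Suc n))"
      unfolding exp_less_cancel_iff
      by (intro divide_strict_right_mono) (auto simp: power2_eq_square algebra_simps)
    also have "\<dots> = (w n (Suc k))\<^sup>2"
      unfolding w_def power2_eq_square exp_add[symmetric] by (simp add: add_divide_distrib diff_divide_distrib add_ac)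
    finally show ?thesis .
  qed
  define B where "B n = Abs_fps (\<lambda>k. c * a k / C_inf q k * w n k)" for n
  show "B n \<in> LC_plus_bar" for n
  proof (rule LC_plus_imp_LC_plus_bar)
    have sgn: "(\<forall>k. fps_nth (B n) k \<ge> 0) \<or> (\<forall>k. fps_nth (B n) k \<le> 0)"
    proof (cases "c \<ge> 0")
      case True
      then show ?thesis using nn C w by (auto simp: B_def less_imp_le)
    next
      case False
      then show ?thesis using nn C w
        by (auto simp: B_def less_imp_le mult_nonpos_nonneg divide_nonpos_pos)
    qed
    have conc: "(fps_nth (B n) k)\<^sup>2 > (if k = 0 then 0 else fps_nth (B n) (k - 1)) * fps_nth (B n) (k + 1)"
      if l: "l \<le> k" "fps_nth (B n) l \<noteq> 0" and m: "k \<le> m" "fps_nth (B n) m \<noteq> 0" for k l m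
    proof -
      have c: "c \<noteq> 0" and al: "a l > 0" "a m > 0"
        using l m nn[of l] nn[of m] by (auto simp: B_def less_le)
      have ak: "a k > 0" using q_newton_no_internal_zeros[OF a l(1) m(1) al] .
      show ?thesis
      proof (cases k)
        case 0
        then show ?thesis using c ak C[of 0] w[of n 0] by (simp add: B_def)
      next
        case (Suc j)
        let ?x = "a j * a (Suc (Suc j))" and ?y = "(a (Suc j))\<^sup>2"
          and ?u = "C_inf q j * C_inf q (Suc (Suc j))" and ?v = "(C_inf q (Suc j))\<^sup>2"
        have uv: "0 < ?u" "0 < ?v" using C[of j] C[of "Suc j"] C[of "Suc (Suc j)"] by simp_all
        have "qnum q (Suc (Suc j)) * ?x * (q * qnum q (Suc j) * ?v) \<le>
            q * qnum q (Suc j) * ?y * (qnum q (Suc (Suc j)) * ?u)"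
          unfolding C_inf_ratio[OF q] using newt[of j] q qnum_nonneg[OF q(1)]
          by (intro mult_right_mono) auto
        then have "(q * qnum q (Suc j) * qnum q (Suc (Suc j))) * (?x * ?v) \<le>
            (q * qnum q (Suc j) * qnum q (Suc (Suc j))) * (?y * ?u)" by (simp only: mult_ac)
        then have "?x * ?v \<le> ?y * ?u"
          using q qnum_pos[OF q(1)] by (simp add: mult_le_cancel_left_pos)
        then have xy: "?x / ?u \<le> ?y / ?v" using uv by (simp add: frac_le_eq divide_simps)
        have "?x / ?u * (w n j * w n (Suc (Suc j))) \<le> ?y / ?v * (w n j * w n (Suc (Suc j)))"
          using xy w by (intro mult_right_mono) (auto simp: less_imp_le)
        also have "\<dots> < ?y / ?v * (w n (Suc j))\<^sup>2"
          using w2 ak Suc uv by (intro mult_strict_left_mono) auto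
        finally have "c\<^sup>2 * (?x / ?u * (w n j * w n (Suc (Suc j)))) < c\<^sup>2 * (?y / ?v * (w n (Suc j))\<^sup>2)"
          using c by (intro mult_strict_left_mono) auto
        then show ?thesis using Suc by (simp add: B_def power2_eq_square mult_ac)
      qed
    qed
    show "B n \<in> LC_plus" unfolding LC_plus_def using sgn conc by blast
  qed
  show "(\<lambda>n. fps_nth (B n) k) \<longlonglongrightarrow> fps_nth (Abs_fps (\<lambda>k. c * a k / C_inf q k)) k" for k
  proof -
    have "(\<lambda>n. - (real k)\<^sup>2 / real (Suc n)) \<longlonglongrightarrow> 0" by real_asymp
    then have "(\<lambda>n. w n k) \<longlonglongrightarrow> 1" unfolding w_def using tendsto_exp by fastforce
    from tendsto_mult[OF tendsto_const[of "c * a k / C_inf q k"] this] show ?thesis by (simp add: B_def)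
  qed
qed

lemma coeff_mult_linear: "coeff ([:1, r:] * p) = mul_linear r (coeff p)"
  by (rule ext) (simp add: mul_linear_def coeff_pCons split: nat.split)

lemma q_newton_one: "0 < q \<Longrightarrow> q_newton q (\<lambda>k. of_bool (k = 0))"
  by (auto simp: q_newton_def qnum_nonneg split: if_splits)

section \<open>Polynomials with real zeros and limits of their coefficients\<close>

abbreviation cpoly :: "real poly \<Rightarrow> complex \<Rightarrow> complex" where
  "cpoly p \<equiv> poly (map_poly of_real p)"

lemma map_poly_of_real_mult:
  "map_poly (of_real :: real \<Rightarrow> complex) (p * q) = map_poly of_real p * map_poly of_real q"
  by (rule poly_eqI) (simp add: coeff_map_poly coeff_mult)

lemma poly_map_poly_of_real:
  "cpoly p (of_real x) = of_real (poly p x)"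
  by (simp add: poly_altdef coeff_map_poly degree_map_poly)

text \<open>Roots are split off one by one: the root 0 is a shift, and a negative root s is the
  factor -s (1 + z / (-s)). At q = 1 the order of the roots is irrelevant. The scalar c carries the
  sign and covers the zero polynomial.\<close>

lemma nonpos_rooted_polys_q_newton:
  assumes "p \<in> nonpos_rooted_polys"
  shows "\<exists>c a. q_newton 1 a \<and> (\<forall>k. coeff p k = c * a k)"
  using assms
proof (induction "degree p" arbitrary: p)
  case 0
  then obtain c where p: "p = [:c:]" by (metis degree_eq_zeroE)
  show ?case
    by (rule exI[of _ c], rule exI[of _ "\<lambda>k. of_bool (k = 0)"]) (use q_newton_one[of 1] in \<open>auto simp: p coeff_pCons split: nat.split\<close>)
next
  case (Suc n)
  let ?h = "map_poly complex_of_real"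
  have "degree (?h p) \<noteq> 0" using Suc(2) by (simp add: degree_map_poly)
  then obtain z where z: "poly (?h p) z = 0"
    using alg_closed_imp_poly_has_root[of "?h p"] by auto
  have p0: "p \<noteq> 0" using Suc(2) by auto
  then obtain s where s: "z = of_real s" "s \<le> 0" using z Suc(3) by (auto simp: nonpos_rooted_polys_def)
  then have "poly p s = 0" using z by (simp add: poly_map_poly_of_real)
  then obtain r where r: "p = [:- s, 1:] * r" by (auto simp: poly_eq_0_iff_dvd elim: dvdE)
  have r0: "r \<noteq> 0" using p0 r by auto
  have "degree r = n" using Suc(2) r r0 by (simp add: degree_mult_eq del: mult_pCons_left)
  moreover have "r \<in> nonpos_rooted_polys"
    using Suc(3) r p0 unfolding nonpos_rooted_polys_def
    by (auto simp: map_poly_of_real_mult simp del: mult_pCons_left)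
  ultimately obtain c a where a: "q_newton 1 a" "\<And>k. coeff r k = c * a k" using Suc(1) by blast
  show ?case
  proof (cases "s = 0")
    case True
    show ?thesis
      by (rule exI[of _ c], rule exI[of _ "case_nat 0 a"])
        (use q_newton_shift[OF _ a(1)] a(2) True r in \<open>auto simp: coeff_pCons split: nat.split\<close>)
  next
    case False
    with s have s0: "s < 0" by simp
    have "q_newton 1 (mul_linear (1 / (- s)) a)"
      using s0 q_newton_nonneg[OF a(1)] by (intro q_newton_mul_linear[OF _ _ a(1)]) (auto simp: divide_nonneg_neg)
    moreover have "coeff p k = (c * (- s)) * mul_linear (1 / (- s)) a k" for k
    proof -
      have e: "coeff p k = coeff (pCons 0 r) k - s * coeff r k" unfolding r by simp
      show ?thesis unfolding e using s0 by (cases k) (simp_all add: mul_linear_def a(2) field_simps)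
    qed
    ultimately show ?thesis by blast
  qed
qed

lemma power_series_coeff_eq:
  assumes "\<And>z::complex. (\<lambda>k. c k * z ^ k) sums f z"
  shows "c k = (deriv ^^ k) f 0 / fact k"
proof -
  define C where "C = Abs_fps c"
  have sm: "summable (\<lambda>k. fps_nth C k * z ^ k)" for z :: complex
    using assms[of z] by (simp add: C_def sums_iff)
  have "fps_conv_radius C \<ge> ereal r" for r
    unfolding fps_conv_radius_def
    by (rule conv_radius_geI_ex') (use sm[of "of_real _"] in auto)
  then have "fps_conv_radius C > 0" using order.strict_trans2[of 0 "ereal 1"] by auto
  moreover have "eval_fps C z = f z" for z
    using assms[of z] by (simp add: eval_fps_def C_def sums_iff)
  ultimately have "f has_fps_expansion C" by (simp add: has_fps_expansion_def)
  then show ?thesis using fps_nth_fps_expansion[of f C k] by (simp add: C_def)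
qed

lemma power_series_holomorphic_UNIV:
  assumes "\<And>z::complex. (\<lambda>k. c k * z ^ k) sums f z"
  shows "f holomorphic_on UNIV"
proof -
  have "f holomorphic_on ball 0 (norm z + 1)" for z :: complex
    by (rule power_series_holomorphic[where a = c]) (use assms in simp)
  then have "f field_differentiable (at z)" for z
    using holomorphic_on_imp_differentiable_at[of f "ball 0 (norm z + 1)" z] by simp
  then show ?thesis by (auto simp: holomorphic_on_def intro: field_differentiable_at_within)
qed

text \<open>Cauchy's estimate on the unit circle bounds every coefficient of \<open>f n - g\<close>
  by the supremum of that difference.\<close>

lemma power_series_coeffs_tendsto:
  fixes a :: "nat \<Rightarrow> nat \<Rightarrow> complex"
  assumes a: "\<And>n z. (\<lambda>k. a n k * z ^ k) sums f n z" and b: "\<And>z. (\<lambda>k. b k * z ^ k) sums g z"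
    and lim: "uniform_limit (cball 0 1) f g sequentially"
  shows "(\<lambda>n. a n k) \<longlonglongrightarrow> b k"
proof (rule tendstoI)
  fix e :: real assume e: "0 < e"
  have "eventually (\<lambda>n. \<forall>z\<in>cball 0 1. dist (f n z) (g z) < e / 2) sequentially"
    using uniform_limitD[OF lim, of "e / 2"] e by simp
  then show "eventually (\<lambda>n. dist (a n k) (b k) < e) sequentially"
  proof eventually_elim
    case (elim n)
    define h where "h z = f n z - g z" for z
    have h: "(\<lambda>k. (a n k - b k) * z ^ k) sums h z" for z
      using sums_diff[OF a[of n z] b[of z]] by (simp add: h_def algebra_simps)
    have hol: "h holomorphic_on UNIV" using h by (rule power_series_holomorphic_UNIV)
    have "norm ((deriv ^^ k) h 0) \<le> fact k * (e / 2) / 1 ^ k"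
    proof (rule Cauchy_inequality)
      show "h holomorphic_on ball 0 1" using hol by (rule holomorphic_on_subset) simp
      show "continuous_on (cball 0 1) h"
        using hol by (intro holomorphic_on_imp_continuous_on) (rule holomorphic_on_subset, auto)
      show "norm (h x) \<le> e / 2" if "norm (0 - x) = 1" for x
        using elim[rule_format, of x] that by (simp add: h_def dist_norm)
    qed simp
    then have "norm (a n k - b k) \<le> e / 2"
      unfolding power_series_coeff_eq[OF h] by (simp add: norm_divide field_simps)
    then show ?case using e by (simp add: dist_norm)
  qed
qed

lemma poly_sums: "(\<lambda>k. coeff p k * z ^ k) sums poly p (z :: 'a :: {comm_semiring_1, real_normed_algebra_1})"
  unfolding poly_altdef by (rule sums_finite) (auto simp: coeff_eq_0)

lemma PN_bar_1_subset: "PN_bar 1 \<subseteq> LC_plus_bar"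
proof
  fix A assume "A \<in> PN_bar 1"
  then obtain g where g: "g \<in> N_bar_1"
    and A: "\<And>z. (\<lambda>k. of_real (C_inf 1 k * fps_nth A k) * z ^ k) sums g z"
    by (auto simp: PN_bar_def N_bar_def)
  obtain P where P: "\<And>i. P i \<in> nonpos_rooted_polys"
    and lim: "\<And>K. compact K \<Longrightarrow> uniform_limit K (\<lambda>i z. cpoly (P i) z) g sequentially"
    using g by (auto simp: N_bar_1_def)
  have "(\<lambda>i. coeff (map_poly complex_of_real (P i)) k) \<longlonglongrightarrow> of_real (C_inf 1 k * fps_nth A k)" for k
    by (rule power_series_coeffs_tendsto[OF poly_sums A]) (simp add: lim)
  then have "(\<lambda>i. complex_of_real (coeff (P i) k)) \<longlonglongrightarrow> of_real (C_inf 1 k * fps_nth A k)" for k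
    by (simp add: coeff_map_poly)
  then have l: "(\<lambda>i. coeff (P i) k) \<longlonglongrightarrow> C_inf 1 k * fps_nth A k" for k
    by (simp only: tendsto_of_real_iff)
  have C: "C_inf 1 k \<noteq> 0" for k using C_inf_pos[of 1 k] by simp
  show "A \<in> LC_plus_bar"
  proof (rule LC_plus_bar_limit)
    show "Abs_fps (\<lambda>k. coeff (P i) k / C_inf 1 k) \<in> LC_plus_bar" for i
    proof -
      obtain c a where "q_newton 1 a" "\<And>k. coeff (P i) k = c * a k"
        using nonpos_rooted_polys_q_newton[OF P] by blast
      then show ?thesis using q_newton_LC_plus_bar[of 1 a c] by simp
    qed
    show "(\<lambda>i. fps_nth (Abs_fps (\<lambda>k. coeff (P i) k / C_inf 1 k)) k) \<longlonglongrightarrow> fps_nth A k" for k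
      using tendsto_divide[OF l[of k] tendsto_const[of "C_inf 1 k"]] C[of k] by simp
  qed
qed

text \<open>Adding the largest root last makes the separation hypothesis of
  \<open>q_newton_mul_linear\<close> an invariant.\<close>

lemma q_separated_prod_q_newton:
  fixes r :: "'i \<Rightarrow> real"
  assumes q: "0 < q" "q \<le> 1" and "finite J" and "\<And>j. j \<in> J \<Longrightarrow> 0 < r j"
    and "\<And>i j. i \<in> J \<Longrightarrow> j \<in> J \<Longrightarrow> i \<noteq> j \<Longrightarrow> r i \<le> r j \<Longrightarrow> r i \<le> q * r j"
  shows "q_newton q (coeff (\<Prod>j\<in>J. [:1, r j:])) \<and> (\<forall>R. (\<forall>j\<in>J. r j \<le> q * R) \<longrightarrow> 0 \<le> R \<longrightarrow>
    (\<forall>k. (1 - q) * qnum q (Suc k) * coeff (\<Prod>j\<in>J. [:1, r j:]) (Suc k) \<le>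
      q ^ Suc k * R * coeff (\<Prod>j\<in>J. [:1, r j:]) k))"
  using assms(3-)
proof (induction "card J" arbitrary: J)
  case 0
  then have "J = {}" by simp
  then show ?case using q q_newton_one[OF q(1)] by simp
next
  case (Suc n)
  have "J \<noteq> {}" using Suc(2) by auto
  then have "Max (r ` J) \<in> r ` J" using Suc(3) by (intro Max_in) auto
  then obtain i where i: "i \<in> J" "r i = Max (r ` J)" by auto
  then have max: "r j \<le> r i" if "j \<in> J" for j using Suc(3) that by simp
  define I where "I = J - {i}"
  define p where "p = (\<Prod>j\<in>I. [:1, r j:])"
  have I: "card I = n" "finite I" using Suc(2,3) i by (auto simp: I_def)
  have pos: "0 < r i" by (rule Suc(4)[OF i(1)])
  have IH: "q_newton q (coeff p)"
    "\<And>R k. (\<And>j. j \<in> I \<Longrightarrow> r j \<le> q * R) \<Longrightarrow> 0 \<le> R \<Longrightarrow>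
       (1 - q) * qnum q (Suc k) * coeff p (Suc k) \<le> q ^ Suc k * R * coeff p k"
    using Suc(1)[of I] I Suc(4,5) unfolding p_def I_def by auto
  have sep: "(1 - q) * qnum q (Suc k) * coeff p (Suc k) \<le> q ^ Suc k * r i * coeff p k" for k
  proof (rule IH(2))
    show "r j \<le> q * r i" if "j \<in> I" for j
      using that max[of j] Suc(5)[of j i] i(1) by (auto simp: I_def)
  qed (use pos in simp)
  have J: "(\<Prod>j\<in>J. [:1, r j:]) = [:1, r i:] * p"
    unfolding p_def I_def using i Suc(3) by (simp add: prod.remove del: mult_pCons_left)
  have nn: "0 \<le> coeff p k" for k using IH(1) by (rule q_newton_nonneg)
  \<comment> \<open>The separation invariant for the enlarged product: the assumption
    \<open>r i \<le> q * R\<close> trades the factor r_i q^k for R q^(k+1).\<close>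
  have bound: "(1 - q) * qnum q (Suc k) * mul_linear (r i) (coeff p) (Suc k) \<le>
      q ^ Suc k * R * mul_linear (r i) (coeff p) k" if R: "r i \<le> q * R" "0 \<le> R" for R k
  proof -
    define x where "x = coeff p k"
    define v where "v = (case k of 0 \<Rightarrow> 0 | Suc l \<Rightarrow> coeff p l)"
    have x: "0 \<le> x" and v: "0 \<le> v" using nn by (auto simp: x_def v_def split: nat.split)
    \<comment> \<open>The bound \<open>sep\<close> one index lower; at k = 0 it holds because the
      q-integer of 0 is 0.\<close>
    have S: "(1 - q) * qnum q k * x \<le> q ^ k * r i * v"
    proof (cases k)
      case (Suc l)
      then show ?thesis using sep[of l] by (simp add: x_def v_def del: power_Suc)
    qed (simp add: v_def)
    have "(1 - q) * qnum q (Suc k) * (coeff p (Suc k) + r i * x) =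
        (1 - q) * qnum q (Suc k) * coeff p (Suc k) + (1 - q ^ Suc k) * (r i * x)"
      unfolding power_eq_qnum[of q "Suc k"] by (simp only: distrib_left diff_diff_eq2 add_diff_cancel_left')
    also have "\<dots> \<le> q ^ Suc k * r i * x + (1 - q ^ Suc k) * (r i * x)"
      using sep[of k] by (simp add: x_def del: power_Suc)
    also have "\<dots> = r i * (q ^ k * x + (1 - q) * qnum q k * x)"
      unfolding distrib_right[symmetric] by (simp add: power_eq_qnum[of q k] algebra_simps)
    also have "\<dots> \<le> r i * (q ^ k * x + q ^ k * r i * v)"
      using S pos by (intro mult_left_mono) auto
    also have "\<dots> = r i * (q ^ k * (x + r i * v))" by (simp add: algebra_simps)
    also have "\<dots> \<le> (q * R) * (q ^ k * (x + r i * v))"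
      using R x v pos q by (intro mult_right_mono) auto
    also have "\<dots> = q ^ Suc k * R * (x + r i * v)" by simp
    finally show ?thesis by (cases k) (simp_all add: mul_linear_def x_def v_def)
  qed
  show ?case unfolding J coeff_mult_linear
    using q_newton_mul_linear[OF q IH(1) pos sep] bound i(1) by blast
qed

lemma power_series_tannery:
  fixes c :: "nat \<Rightarrow> nat \<Rightarrow> complex"
  assumes lim: "\<And>k. (\<lambda>n. c n k) \<longlonglongrightarrow> d k" and dom: "\<And>n k. norm (c n k) \<le> D k"
    and D: "summable (\<lambda>k. D k * norm z ^ k)"
    and f: "\<And>n. (\<lambda>k. c n k * z ^ k) sums f n"
  shows "f \<longlonglongrightarrow> (\<Sum>k. d k * z ^ k) \<and> summable (\<lambda>k. d k * z ^ k)"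
proof -
  have "eventually (\<lambda>n. summable (\<lambda>k. norm (c n k * z ^ k))) sequentially \<and>
      summable (\<lambda>k. norm (d k * z ^ k)) \<and>
      (\<lambda>n. \<Sum>k. c n k * z ^ k) \<longlonglongrightarrow> (\<Sum>k. d k * z ^ k)"
  proof (rule tannerys_theorem[where M = "\<lambda>k. D k * norm z ^ k"])
    show "(\<lambda>n. c n k * z ^ k) \<longlonglongrightarrow> d k * z ^ k" for k
      by (intro tendsto_intros lim)
    show "eventually (\<lambda>(k, n). norm (c n k * z ^ k) \<le> D k * norm z ^ k) (at_top \<times>\<^sub>F sequentially)"
      using dom by (intro always_eventually) (auto simp: norm_mult norm_power intro!: mult_right_mono)
  qed (use D in auto)
  moreover have "(\<lambda>n. \<Sum>k. c n k * z ^ k) = f" using f by (auto simp: sums_iff)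
  ultimately show ?thesis
    using summable_norm_cancel by auto
qed

lemma poly_prod_linear:
  fixes d :: nat
  shows "cpoly (\<Prod>j<d. [:1, r j:]) z = (\<Prod>j<d. 1 + complex_of_real (r j) * z)"
proof (induction d)
  case (Suc d)
  show ?case unfolding prod.lessThan_Suc map_poly_of_real_mult poly_mult Suc
    by (simp add: map_poly_pCons mult.commute)
qed simp

text \<open>The partial products are polynomials with q-separated zeros, to which the Newton
  inequalities apply. The definition of the class gives only pointwise convergence of the product,
  so locally uniform convergence, and with it convergence of coefficients, has to be recovered from
  positivity of the numbers -1 / x_j.\<close>

lemma PN_bar_less_1_subset:
  assumes q: "0 < q" "q < 1"
  shows "PN_bar q \<subseteq> LC_plus_bar"
proof
  fix A assume "A \<in> PN_bar q"
  then obtain g where g: "g \<in> N_bar_less_1 q"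
    and A: "\<And>z. (\<lambda>k. of_real (C_inf q k * fps_nth A k) * z ^ k) sums g z"
    using q by (auto simp: PN_bar_def N_bar_def)
  obtain a m n x where x: "\<And>j. enat j < n \<Longrightarrow> x j < 0" and sep: "q_separated q n x"
    and prod: "\<And>z. \<exists>p. (\<lambda>j. if enat j < n then 1 - z / of_real (x j) else 1) has_prod p \<and>
               g z = of_real a * z ^ m * p"
    using g unfolding N_bar_less_1_def by blast
  \<comment> \<open>The value 0 beyond the length of the sequence makes the corresponding factors
    equal to 1.\<close>
  define r where "r j = (if enat j < n then - 1 / x j else 0)" for j
  define p where "p N = (\<Prod>j<N. [:1, r j:])" for N
  have r0: "0 \<le> r j" for j using x[of j] by (auto simp: r_def divide_nonneg_neg)
  define h where "h = coeff \<circ> p"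
  have newton: "q_newton q (h N)" for N
  proof -
    define J where "J = {j. j < N \<and> enat j < n}"
    have "p N = (\<Prod>j\<in>J. [:1, r j:])"
      unfolding p_def by (rule prod.mono_neutral_right) (auto simp: J_def r_def one_pCons)
    moreover have "q_newton q (coeff (\<Prod>j\<in>J. [:1, r j:]))"
    proof (rule q_separated_prod_q_newton[THEN conjunct1])
      show "finite J" by (simp add: J_def)
      show "0 < r j" if "j \<in> J" for j using that x[of j] by (simp add: J_def r_def divide_neg_neg)
      show "r i \<le> q * r j" if ij: "i \<in> J" "j \<in> J" "i \<noteq> j" "r i \<le> r j" for i j
      proof -
        have xx: "x i < 0" "x j < 0" using ij x by (auto simp: J_def)
        then have "x i \<le> x j" using ij by (simp add: J_def r_def divide_simps split: if_splits)
        then have "x j / x i \<le> q" using sep ij xx unfolding q_separated_def J_def by blast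
        then show ?thesis using xx ij by (simp add: J_def r_def field_simps)
      qed
    qed (use q in auto)
    ultimately show ?thesis by (simp add: h_def)
  qed
  define P where "P z = (SOME p. (\<lambda>j. if enat j < n then 1 - z / of_real (x j) else 1) has_prod p \<and>
               g z = of_real a * z ^ m * p)" for z
  have P: "(\<lambda>j. if enat j < n then 1 - z / of_real (x j) else 1) has_prod P z"
      "g z = of_real a * z ^ m * P z" for z
    using someI_ex[OF prod[of z]] unfolding P_def by auto
  have pe: "(\<lambda>j. if enat j < n then 1 - z / of_real (x j) else 1) = (\<lambda>j. 1 + of_real (r j) * z)" for z :: complex
    by (auto simp: r_def)
  have lim: "(\<lambda>N. \<Prod>j<N. 1 + of_real (r j) * z) \<longlonglongrightarrow> P z" for z :: complex
    using has_prod_imp_tendsto'[OF P(1)[of z, unfolded pe]] .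
  \<comment> \<open>At z = 1 the factors are 1 + r_j with r_j nonnegative, so a bound for the
    partial products is also a bound for the partial sums of r.\<close>
  have "Bseq (\<lambda>N. \<Prod>j<N. 1 + complex_of_real (r j) * 1)"
    using lim[of 1] by (intro convergent_imp_Bseq) (auto simp: convergent_def)
  then obtain L where L: "\<And>N. norm (\<Prod>j<N. 1 + complex_of_real (r j) * 1) \<le> L" unfolding Bseq_def by blast
  have sr: "summable r"
  proof (rule summableI_nonneg_bounded[OF r0])
    show "(\<Sum>j<N. r j) \<le> L" for N
    proof -
      have "(\<Sum>j<N. r j) \<le> (\<Prod>j<N. 1 + r j)" using r0 by (intro sum_le_prod)
      also have "\<dots> = norm (complex_of_real (\<Prod>j<N. 1 + r j))"
        using r0 by (simp only: norm_of_real) (simp add: prod_nonneg)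
      also have "\<dots> \<le> L" using L[of N] by simp
      finally show ?thesis .
    qed
  qed
  have "uniformly_convergent_on (cball 0 1) (\<lambda>N z. \<Prod>j<N. 1 + complex_of_real (r j) * z)"
  proof (rule uniformly_convergent_on_prod)
    show "uniformly_convergent_on (cball 0 1) (\<lambda>N z. \<Sum>j<N. norm (complex_of_real (r j) * z))"
      by (rule Weierstrass_m_test'[OF _ sr]) (use r0 in \<open>auto simp: norm_mult mult_left_le\<close>)
  qed (auto intro!: continuous_intros)
  moreover have "(\<lambda>z. lim (\<lambda>N. \<Prod>j<N. 1 + complex_of_real (r j) * z)) = P" using lim by (auto simp: limI)
  ultimately have ul: "uniform_limit (cball 0 1) (\<lambda>N z. \<Prod>j<N. 1 + of_real (r j) * z) P sequentially"
    unfolding uniformly_convergent_uniform_limit_iff by simp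
  have U: "uniform_limit (cball 0 1) (\<lambda>N z. of_real a * z ^ m * (\<Prod>j<N. 1 + of_real (r j) * z))
      (\<lambda>z. of_real a * z ^ m * P z) sequentially"
  proof (rule uniform_lim_mult[OF uniform_limit_const ul])
    have "continuous_on (cball 0 1) P"
      by (rule uniform_limit_theorem[OF _ ul]) (auto intro!: always_eventually continuous_intros)
    then show "bounded (P ` cball 0 1)" by (intro compact_imp_bounded compact_continuous_image) auto
    show "bounded ((\<lambda>z. complex_of_real a * z ^ m) ` cball 0 1)"
      by (intro compact_imp_bounded compact_continuous_image continuous_intros) auto
  qed
  have e: "cpoly (smult a (monom 1 m * p N)) z = of_real a * z ^ m * (\<Prod>j<N. 1 + of_real (r j) * z)"
    for N and z :: complex
    unfolding p_def map_poly_smult[of complex_of_real, simplified] poly_smult map_poly_of_real_mult poly_mult poly_prod_linear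
    by (simp add: map_poly_monom poly_monom)
  have "uniform_limit (cball 0 1) (\<lambda>N. cpoly (smult a (monom 1 m * p N))) g sequentially"
    using U unfolding e[symmetric] P(2)[symmetric] .
  from power_series_coeffs_tendsto[OF poly_sums A this]
  have "(\<lambda>N. complex_of_real (coeff (smult a (monom 1 m * p N)) k)) \<longlonglongrightarrow> of_real (C_inf q k * fps_nth A k)" for k
    by (simp add: coeff_map_poly)
  then have co: "(\<lambda>N. coeff (smult a (monom 1 m * p N)) k) \<longlonglongrightarrow> C_inf q k * fps_nth A k" for k
    by (simp only: tendsto_of_real_iff)
  have C: "C_inf q k \<noteq> 0" for k using C_inf_pos[of q k] q by simp
  have sh: "coeff (monom 1 i * p N) = (case_nat 0 ^^ i) (h N)" for i N
  proof (induction i)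
    case (Suc i)
    have "monom 1 (Suc i) * p N = pCons 0 (monom 1 i * p N)" by (simp add: monom_Suc)
    then show ?case by (simp add: Suc[symmetric] coeff_pCons fun_eq_iff split: nat.split)
  qed (simp add: h_def)
  have nw: "q_newton q ((case_nat 0 ^^ i) (h N))" for i N
    by (induction i) (use newton q_newton_shift[OF q(1)] in auto)
  show "A \<in> LC_plus_bar"
  proof (rule LC_plus_bar_limit)
    show "Abs_fps (\<lambda>k. a * coeff (monom 1 m * p N) k / C_inf q k) \<in> LC_plus_bar" for N
      unfolding sh using q by (intro q_newton_LC_plus_bar nw) auto
    show "(\<lambda>N. fps_nth (Abs_fps (\<lambda>k. a * coeff (monom 1 m * p N) k / C_inf q k)) k) \<longlonglongrightarrow> fps_nth A k" for k
      using tendsto_divide[OF co[of k] tendsto_const C[of k]] C[of k] by simp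
  qed
qed

lemma PN_bar_subset_LC_plus_bar:
  assumes "0 < q" "q \<le> 1"
  shows "PN_bar q \<subseteq> LC_plus_bar"
  using assms PN_bar_1_subset PN_bar_less_1_subset[of q] by (cases "q = 1") auto

subsection \<open>Schur composition and q-separation\<close>

text \<open>The logarithmic derivative is the sum of 1 / (x - a) over the roots a, as in the
  Gauss-Lucas theorem, and each x - a has nonnegative imaginary part. The boundary point x = 0 is
  admissible because no root is 0.\<close>

lemma Im_log_deriv_nonpos:
  assumes "p \<noteq> 0" and "\<And>a. poly p a = 0 \<Longrightarrow> Im a \<le> 0 \<and> a \<noteq> 0" and x: "0 < Im x \<or> x = 0"
  shows "Im (poly (pderiv p) x / poly p x) \<le> 0"
  using assms(1,2)
proof (induction "degree p" arbitrary: p)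
  case 0
  then obtain c where "p = [:c:]" by (metis degree_eq_zeroE)
  then show ?case by simp
next
  case (Suc n)
  obtain a where a: "poly p a = 0"
    using fundamental_theorem_of_algebra_alt[of p] Suc(2) by (metis degree_pCons_0 nat.distinct(1))
  then obtain r where r: "p = [:- a, 1:] * r" by (auto simp: poly_eq_0_iff_dvd elim: dvdE)
  have r0: "r \<noteq> 0" using r Suc(3) by auto
  have "degree r = n" using Suc(2) r r0 by (simp add: degree_mult_eq del: mult_pCons_left)
  then have IH: "Im (poly (pderiv r) x / poly r x) \<le> 0"
    using r by (intro Suc(1) r0 Suc(4)) (auto simp del: mult_pCons_left)
  have ia: "Im a \<le> 0" "a \<noteq> 0" using Suc(4)[OF a] by auto
  have "poly p x \<noteq> 0" using Suc(4)[of x] x by auto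
  then have nz': "x - a \<noteq> 0" "poly r x \<noteq> 0" using r by (auto simp: algebra_simps)
  have e1: "poly (pderiv p) x = poly r x + (x - a) * poly (pderiv r) x"
    unfolding r pderiv_mult poly_add poly_mult by (simp add: pderiv_pCons algebra_simps)
  have e2: "poly p x = (x - a) * poly r x" unfolding r by (simp add: algebra_simps)
  have "poly (pderiv p) x / poly p x = 1 / (x - a) + poly (pderiv r) x / poly r x"
    unfolding e1 e2 using nz' by (simp add: add_divide_distrib)
  moreover have "Im (1 / (x - a)) \<le> 0"
  proof -
    have "0 \<le> Im (x - a)" using x ia by auto
    then show ?thesis unfolding Im_divide by (simp add: divide_nonpos_nonneg)
  qed
  ultimately show ?case using IH by simp
qed

fun iter_deriv :: "real list \<Rightarrow> complex \<Rightarrow> complex poly \<Rightarrow> complex poly" where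
  "iter_deriv [] z p = p"
| "iter_deriv (r # rs) z p = iter_deriv rs z (p + smult (of_real r * z) (pderiv p))"

text \<open>The point \<open>0\<close> on the boundary of the half-plane is where the operator
  \<open>\<Prod>(1 + r z d/dx)\<close> is evaluated to yield the composition.\<close>

lemma iter_deriv_nonzero:
  assumes "\<And>r. r \<in> set rs \<Longrightarrow> 0 < r" and z: "0 < Im z"
    and "\<And>x. 0 < Im x \<or> x = 0 \<Longrightarrow> poly p x \<noteq> 0" and x: "0 < Im x \<or> x = 0"
  shows "poly (iter_deriv rs z p) x \<noteq> 0"
  using assms(1,3)
proof (induction rs arbitrary: p)
  case (Cons r rs)
  have r: "0 < r" using Cons(2) by simp
  have p0: "p \<noteq> 0" using Cons(3)[of 0] by auto
  have "poly (p + smult (of_real r * z) (pderiv p)) y \<noteq> 0" if y: "0 < Im y \<or> y = 0" for y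
  proof
    assume *: "poly (p + smult (of_real r * z) (pderiv p)) y = 0"
    have py: "poly p y \<noteq> 0" using Cons(3) y by blast
    have z0: "z \<noteq> 0" using z by auto
    \<comment> \<open>A zero of p + r z p' forces p'/p = -1 / (r z). Since z lies in the upper
      half-plane this value has positive imaginary part, against the bound for logarithmic
      derivatives.\<close>
    have "poly (pderiv p) y / poly p y = - (1 / (of_real r * z))"
      using * py z0 r by (simp add: field_simps add_eq_0_iff)
    moreover have "Im (poly (pderiv p) y / poly p y) \<le> 0"
    proof (rule Im_log_deriv_nonpos[OF p0 _ y])
      show "Im a \<le> 0 \<and> a \<noteq> 0" if "poly p a = 0" for a
        using Cons(3)[of a] that by (metis linorder_not_le)
    qed
    moreover have "0 < Im (- (1 / (of_real r * z)))"
    proof -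
      have "0 < Im (of_real r * z)" using z r by simp
      then show ?thesis
        by (simp only: inverse_eq_divide[symmetric] uminus_complex.sel inverse_complex.sel minus_divide_left minus_minus)
          (intro divide_pos_pos add_nonneg_pos, auto)
    qed
    ultimately show False by simp
  qed
  then show ?case using Cons(1)[of "p + smult (of_real r * z) (pderiv p)"] Cons(2) by simp
qed (use x in simp)

definition linear_prod :: "real list \<Rightarrow> real poly" where
  "linear_prod rs = (\<Prod>r\<leftarrow>rs. [:1, r:])"

lemma linear_prod_simps [simp]:
  "linear_prod [] = 1" "linear_prod (r # rs) = [:1, r:] * linear_prod rs"
  by (simp_all add: linear_prod_def)

text \<open>Expanding the operator in powers of d/dx, the k-th derivative carries the coefficient
  z^k times the k-th coefficient of \<open>linear_prod rs\<close>. The factor k! arises because the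
  k-th derivative of p at 0 is k! times its coefficient.\<close>

lemma iter_deriv_at_0:
  assumes "degree p \<le> N"
  shows "poly (iter_deriv rs z p) 0 =
    (\<Sum>k\<le>N. fact k * of_real (coeff (linear_prod rs) k) * coeff p k * z ^ k)"
  using assms
proof (induction rs arbitrary: p)
  case Nil
  have "(\<Sum>k\<le>N. fact k * of_real (coeff (linear_prod []) k) * coeff p k * z ^ k) =
      (\<Sum>k\<in>{0}. fact k * of_real (coeff (linear_prod []) k) * coeff p k * z ^ k)"
    by (rule sum.mono_neutral_right) auto
  then show ?case by (simp add: poly_0_coeff_0)
next
  case (Cons r rs)
  let ?c = "\<lambda>k. complex_of_real (coeff (linear_prod rs) k)"
  let ?p = "p + smult (of_real r * z) (pderiv p)"
  have deg: "degree ?p \<le> N"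
    using Cons(2) by (intro degree_add_le) (auto simp: degree_pderiv intro: order.trans[OF degree_smult_le])
  have "poly (iter_deriv (r # rs) z p) 0 = (\<Sum>k\<le>N. fact k * ?c k * coeff ?p k * z ^ k)"
    using Cons(1)[OF deg] by simp
  also have "\<dots> = (\<Sum>k\<le>N. fact k * ?c k * coeff p k * z ^ k) +
      (\<Sum>k\<le>N. fact (Suc k) * (of_real r * ?c k) * coeff p (Suc k) * z ^ Suc k)"
    by (simp add: sum.distrib[symmetric] coeff_pderiv algebra_simps)
  also have "(\<Sum>k\<le>N. fact (Suc k) * (of_real r * ?c k) * coeff p (Suc k) * z ^ Suc k) =
      (\<Sum>k\<le>N. fact k * (case k of 0 \<Rightarrow> 0 | Suc l \<Rightarrow> of_real r * ?c l) * coeff p k * z ^ k)"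
  proof -
    let ?f = "\<lambda>k. fact k * (case k of 0 \<Rightarrow> 0 | Suc l \<Rightarrow> of_real r * ?c l) * coeff p k * z ^ k"
    have "sum ?f {..Suc N} = (\<Sum>k\<le>N. ?f (Suc k))"
      by (subst sum.atMost_Suc_shift) simp
    moreover have "sum ?f {..Suc N} = sum ?f {..N}"
      using Cons(2) by (simp add: coeff_eq_0)
    ultimately show ?thesis by simp
  qed
  also have "(\<Sum>k\<le>N. fact k * ?c k * coeff p k * z ^ k) + \<dots> =
      (\<Sum>k\<le>N. fact k * of_real (coeff (linear_prod (r # rs)) k) * coeff p k * z ^ k)"
    unfolding sum.distrib[symmetric] linear_prod_simps coeff_mult_linear
    by (intro sum.cong refl) (auto simp: mul_linear_def algebra_simps split: nat.split)
  finally show ?case .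
qed

text \<open>The partial products of \<open>\<Sum>\<^sub>k C\<^sub>k\<^sup>\<infinity>(q) z\<^sup>k = \<Prod>\<^sub>i (1 + q\<^sup>i z)\<close>.\<close>

definition q_exp_poly :: "real \<Rightarrow> nat \<Rightarrow> real poly" where
  "q_exp_poly q N = (\<Prod>i<N. [:1, q ^ i:])"

text \<open>Replacing z by q z shifts the index of every factor by one, so only the first and the
  last factor differ. This is the finite form of E(z) = (1 + z) E(q z); comparing coefficients
  yields a two-term recursion.\<close>

lemma q_exp_poly_scale:
  "pcompose (q_exp_poly q N) [:0, q:] * [:1, 1:] = q_exp_poly q N * [:1, q ^ N:]"
proof (induction N)
  case (Suc N)
  have e: "q_exp_poly q (Suc N) = q_exp_poly q N * [:1, q ^ N:]" by (simp add: q_exp_poly_def)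
  have "pcompose (q_exp_poly q (Suc N)) [:0, q:] * [:1, 1:] =
      (pcompose (q_exp_poly q N) [:0, q:] * [:1, 1:]) * [:1, q ^ Suc N:]"
  proof -
    have "pcompose [:1, q ^ N:] [:0, q:] = [:1, q ^ Suc N:]" by (simp add: pcompose_pCons mult_ac)
    then show ?thesis unfolding e pcompose_mult by (simp only: mult_ac)
  qed
  also have "\<dots> = q_exp_poly q (Suc N) * [:1, q ^ Suc N:]" unfolding Suc e by simp
  finally show ?case .
qed (simp add: q_exp_poly_def one_pCons pcompose_pCons)

lemma coeff_pcompose_scale: "coeff (pcompose p [:0, c:]) k = c ^ k * coeff p (k :: nat)"
  for p :: "'a :: comm_ring_1 poly"
  by (induction p arbitrary: k) (auto simp: pcompose_pCons coeff_pCons algebra_simps split: nat.split)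

lemma coeff_q_exp_poly_Suc:
  "coeff (q_exp_poly q N) (Suc k) * (1 - q ^ Suc k) = coeff (q_exp_poly q N) k * (q ^ k - q ^ N)"
proof -
  have "coeff (pcompose (q_exp_poly q N) [:0, q:] * [:1, 1:]) (Suc k) =
      coeff (q_exp_poly q N * [:1, q ^ N:]) (Suc k)" unfolding q_exp_poly_scale ..
  then show ?thesis
    unfolding mult.commute[of _ "[:1, _:]"] coeff_mult_linear
    by (simp add: mul_linear_def coeff_pcompose_scale algebra_simps)
qed

lemma coeff_0_q_exp_poly: "coeff (q_exp_poly q N) 0 = 1"
  by (induction N) (simp_all add: q_exp_poly_def coeff_mult)

lemma coeff_q_exp_poly_nonneg: "0 \<le> q \<Longrightarrow> 0 \<le> coeff (q_exp_poly q N) k"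
proof (induction N arbitrary: k)
  case (Suc N)
  have e: "q_exp_poly q (Suc N) = [:1, q ^ N:] * q_exp_poly q N" by (simp add: q_exp_poly_def mult_ac)
  show ?case unfolding e coeff_mult_linear using Suc by (simp add: mul_linear_def split: nat.split)
qed (simp add: q_exp_poly_def)

text \<open>As q^N vanishes, the two-term recursion becomes that of the product defining
  \<open>C_inf\<close>.\<close>

lemma coeff_q_exp_poly_tendsto:
  assumes q: "0 < q" "q < 1"
  shows "(\<lambda>N. coeff (q_exp_poly q N) k) \<longlonglongrightarrow> C_inf q k"
proof (induction k)
  case 0
  then show ?case by (simp add: coeff_0_q_exp_poly)
next
  case (Suc k)
  have nz: "1 - q ^ Suc k \<noteq> 0" using q power_Suc_less_one[of q k] by simp
  have "(\<lambda>N. coeff (q_exp_poly q N) k * (q ^ k - q ^ N) / (1 - q ^ Suc k)) \<longlonglongrightarrow>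
      C_inf q k * (q ^ k - 0) / (1 - q ^ Suc k)"
    by (intro tendsto_intros Suc nz LIMSEQ_power_zero) (use q in auto)
  moreover have "coeff (q_exp_poly q N) k * (q ^ k - q ^ N) / (1 - q ^ Suc k) = coeff (q_exp_poly q N) (Suc k)" for N
    unfolding coeff_q_exp_poly_Suc[symmetric] using nz by simp
  moreover have "C_inf q k * (q ^ k - 0) / (1 - q ^ Suc k) = C_inf q (Suc k)"
    using q by (simp add: C_inf_def)
  ultimately show ?case by simp
qed

lemma poly_linear_prod_factor:
  "cpoly (linear_prod rs) z = (\<Prod>r\<leftarrow>rs. 1 + of_real r * z)"
proof (induction rs)
  case (Cons r rs)
  then show ?case
    by (simp only: linear_prod_simps map_poly_of_real_mult poly_mult) (simp add: map_poly_pCons mult.commute)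
qed simp

text \<open>After the common factors M are taken out, 1 + x + c (1 + Q x) remains, with Q = q^(N+1)
  left over by truncation. A zero would mean -x = (1 + c) / (1 + Q c), whose imaginary part has the
  sign of (1 - Q) Im c, so x would lie below the real axis. The case c = 0 says that the polynomial
  itself has no zero at these points.\<close>

lemma q_exp_poly_combination_nonzero:
  fixes c x :: complex
  assumes q: "0 < q" "q < 1" and c: "0 < Im c \<or> c = 0" and x: "0 < Im x \<or> x = 0"
  shows "cpoly (q_exp_poly q (Suc N)) x +
    c * cpoly (q_exp_poly q (Suc N)) (of_real q * x) \<noteq> 0"
proof -
  define M where "M = (\<Prod>i<N. 1 + of_real (q ^ Suc i) * x)"
  have ev: "cpoly (q_exp_poly q K) y = (\<Prod>i<K. 1 + of_real (q ^ i) * y)" for K y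
    unfolding q_exp_poly_def by (rule poly_prod_linear)
  have 1: "cpoly (q_exp_poly q (Suc N)) x = (1 + x) * M"
    unfolding ev M_def prod.lessThan_Suc_shift by simp
  have 2: "cpoly (q_exp_poly q (Suc N)) (of_real q * x) = M * (1 + of_real (q ^ Suc N) * x)"
    unfolding ev M_def by (simp add: mult_ac)
  have lin: "1 + of_real s * x \<noteq> 0" if "0 < s" for s
  proof
    assume "1 + of_real s * x = 0"
    then have "Im (1 + of_real s * x) = 0" "Re (1 + of_real s * x) = 0" by simp_all
    then show False using x that by auto
  qed
  have "1 + of_real (q ^ Suc i) * x \<noteq> 0" for i using q by (intro lin) simp
  then have M: "M \<noteq> 0" unfolding M_def by (simp del: power_Suc of_real_power)
  define Q where "Q = q ^ Suc N"
  have Q: "0 < Q" "Q < 1" using q unfolding Q_def by (auto intro: power_Suc_less_one simp del: power_Suc)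
  have main: "(1 + x) + c * (1 + of_real Q * x) \<noteq> 0"
  proof
    assume *: "(1 + x) + c * (1 + of_real Q * x) = 0"
    have ic: "0 < Im c"
      using c * lin[of 1] by auto
    have ix: "0 < Im x"
    proof (rule ccontr)
      assume "\<not> 0 < Im x"
      then have "c = - 1" using * x by (simp add: add_eq_0_iff)
      then show False using ic by simp
    qed
    have "(1 + c) * cnj (1 + of_real Q * c) = - (x * ((1 + of_real Q * c) * cnj (1 + of_real Q * c)))"
    proof -
      have "1 + c + x * (1 + of_real Q * c) = (1 + x) + c * (1 + of_real Q * x)"
        by (simp add: algebra_simps)
      then have "1 + c = - (x * (1 + of_real Q * c))" using * by (simp add: eq_neg_iff_add_eq_0)
      then show ?thesis by (metis minus_mult_left mult.assoc)
    qed
    also have "\<dots> = - (x * of_real ((norm (1 + of_real Q * c))\<^sup>2))"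
      by (simp only: complex_norm_square)
    finally have "Im ((1 + c) * cnj (1 + of_real Q * c)) = - (Im x * (norm (1 + of_real Q * c))\<^sup>2)"
      by simp
    moreover have "Im ((1 + c) * cnj (1 + of_real Q * c)) = Im c * (1 - Q)"
      by (simp add: algebra_simps)
    moreover have "0 < Im c * (1 - Q)" using ic Q by simp
    moreover have "0 \<le> Im x * (norm (1 + of_real Q * c))\<^sup>2" using ix by simp
    ultimately show False by linarith
  qed
  have "cpoly (q_exp_poly q (Suc N)) x +
      c * cpoly (q_exp_poly q (Suc N)) (of_real q * x) =
      M * ((1 + x) + c * (1 + of_real Q * x))"
    unfolding 1 2 Q_def by (simp add: algebra_simps)
  then show ?thesis using M main by simp
qed

lemma linear_prod_roots:
  assumes "poly p 0 = 1" and "\<And>z. cpoly p z = (0 :: complex) \<Longrightarrow> z \<in> of_real ` {..<0}"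
  shows "\<exists>rs. (\<forall>r\<in>set rs. 0 < r) \<and> p = linear_prod rs"
  using assms
proof (induction "degree p" arbitrary: p)
  case 0
  then obtain c where "p = [:c:]" by (metis degree_eq_zeroE)
  with 0 show ?case by (intro exI[of _ "[]"]) (simp add: one_pCons)
next
  case (Suc n)
  let ?h = "map_poly complex_of_real"
  have "0 < degree (?h p)" using Suc(2) by (simp add: degree_map_poly)
  then obtain z where z: "poly (?h p) z = 0"
    using fundamental_theorem_of_algebra_alt[of "?h p"] by (metis degree_pCons_0 less_irrefl)
  have p0: "p \<noteq> 0" using Suc(2) by auto
  obtain s where s: "z = of_real s" "s < 0" using Suc(4)[OF z] by auto
  then have "poly p s = 0" using z by (simp add: poly_map_poly_of_real)
  then obtain t where t: "p = [:- s, 1:] * t" by (auto simp: poly_eq_0_iff_dvd elim: dvdE)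
  define u where "u = smult (- s) t"
  have u: "p = [:1, 1 / (- s):] * u"
  proof -
    have "[:- s, 1:] = smult (- s) [:1, 1 / (- s):]" using s by simp
    then show ?thesis unfolding t u_def by (simp only: mult_smult_left mult_smult_right)
  qed
  have u0: "u \<noteq> 0" using p0 u by auto
  have "degree p = degree [:1, 1 / (- s):] + degree u" unfolding u
    by (rule degree_mult_eq) (use u0 in auto)
  then have "degree u = n" using Suc(2) s by simp
  moreover have "poly u 0 = 1" using Suc(3) unfolding u by simp
  moreover have "poly (?h u) z = 0 \<Longrightarrow> z \<in> of_real ` {..<0}" for z
    by (rule Suc(4)) (simp only: u map_poly_of_real_mult poly_mult mult_zero_right)
  ultimately obtain rs where "\<forall>r\<in>set rs. 0 < r" "u = linear_prod rs" using Suc(1) by blast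
  then show ?case using s u by (intro exI[of _ "1 / (- s) # rs"]) auto
qed

lemma tendsto_upper_half_Ln:
  assumes "((f :: 'a \<Rightarrow> complex) \<longlongrightarrow> of_real u) F" "0 < u"
  shows "((\<lambda>x. Im (Ln (f x))) \<longlongrightarrow> 0) F"
proof -
  have "((\<lambda>x. Im (Ln (f x))) \<longlongrightarrow> Im (Ln (of_real u))) F"
    using assms by (intro tendsto_intros) (auto simp: complex_nonpos_Reals_iff)
  then show ?thesis using assms(2) by simp
qed

text \<open>The argument of \<open>G z / G (q z)\<close>, computed factor by factor, tends to \<open>0\<close> at the
  origin and would exceed \<open>3\<pi>/2\<close> above a pair of roots violating \<open>q\<close>-separation.\<close>

lemma linear_prod_q_separated:
  assumes q: "0 < q" "q < 1" and pos: "\<And>r. r \<in> set rs \<Longrightarrow> 0 < r"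
    and nz: "\<And>c z. 0 < Im z \<Longrightarrow> 0 < Im c \<Longrightarrow>
      cpoly (linear_prod rs) z +
      c * cpoly (linear_prod rs) (of_real q * z) \<noteq> 0"
    and ij: "i < length rs" "j < length rs" "i \<noteq> j" "rs ! j \<le> rs ! i"
  shows "rs ! j \<le> q * rs ! i"
proof (rule ccontr)
  assume "\<not> ?thesis"
  then have lt: "q * rs ! i < rs ! j" by simp
  define d where "d = length rs"
  define a where "a k = rs ! k" for k
  have a: "0 < a k" if "k < d" for k using pos that by (simp add: a_def d_def)
  have aij: "0 < a i" "0 < a j" "q * a i < a j" "a j \<le> a i" using a ij lt by (auto simp: a_def d_def)
  \<comment> \<open>At -t the factors 1 + a_i z and 1 + a_j z are negative while 1 + q a_i z and 1 +
    q a_j z are positive. Such a t exists exactly because q-separation fails.\<close>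
  obtain t where t: "1 / a j < t" "t < 1 / (q * a i)"
    using dense[of "1 / a j" "1 / (q * a i)"] aij q by (auto simp: frac_less2)
  define D where "D k z = Im (Ln (1 + of_real (a k) * z)) - Im (Ln (1 + of_real (q * a k) * z))"
    for k and z :: complex
  define A where "A z = (\<Sum>k<d. D k z)" for z
  have nonreal: "1 + of_real s * z \<notin> \<real>\<^sub>\<le>\<^sub>0" if "0 < s" "0 < Im z" for s z
    using that by (auto simp: complex_nonpos_Reals_iff)
  \<comment> \<open>\<open>D k z\<close> is the argument of the quotient of the k-th factors, which
    lies in the upper half-plane. The arguments of numerator and denominator both lie in (0, pi), so
    subtracting them needs no branch correction.\<close>
  have D0: "0 \<le> D k z" if k: "k < d" and z: "0 < Im z" for k z
  proof -
    define u where "u = 1 + of_real (a k) * z"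
    define v where "v = 1 + of_real (q * a k) * z"
    have u: "u \<noteq> 0" "0 < Im u" and v: "v \<noteq> 0" "0 < Im v"
      using a[OF k] z q by (auto simp: u_def v_def complex_eq_iff)
    have iu: "0 < Im (Ln u)" "Im (Ln u) < pi" "0 < Im (Ln v)" "Im (Ln v) < pi"
      using Im_Ln_pos_lt[OF u(1)] Im_Ln_pos_lt[OF v(1)] u v by auto
    have e: "u / v = exp (Ln u - Ln v)" using u v by (simp add: exp_diff)
    have "Ln (u / v) = Ln u - Ln v" unfolding e using iu by (intro Ln_exp) auto
    moreover have "0 < Im (u / v)"
    proof -
      have "Im u * Re v - Re u * Im v = a k * (1 - q) * Im z"
        by (simp add: u_def v_def algebra_simps)
      also have "\<dots> > 0" using a[OF k] q z by simp
      finally show ?thesis using v by (simp add: Im_divide complex_neq_0 divide_pos_pos)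
    qed
    moreover from this have "u / v \<noteq> 0" by auto
    ultimately have "0 < Im (Ln u - Ln v)" using Im_Ln_pos_lt[of "u / v"] by metis
    then show ?thesis by (simp add: D_def u_def v_def)
  qed
  have cont: "continuous_on {z. 0 < Im z} A"
    unfolding A_def D_def
  proof (intro continuous_intros)
    show "1 + of_real (a k) * z \<notin> \<real>\<^sub>\<le>\<^sub>0" if "k \<in> {..<d}" "z \<in> {z. 0 < Im z}" for k z
      using that a by (intro nonreal) auto
    show "1 + of_real (q * a k) * z \<notin> \<real>\<^sub>\<le>\<^sub>0" if "k \<in> {..<d}" "z \<in> {z. 0 < Im z}" for k z
      using that a q by (intro nonreal) auto
  qed
  have conn: "connected (A ` {z. 0 < Im z})"
    using cont by (intro connected_continuous_image convex_connected convex_halfspace_Im_gt)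
  have "((\<lambda>e::real. A (\<i> * of_real e)) \<longlongrightarrow> (\<Sum>k<d. 0 - 0)) (at_right 0)"
    unfolding A_def D_def
  proof (intro tendsto_sum tendsto_diff)
    fix k
    show "((\<lambda>e::real. Im (Ln (1 + of_real (a k) * (\<i> * of_real e)))) \<longlongrightarrow> 0) (at_right 0)"
      by (rule tendsto_upper_half_Ln[of _ 1]) (auto intro!: tendsto_eq_intros)
    show "((\<lambda>e::real. Im (Ln (1 + of_real (q * a k) * (\<i> * of_real e)))) \<longlongrightarrow> 0) (at_right 0)"
      by (rule tendsto_upper_half_Ln[of _ 1]) (auto intro!: tendsto_eq_intros)
  qed
  then have "((\<lambda>e::real. A (\<i> * of_real e)) \<longlongrightarrow> 0) (at_right 0)" by simp
  then have "eventually (\<lambda>e. A (\<i> * of_real e) < 3 * pi / 2) (at_right (0::real))"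
    by (rule order_tendstoD) simp
  moreover have "eventually (\<lambda>e::real. 0 < e) (at_right 0)" by (rule eventually_at_right_less)
  ultimately have "eventually (\<lambda>e. A (\<i> * of_real e) < 3 * pi / 2 \<and> 0 < e) (at_right (0::real))"
    by eventually_elim simp
  then obtain e1 :: real where e1: "0 < e1" "A (\<i> * of_real e1) < 3 * pi / 2"
    using eventually_happens trivial_limit_at_right_real by blast
  let ?\<zeta> = "\<lambda>e. of_real (- t) + \<i> * of_real e"
  \<comment> \<open>Approaching -t from above, the numerator tends to a negative real with argument
    pi and the denominator to a positive real with argument 0.\<close>
  have Dpi: "((\<lambda>e::real. D k (?\<zeta> e)) \<longlongrightarrow> pi - 0) (at_right 0)"
    if k: "k = i \<or> k = j" for k
  proof -
    have ak: "0 < a k" "1 < a k * t" "q * a k * t < 1"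
    proof -
      show "0 < a k" using k aij by auto
      have "1 < a j * t" using t aij by (simp add: field_simps)
      moreover have tpos: "0 < t" using t aij by (meson less_trans zero_less_divide_1_iff)
      moreover have "q * a i * t < 1" using t aij q by (simp add: field_simps)
      moreover have "a j * t \<le> a i * t" "q * a j * t \<le> q * a i * t"
        by (intro mult_right_mono mult_left_mono; use tpos aij q in simp)+
      ultimately show "1 < a k * t" "q * a k * t < 1" using k
        by (metis order.strict_trans2) (metis \<open>q * a i * t < 1\<close> \<open>q * a j * t \<le> q * a i * t\<close> k order.strict_trans1)
    qed
    have "((\<lambda>e::real. Im (Ln (- (1 + of_real (a k) * (?\<zeta> e))))) \<longlongrightarrow> 0) (at_right 0)"
      by (rule tendsto_upper_half_Ln[of _ "a k * t - 1"]) (use ak in \<open>auto intro!: tendsto_eq_intros\<close>)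
    then have "((\<lambda>e::real. Im (Ln (- (1 + of_real (a k) * (?\<zeta> e)))) + pi) \<longlongrightarrow> 0 + pi) (at_right 0)"
      by (intro tendsto_intros)
    moreover have "eventually (\<lambda>e::real. Im (Ln (- (1 + of_real (a k) * (?\<zeta> e)))) + pi =
        Im (Ln (1 + of_real (a k) * (?\<zeta> e)))) (at_right 0)"
      using eventually_at_right_less[of "0::real"]
    proof eventually_elim
      case (elim e)
      define w where "w = 1 + of_real (a k) * (?\<zeta> e)"
      have "0 < Im w" using elim ak by (simp add: w_def)
      then have "Ln (- w) = Ln w - \<i> * pi" by (subst Ln_minus) auto
      then show ?case unfolding w_def[symmetric] by simp
    qed
    ultimately have 1: "((\<lambda>e::real. Im (Ln (1 + of_real (a k) * (?\<zeta> e)))) \<longlongrightarrow> pi) (at_right 0)"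
      using Lim_transform_eventually by fastforce
    have 2: "((\<lambda>e::real. Im (Ln (1 + of_real (q * a k) * (?\<zeta> e)))) \<longlongrightarrow> 0) (at_right 0)"
      by (rule tendsto_upper_half_Ln[of _ "1 - q * a k * t"]) (use ak in \<open>auto intro!: tendsto_eq_intros\<close>)
    show ?thesis unfolding D_def by (intro tendsto_diff 1 2)
  qed
  have "eventually (\<lambda>e. 3 * pi / 4 < D k (?\<zeta> e)) (at_right (0::real))"
    if "k = i \<or> k = j" for k
    by (rule order_tendstoD(1)[OF Dpi[OF that]]) simp
  then have "eventually (\<lambda>e. 3 * pi / 4 < D i (?\<zeta> e) \<and>
      3 * pi / 4 < D j (?\<zeta> e) \<and> 0 < e) (at_right (0::real))"
    using eventually_at_right_less[of "0::real"] by (simp add: eventually_conj_iff)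
  then obtain e2 :: real where e2: "0 < e2" "3 * pi / 4 < D i (?\<zeta> e2)"
      "3 * pi / 4 < D j (?\<zeta> e2)"
    using eventually_happens trivial_limit_at_right_real by blast
  define z2 where "z2 = ?\<zeta> e2"
  have "D i z2 + D j z2 = (\<Sum>k\<in>{i, j}. D k z2)" using ij by simp
  also have "\<dots> \<le> A z2"
    unfolding A_def using ij D0[of _ z2] e2(1) by (intro sum_mono2) (auto simp: d_def z2_def)
  finally have A2: "3 * pi / 2 < A z2" using e2 by (simp add: z2_def)
  \<comment> \<open>The total argument is continuous on a connected set, close to 0 near the origin
    and above 3 pi / 2 near -t. At the value 3 pi / 2 the quotient G(z) / G(q z) is -i times a
    positive number, so G(z) + c G(q z) vanishes for some c on the positive imaginary axis.\<close>
  have "3 * pi / 2 \<in> A ` {z. 0 < Im z}"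
  proof (rule connectedD_interval[OF conn])
    show "A (\<i> * of_real e1) \<in> A ` {z. 0 < Im z}" using e1 by auto
    show "A z2 \<in> A ` {z. 0 < Im z}" using e2 by (auto simp: z2_def)
  qed (use A2 e1 in auto)
  then obtain z where z: "0 < Im z" "A z = 3 * pi / 2" by auto
  define B where "B z = (\<Sum>k<d. Ln (1 + of_real (a k) * z) - Ln (1 + of_real (q * a k) * z))" for z
  have ev: "cpoly (linear_prod rs) w = (\<Prod>k<d. 1 + of_real (a k) * w)" for w :: complex
    unfolding poly_linear_prod_factor prod.list_conv_set_nth d_def a_def
    by (simp add: atLeast0LessThan)
  have nz1: "1 + of_real s * z \<noteq> 0" if "0 < s" for s using nonreal[OF that z(1)] by auto
  have "exp (B z) = (\<Prod>k<d. 1 + of_real (a k) * z) / (\<Prod>k<d. 1 + of_real (q * a k) * z)"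
    unfolding B_def exp_sum[OF finite_lessThan] prod_dividef[symmetric]
    using nz1 a q by (intro prod.cong refl) (simp add: exp_diff del: of_real_mult)
  also have "(\<Prod>k<d. 1 + of_real (q * a k) * z) = cpoly (linear_prod rs) (of_real q * z)"
    unfolding ev by (simp add: mult_ac)
  finally have "cpoly (linear_prod rs) z =
      exp (B z) * cpoly (linear_prod rs) (of_real q * z)"
  proof -
    assume *: "exp (B z) = (\<Prod>k<d. 1 + of_real (a k) * z) / cpoly (linear_prod rs) (of_real q * z)"
    have "cpoly (linear_prod rs) (of_real q * z) \<noteq> 0"
      unfolding ev using nz1[of "a _ * q"] a q by (simp add: mult.assoc)
    then show ?thesis using * by (simp add: ev)
  qed
  moreover have "exp (B z) = of_real (exp (Re (B z))) * (- \<i>)"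
  proof -
    have b: "Im (B z) = 3 / 2 * pi" using z(2) by (simp add: A_def D_def B_def)
    have "cis (Im (B z)) = - \<i>"
      unfolding b by (simp add: complex_eq_iff cos_3over2_pi sin_3over2_pi del: mult_numeral_left times_divide_eq_left)
    then show ?thesis by (simp add: exp_eq_polar)
  qed
  ultimately have "cpoly (linear_prod rs) z +
      (\<i> * of_real (exp (Re (B z)))) * cpoly (linear_prod rs) (of_real q * z) = 0"
    by simp
  with nz[of z "\<i> * of_real (exp (Re (B z)))"] z(1) show False by simp
qed

lemma poly_map_of_real_cnj:
  "cpoly p (cnj z) = cnj (cpoly p z)"
  by (simp add: poly_altdef coeff_map_poly)

lemma linear_prod_mset_cong: "mset rs = mset ss \<Longrightarrow> linear_prod rs = linear_prod ss"
  unfolding linear_prod_def by (metis mset_map prod_mset_prod_list)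

lemma linear_prod_conv_prod: "linear_prod rs = (\<Prod>j<length rs. [:1, rs ! j:])"
  unfolding linear_prod_def by (simp add: prod.list_conv_set_nth atLeast0LessThan)

lemma linear_prod_coeff_nonneg:
  assumes "\<And>r. r \<in> set rs \<Longrightarrow> 0 \<le> r"
  shows "0 \<le> coeff (linear_prod rs) k"
  using assms
proof (induction rs arbitrary: k)
  case (Cons r rs)
  show ?case unfolding linear_prod_simps coeff_mult_linear
    using Cons by (simp add: mul_linear_def split: nat.split)
qed simp

lemma linear_prod_coeff_0: "coeff (linear_prod rs) 0 = 1"
  by (induction rs) (simp_all add: coeff_mult)

text \<open>Nonvanishing of G(z) + c G(q z) is used twice: c = 0 and conjugation make all zeros of G
  real, and Im c > 0 makes them q-separated. Nonnegative coefficients and G(0) = 1 exclude zeros on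
  the nonnegative axis.\<close>

lemma composition_q_separated:
  assumes q: "0 < q" "q < 1" and pos: "\<And>r. r \<in> set rs \<Longrightarrow> 0 < r"
  shows "\<exists>r d. (\<forall>j. 0 \<le> r j) \<and> (\<forall>j. r (Suc j) \<le> q * r j) \<and> (\<forall>j\<ge>d. r j = 0) \<and>
    (\<forall>k. coeff (\<Prod>j<d. [:1, r j:]) k =
      fact k * coeff (linear_prod rs) k * coeff (q_exp_poly q (Suc N)) k)"
proof -
  define E where "E = q_exp_poly q (Suc N)"
  define n where "n = degree E"
  define G where "G = (\<Sum>k\<le>n. monom (fact k * coeff (linear_prod rs) k * coeff E k) k)"
  have G: "coeff G k = fact k * coeff (linear_prod rs) k * coeff E k" for k
    unfolding G_def by (simp add: coeff_sum n_def coeff_eq_0 not_le)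
  let ?h = "map_poly complex_of_real"
  have polyG: "poly (?h G) z = (\<Sum>k\<le>n. fact k * of_real (coeff (linear_prod rs) k) * of_real (coeff E k) * z ^ k)" for z
  proof -
    have "degree (?h G) \<le> n" by (rule degree_le) (simp add: coeff_map_poly G coeff_eq_0 n_def)
    then have "poly (?h G) z = (\<Sum>k\<le>n. coeff (?h G) k * z ^ k)"
      unfolding poly_altdef by (intro sum.mono_neutral_left) (auto simp: coeff_eq_0)
    then show ?thesis by (simp add: coeff_map_poly G)
  qed
  have nz: "poly (?h G) z + c * poly (?h G) (of_real q * z) \<noteq> 0"
    if z: "0 < Im z" and c: "0 < Im c \<or> c = 0" for z c
  proof -
    \<comment> \<open>Composition is linear and commutes with scaling of the argument, so composing
      E(x) + c E(q x) yields G(z) + c G(q z).\<close>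
    define F where "F = ?h E + smult c (pcompose (?h E) [:0, of_real q:])"
    have F: "coeff F k = of_real (coeff E k) + c * (of_real q ^ k * of_real (coeff E k))" for k
      by (simp add: F_def coeff_pcompose_scale coeff_map_poly)
    have "poly (iter_deriv rs z F) 0 \<noteq> 0"
    proof (rule iter_deriv_nonzero[OF pos z])
      show "poly F x \<noteq> 0" if "0 < Im x \<or> x = 0" for x
        using q_exp_poly_combination_nonzero[OF q c that, of N]
        by (simp add: F_def E_def poly_pcompose mult.commute)
    qed auto
    also have "poly (iter_deriv rs z F) 0 = (\<Sum>k\<le>n. fact k * of_real (coeff (linear_prod rs) k) * coeff F k * z ^ k)"
      by (rule iter_deriv_at_0) (rule degree_le, simp add: F coeff_eq_0 n_def)
    also have "\<dots> = poly (?h G) z + c * poly (?h G) (of_real q * z)"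
      unfolding polyG F sum_distrib_left sum.distrib[symmetric]
      by (intro sum.cong refl) (simp add: algebra_simps power_mult_distrib)
    finally show ?thesis .
  qed
  have G0: "poly G 0 = 1"
    using G[of 0] by (simp add: poly_0_coeff_0 E_def coeff_0_q_exp_poly linear_prod_coeff_0)
  have Gnn: "0 \<le> coeff G k" for k
    unfolding G E_def using q pos
    by (intro mult_nonneg_nonneg linear_prod_coeff_nonneg coeff_q_exp_poly_nonneg) (auto simp: less_imp_le)
  have "z \<in> of_real ` {..<0}" if z: "poly (?h G) z = 0" for z
  proof -
    have "\<not> 0 < Im z" using nz[of z 0] z by auto
    moreover have "\<not> 0 < Im (cnj z)" using nz[of "cnj z" 0] z by (auto simp: poly_map_of_real_cnj)
    ultimately have "Im z = 0" by simp
    then have zr: "z = of_real (Re z)" by (simp add: complex_eq_iff)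
    have "Re z < 0"
    proof (rule ccontr)
      assume "\<not> Re z < 0"
      then have x: "0 \<le> Re z" by simp
      have "0 < poly G 0" using G0 by simp
      also have "poly G 0 \<le> poly G (Re z)"
        unfolding poly_altdef using x Gnn by (intro sum_mono mult_left_mono power_mono) auto
      finally show False using z zr poly_map_poly_of_real[of G "Re z"] by simp
    qed
    then show ?thesis using zr by blast
  qed
  from linear_prod_roots[OF G0 this] obtain ts
    where ts: "\<And>t. t \<in> set ts \<Longrightarrow> 0 < t" "G = linear_prod ts" by blast
  \<comment> \<open>In decreasing order pairwise separation becomes the one-step inequality
    \<open>r (Suc j) \<le> q * r j\<close>, which padding by zeros respects.\<close>
  define us where "us = rev (sort ts)"
  have us: "\<And>t. t \<in> set us \<Longrightarrow> 0 < t" "G = linear_prod us"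
    using ts linear_prod_mset_cong[of us ts] by (auto simp: us_def)
  define r where "r j = (if j < length us then us ! j else 0)" for j
  have "r (Suc j) \<le> q * r j" for j
  proof (cases "Suc j < length us")
    case True
    have "us ! Suc j \<le> us ! j"
      unfolding us_def using True by (intro sorted_rev_nth_mono) (auto simp: us_def)
    then have "us ! Suc j \<le> q * us ! j"
      using True nz us by (intro linear_prod_q_separated[OF q us(1)]) auto
    then show ?thesis using True by (simp add: r_def)
  next
    case False
    then show ?thesis using q us(1)[of "us ! j"] by (auto simp: r_def less_imp_le)
  qed
  moreover have "0 \<le> r j" for j using us(1)[of "us ! j"] by (auto simp: r_def less_imp_le)
  moreover have "(\<Prod>j<length us. [:1, r j:]) = G"
    unfolding us(2) linear_prod_conv_prod by (intro prod.cong) (auto simp: r_def)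
  ultimately show ?thesis
    by (intro exI[of _ r] exI[of _ "length us"]) (auto simp: r_def G E_def)
qed

subsection \<open>Limits of q-separated products\<close>

lemma prod_telescope:
  fixes J :: nat
  shows "(\<Sum>j<J. x j * (\<Prod>i<j. 1 + x i)) = (\<Prod>i<J. 1 + x i) - (1 :: 'a :: comm_ring_1)"
  by (induction J) (simp_all add: algebra_simps)

text \<open>The telescoping identity turns the product into a series to which Tannery's theorem applies.\<close>

lemma prod_tannery:
  fixes x :: "nat \<Rightarrow> nat \<Rightarrow> complex"
  assumes lim: "\<And>j. (\<lambda>n. x n j) \<longlonglongrightarrow> y j" and bd: "\<And>n j. norm (x n j) \<le> B j" and B: "summable B"
    and d: "\<And>n j. d n \<le> j \<Longrightarrow> x n j = 0"
  shows "\<exists>L. (\<lambda>n. \<Prod>j<d n. 1 + x n j) \<longlonglongrightarrow> L \<and> (\<lambda>j. 1 + y j) has_prod L"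
proof -
  define a where "a j n = x n j * (\<Prod>i<j. 1 + x n i)" for j n
  define b where "b j = y j * (\<Prod>i<j. 1 + y i)" for j
  have B0: "0 \<le> B j" for j using bd[of 0 j] norm_ge_zero order_trans by blast
  have pb: "norm (\<Prod>i<j. 1 + x n i) \<le> exp (suminf B)" for n j
  proof -
    have "norm (\<Prod>i<j. 1 + x n i) \<le> (\<Prod>i<j. exp (B i))"
      unfolding prod_norm[symmetric]
    proof (rule prod_mono, safe)
      fix i
      have "norm (1 + x n i) \<le> 1 + B i" using norm_triangle_ineq[of 1 "x n i"] bd[of n i] by simp
      also have "\<dots> \<le> exp (B i)" by (rule exp_ge_add_one_self)
      finally show "norm (1 + x n i) \<le> exp (B i)" .
    qed simp
    also have "\<dots> = exp (\<Sum>i<j. B i)" by (simp add: exp_sum)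
    also have "\<dots> \<le> exp (suminf B)" using sum_le_suminf[OF B, of "{..<j}"] B0 by simp
    finally show ?thesis .
  qed
  have T: "eventually (\<lambda>n. summable (\<lambda>j. norm (a j n))) sequentially \<and> summable (\<lambda>j. norm (b j)) \<and>
      (\<lambda>n. \<Sum>j. a j n) \<longlonglongrightarrow> (\<Sum>j. b j)"
  proof (rule tannerys_theorem[where M = "\<lambda>j. B j * exp (suminf B)"])
    show "(\<lambda>n. a j n) \<longlonglongrightarrow> b j" for j
      unfolding a_def b_def by (intro tendsto_intros lim)
    show "eventually (\<lambda>(j, n). norm (a j n) \<le> B j * exp (suminf B)) (at_top \<times>\<^sub>F sequentially)"
      by (intro always_eventually allI, clarify)
        (unfold a_def norm_mult, intro mult_mono bd pb B0 norm_ge_zero)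
    show "summable (\<lambda>j. B j * exp (suminf B))" by (intro summable_mult2 B)
  qed simp
  have "(\<Sum>j. a j n) = (\<Prod>j<d n. 1 + x n j) - 1" for n
    unfolding prod_telescope[symmetric] a_def by (rule suminf_finite) (use d in auto)
  then have 1: "(\<lambda>n. \<Prod>j<d n. 1 + x n j) \<longlonglongrightarrow> 1 + (\<Sum>j. b j)"
    using T tendsto_add[OF tendsto_const[of 1], of "\<lambda>n. \<Sum>j. a j n"] by simp
  have yB: "norm (y j) \<le> B j" for j
    by (rule LIMSEQ_le_const2[OF tendsto_norm[OF lim]]) (use bd in auto)
  have "summable (\<lambda>j. norm (y j))" by (rule summable_comparison_test'[OF B, of 0]) (use yB in auto)
  then have "convergent_prod (\<lambda>j. 1 + y j)"
    by (intro abs_convergent_prod_imp_convergent_prod summable_imp_abs_convergent_prod) simp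
  then obtain L where L: "(\<lambda>j. 1 + y j) has_prod L" using convergent_prod_has_prod by blast
  have "summable b" using T summable_norm_cancel by blast
  then have "(\<lambda>J. \<Sum>j<J. b j) \<longlonglongrightarrow> (\<Sum>j. b j)" by (rule summable_LIMSEQ)
  then have "(\<lambda>J. 1 + (\<Sum>j<J. b j)) \<longlonglongrightarrow> 1 + (\<Sum>j. b j)" by (intro tendsto_intros)
  then have "(\<lambda>J. \<Prod>i<J. 1 + y i) \<longlonglongrightarrow> 1 + (\<Sum>j. b j)"
    unfolding b_def prod_telescope by simp
  then have "L = 1 + (\<Sum>j. b j)" using LIMSEQ_unique has_prod_imp_tendsto'[OF L] by blast
  with 1 L show ?thesis by blast
qed

lemma coeff_prod_linear_nonneg:
  fixes d k :: nat and r :: "nat \<Rightarrow> real"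
  assumes "\<And>j. 0 \<le> r j"
  shows "0 \<le> coeff (\<Prod>j<d. [:1, r j:]) k"
  using linear_prod_coeff_nonneg[of "map r [0..<d]" k] assms by (auto simp: linear_prod_conv_prod)

lemma coeff_1_prod_linear:
  fixes d :: nat
  shows "coeff (\<Prod>j<d. [:1, r j:]) 1 = (\<Sum>j<d. r j :: real)"
proof -
  have 0: "coeff (\<Prod>j<d. [:1, r j:]) 0 = 1" for d :: nat by (induction d) (simp_all add: coeff_mult)
  show ?thesis
  proof (induction d)
    case (Suc d)
    show ?case unfolding prod.lessThan_Suc mult.commute[of _ "[:1, _:]"] coeff_mult_linear
      using Suc 0[of d] by (simp add: mul_linear_def)
  qed simp
qed

lemma q_decreasing_le:
  assumes q: "0 < q" "q < 1" and r: "\<And>j. 0 \<le> r j" "\<And>j. r (Suc j) \<le> q * r j" and "i < j"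
  shows "r j \<le> q * (r i :: real)"
  using \<open>i < j\<close>
proof (induction j)
  case (Suc j)
  show ?case
  proof (cases "i = j")
    case False
    then have "r j \<le> q * r i" using Suc by simp
    moreover have "r (Suc j) \<le> r j" using r(2)[of j] mult_right_mono[of q 1 "r j"] q r(1)[of j] by simp
    ultimately show ?thesis by simp
  qed (use r in simp)
qed simp

text \<open>The linear coefficient is the sum of the \<open>r n j\<close>. It converges, hence is
  bounded by some M, and decay gives \<open>r n j \<le> M * q ^ j\<close> uniformly in n. A diagonal
  subsequence converges in every j, and this geometric bound dominates both the products and,
  through them, the power series; both limits are the same number L.\<close>

lemma q_separated_product_limit:
  fixes r :: "nat \<Rightarrow> nat \<Rightarrow> real"
  assumes q: "0 < q" "q < 1" and r: "\<And>n j. 0 \<le> r n j" "\<And>n j. r n (Suc j) \<le> q * r n j"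
    and d: "\<And>n j. d n \<le> j \<Longrightarrow> r n j = 0"
    and lim: "\<And>k. (\<lambda>n. coeff (\<Prod>j<d n. [:1, r n j:]) k) \<longlonglongrightarrow> g k"
  shows "\<exists>s. (\<forall>j. 0 \<le> s j) \<and> (\<forall>j. s (Suc j) \<le> q * s j) \<and>
    (\<forall>z. \<exists>L. (\<lambda>j. 1 + complex_of_real (s j) * z) has_prod L \<and> (\<lambda>k. of_real (g k) * z ^ k) sums L)"
proof -
  have "Bseq (\<lambda>n. coeff (\<Prod>j<d n. [:1, r n j:]) 1)"
    using lim[of 1] by (intro convergent_imp_Bseq) (auto simp: convergent_def)
  then obtain M where M: "0 < M" "\<And>n. \<bar>\<Sum>j<d n. r n j\<bar> \<le> M"
    unfolding Bseq_def coeff_1_prod_linear by auto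
  have r0: "r n 0 \<le> M" for n
  proof (cases "d n = 0")
    case True
    then show ?thesis using d[of n 0] M by simp
  next
    case False
    then have "r n 0 \<le> (\<Sum>j<d n. r n j)" using r(1) by (intro member_le_sum) auto
    then show ?thesis using M(2)[of n] by simp
  qed
  have rM: "r n j \<le> M * q ^ j" for n j
  proof (induction j)
    case (Suc j)
    have "r n (Suc j) \<le> q * (M * q ^ j)"
      using q by (intro order.trans[OF r(2)] mult_left_mono Suc) simp
    then show ?case by (simp add: mult_ac)
  qed (simp add: r0)
  have rM': "norm (r n j) \<le> M" for n j
  proof -
    have "M * q ^ j \<le> M * 1" using q M by (intro mult_left_mono power_le_one) auto
    then show ?thesis using rM[of n j] r(1)[of n j] by simp
  qed
  obtain \<kappa> where \<kappa>: "strict_mono \<kappa>" "\<And>j. j \<in> UNIV \<Longrightarrow> \<exists>l. (\<lambda>n. r (\<kappa> n) j) \<longlonglongrightarrow> l"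
    by (rule function_convergent_subsequence[of "UNIV :: nat set" r M]) (use rM' in auto)
  then obtain s where s: "\<And>j. (\<lambda>n. r (\<kappa> n) j) \<longlonglongrightarrow> s j" by (metis UNIV_I)
  have s0: "0 \<le> s j" for j using s r(1) by (intro LIMSEQ_le_const[OF s]) auto
  have sq: "s (Suc j) \<le> q * s j" for j
    by (rule LIMSEQ_le[OF s tendsto_mult[OF tendsto_const s]]) (use r(2) in auto)
  have sumq: "summable (\<lambda>j. M * q ^ j * c)" for c
    using q by (intro summable_mult summable_mult2 summable_geometric) auto
  have "\<exists>L. (\<lambda>j. 1 + complex_of_real (s j) * z) has_prod L \<and> (\<lambda>k. of_real (g k) * z ^ k) sums L" for z
  proof -
    define p where "p n = (\<Prod>j<d (\<kappa> n). [:1, r (\<kappa> n) j:])" for n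
    have "\<exists>L. (\<lambda>n. \<Prod>j<d (\<kappa> n). 1 + complex_of_real (r (\<kappa> n) j) * z) \<longlonglongrightarrow> L \<and>
        (\<lambda>j. 1 + complex_of_real (s j) * z) has_prod L"
    proof (rule prod_tannery[where B = "\<lambda>j. M * q ^ j * norm z"])
      show "norm (complex_of_real (r (\<kappa> n) j) * z) \<le> M * q ^ j * norm z" for n j
        using rM[of "\<kappa> n" j] r(1) by (simp add: norm_mult mult_right_mono)
    qed (use sumq s d in \<open>auto intro!: tendsto_intros\<close>)
    then obtain L where L: "(\<lambda>n. cpoly (p n) z) \<longlonglongrightarrow> L"
        "(\<lambda>j. 1 + complex_of_real (s j) * z) has_prod L"
      unfolding p_def poly_prod_linear by blast
    \<comment> \<open>With nonnegative coefficients, evaluation at R bounds the k-th coefficient by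
      K / R^k. The choice of R makes |z| / R less than 1/2, so that the majorant is
      summable.\<close>
    define R where "R = 2 * norm z + 1"
    have R: "0 < R" by (simp add: R_def add_nonneg_pos)
    define K where "K = exp (\<Sum>j. M * q ^ j * R)"
    have nn: "0 \<le> coeff (p n) k" for n k
      unfolding p_def using r(1) by (rule coeff_prod_linear_nonneg)
    have bd: "coeff (p n) k \<le> K / R ^ k" for n k
    proof -
      have sm: "(\<lambda>k. coeff (p n) k * R ^ k) sums poly (p n) R" by (rule poly_sums)
      have "coeff (p n) k * R ^ k \<le> poly (p n) R"
        using sum_le_suminf[OF sums_summable[OF sm], of "{k}"] nn R sums_unique[OF sm] by simp
      also have "poly (p n) R = (\<Prod>j<d (\<kappa> n). 1 + r (\<kappa> n) j * R)"
        unfolding p_def poly_prod by (intro prod.cong refl) (simp add: mult.commute)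
      also have "\<dots> \<le> (\<Prod>j<d (\<kappa> n). exp (M * q ^ j * R))"
      proof (rule prod_mono, safe)
        fix j
        show "0 \<le> 1 + r (\<kappa> n) j * R" using r(1) R by simp
        have "1 + r (\<kappa> n) j * R \<le> 1 + M * q ^ j * R" using rM R by (simp add: mult_right_mono)
        also have "\<dots> \<le> exp (M * q ^ j * R)" by (rule exp_ge_add_one_self)
        finally show "1 + r (\<kappa> n) j * R \<le> exp (M * q ^ j * R)" .
      qed
      also have "\<dots> = exp (\<Sum>j<d (\<kappa> n). M * q ^ j * R)" by (simp add: exp_sum)
      also have "\<dots> \<le> K"
        unfolding K_def exp_le_cancel_iff using M q R by (intro sum_le_suminf sumq) auto
      finally show ?thesis using R by (simp add: field_simps)
    qed
    have "(\<lambda>n. cpoly (p n) z) \<longlonglongrightarrow> (\<Sum>k. of_real (g k) * z ^ k) \<and>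
      summable (\<lambda>k. of_real (g k) * z ^ k)"
    proof (rule power_series_tannery[where D = "\<lambda>k. K / R ^ k" and c = "\<lambda>n k. of_real (coeff (p n) k)"])
      show "(\<lambda>k. complex_of_real (coeff (p n) k) * z ^ k) sums cpoly (p n) z" for n
        using poly_sums[of "map_poly of_real (p n)" z] by (simp add: coeff_map_poly)
      show "(\<lambda>n. complex_of_real (coeff (p n) k)) \<longlonglongrightarrow> of_real (g k)" for k
        using LIMSEQ_subseq_LIMSEQ[OF lim[of k] \<kappa>(1)] unfolding p_def comp_def by (intro tendsto_intros)
      show "norm (complex_of_real (coeff (p n) k)) \<le> K / R ^ k" for n k using bd nn by simp
      have "summable (\<lambda>k. K * (norm z / R) ^ k)"
        using R by (intro summable_mult summable_geometric) (simp add: R_def)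
      then show "summable (\<lambda>k. K / R ^ k * norm z ^ k)" by (simp add: power_divide)
    qed
    then have "(\<lambda>k. of_real (g k) * z ^ k) sums L"
      using LIMSEQ_unique[OF L(1)] by (auto simp: sums_iff)
    with L(2) show ?thesis by blast
  qed
  with s0 sq show ?thesis by blast
qed

text \<open>The zeros are -1 / s_j. Once some s_j is 0 all later ones are 0, so the first vanishing
  index is the length of the sequence. As s_0 is the largest term, 1 / s_0 bounds the zeros away
  from 0; if s_0 = 0 the sequence is empty.\<close>

lemma N_bar_less_1I:
  assumes q: "0 < q" "q < 1" and s: "\<And>j. 0 \<le> s j" "\<And>j. s (Suc j) \<le> q * s j"
    and f: "\<And>z. \<exists>L. (\<lambda>j. 1 + complex_of_real (s j) * z) has_prod L \<and> f z = of_real a * L"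
  shows "f \<in> N_bar_less_1 q"
proof -
  define n where "n = (if \<exists>j. s j = 0 then enat (LEAST j. s j = 0) else \<infinity>)"
  have anti: "s j \<le> q * s i" if "i < j" for i j by (rule q_decreasing_le[where r = s, OF q s that])
  have n: "enat j < n \<longleftrightarrow> 0 < s j" for j
  proof (cases "\<exists>j. s j = 0")
    case True
    define m where "m = (LEAST j. s j = 0)"
    have sm: "s m = 0" unfolding m_def using True by (rule LeastI_ex)
    have "0 < s j" if "j < m" using not_less_Least[of j "\<lambda>j. s j = 0"] that s(1)[of j] by (auto simp: m_def)
    moreover have "s j = 0" if "m \<le> j"
      using anti[of m j] sm s(1)[of j] that by (cases "m = j") auto
    ultimately show ?thesis using True by (force simp: n_def m_def[symmetric] not_less)
  next
    case False
    then show ?thesis using s(1)[of j] by (auto simp: n_def less_le)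
  qed
  define x where "x j = - 1 / s j" for j
  have "q_separated q n x"
    unfolding q_separated_def
  proof (intro allI impI)
    fix k l assume *: "enat k < n" "enat l < n" "k \<noteq> l" "x l \<le> x k \<and> x k < 0 \<or> 0 < x k \<and> x k \<le> x l"
    then have pos: "0 < s k" "0 < s l" by (auto simp: n)
    then have "s l \<le> s k" using *(4) by (auto simp: x_def divide_simps split: if_splits)
    moreover have "q * s l < s l" using pos q by simp
    \<comment> \<open>Since \<open>s l \<le> s k\<close>, the index l cannot come first: decay would
      give s_k \<le> q s_l < s_l.\<close>
    ultimately have "k < l" using anti[of l k] *(3) by (cases k l rule: linorder_cases) auto
    then show "x k / x l \<le> q" using anti[of k l] pos by (simp add: x_def field_simps)
  qed
  moreover have "\<exists>c>0. \<forall>j. enat j < n \<longrightarrow> c \<le> \<bar>x j\<bar>"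
  proof (cases "s 0 = 0")
    case True
    then have "\<not> enat j < n" for j using anti[of 0 j] s(1)[of j] unfolding n by (cases j) auto
    then show ?thesis by (intro exI[of _ 1]) auto
  next
    case False
    then have s0: "0 < s 0" using s(1)[of 0] by simp
    have "s j \<le> s 0" for j
    proof (cases "j = 0")
      case False
      have "q * s 0 \<le> s 0" using q s0 by simp
      then show ?thesis using anti[of 0 j] False by simp
    qed simp
    then have "1 / s 0 \<le> \<bar>x j\<bar>" if "enat j < n" for j
      using that s0 by (simp add: n x_def frac_le)
    then show ?thesis using s0 by (intro exI[of _ "1 / s 0"]) auto
  qed
  moreover have "x j < 0" if "enat j < n" for j using that by (simp add: n x_def)
  moreover have "\<exists>p. (\<lambda>j. if enat j < n then 1 - z / of_real (x j) else 1) has_prod p \<and>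
               f z = of_real a * z ^ 0 * p" for z
  proof -
    have "(\<lambda>j. if enat j < n then 1 - z / of_real (x j) else 1) = (\<lambda>j. 1 + complex_of_real (s j) * z)"
    proof
      fix j
      show "(if enat j < n then 1 - z / of_real (x j) else 1) = 1 + complex_of_real (s j) * z"
        using s(1)[of j] unfolding n by (cases "s j = 0") (auto simp: x_def)
    qed
    then show ?thesis using f[of z] by simp
  qed
  ultimately show ?thesis unfolding N_bar_less_1_def by blast
qed

text \<open>One index n drives both approximations: the n-th polynomial for f is composed with n + 1
  factors of E. The k-th coefficient then tends to k! f_k C_k(q), as the definition of
  \<open>PN_bar\<close> requires.\<close>

lemma PN_bar_less_1I:
  assumes q: "0 < q" "q < 1" and pos: "\<And>n r. r \<in> set (rs n) \<Longrightarrow> 0 < r"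
    and lim: "\<And>k. (\<lambda>n. coeff (linear_prod (rs n)) k) \<longlonglongrightarrow> f k"
  shows "Abs_fps (\<lambda>k. a * (fact k * f k)) \<in> PN_bar q"
proof -
  define P where "P n r d \<longleftrightarrow> (\<forall>j. 0 \<le> r j) \<and> (\<forall>j. r (Suc j) \<le> q * r j) \<and> (\<forall>j\<ge>d. r j = 0) \<and>
    (\<forall>k. coeff (\<Prod>j<d. [:1, r j:]) k =
      fact k * coeff (linear_prod (rs n)) k * coeff (q_exp_poly q (Suc n)) k)"
    for n d :: nat and r :: "nat \<Rightarrow> real"
  have "\<forall>n. \<exists>r d. P n r d"
    unfolding P_def by (intro allI composition_q_separated[OF q pos])
  then obtain r d where P: "\<And>n. P n (r n) (d n)" by metis
  have r: "0 \<le> r n j" "r n (Suc j) \<le> q * r n j" "d n \<le> j \<Longrightarrow> r n j = 0"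
      "coeff (\<Prod>j<d n. [:1, r n j:]) k =
        fact k * coeff (linear_prod (rs n)) k * coeff (q_exp_poly q (Suc n)) k" for n j k
    using P[of n] by (auto simp: P_def)
  have lim': "(\<lambda>n. coeff (\<Prod>j<d n. [:1, r n j:]) k) \<longlonglongrightarrow> fact k * f k * C_inf q k" for k
    unfolding r(4) using coeff_q_exp_poly_tendsto[OF q, of k, THEN LIMSEQ_Suc] by (intro tendsto_intros lim)
  define S where "S z L \<longleftrightarrow> (\<lambda>k. of_real (fact k * f k * C_inf q k) * z ^ k) sums L" for z L :: complex
  have "\<exists>s. (\<forall>j. 0 \<le> s j) \<and> (\<forall>j. s (Suc j) \<le> q * s j) \<and>
    (\<forall>z. \<exists>L. (\<lambda>j. 1 + complex_of_real (s j) * z) has_prod L \<and> S z L)"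
    unfolding S_def by (rule q_separated_product_limit[OF q r(1,2,3) lim'])
  then obtain s where s: "\<And>j. 0 \<le> s j" "\<And>j. s (Suc j) \<le> q * s j"
      "\<And>z. \<exists>L. (\<lambda>j. 1 + complex_of_real (s j) * z) has_prod L \<and> S z L" by blast
  then obtain L where L: "\<And>z. (\<lambda>j. 1 + complex_of_real (s j) * z) has_prod L z" "\<And>z. S z (L z)"
    by metis
  have "(\<lambda>z. of_real a * L z) \<in> N_bar_less_1 q"
    using L(1) by (intro N_bar_less_1I[where s = s, OF q s(1,2)]) auto
  moreover have "(\<lambda>k. of_real (C_inf q k * fps_nth (Abs_fps (\<lambda>k. a * (fact k * f k))) k) * z ^ k)
      sums (of_real a * L z)" for z
    using sums_mult[OF L(2)[of z, unfolded S_def], of "of_real a"] by (simp add: mult_ac)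
  ultimately show ?thesis
    using q unfolding PN_bar_def N_bar_def by (intro CollectI bexI[of _ "\<lambda>z. of_real a * L z"] allI) auto
qed

subsection \<open>Entire functions of order less than one\<close>

lemma entire_remove_zero:
  assumes F: "F holomorphic_on UNIV" and w: "F w = 0" and nc: "F u \<noteq> 0"
  shows "\<exists>n G. 0 < n \<and> G holomorphic_on UNIV \<and> (\<forall>z. F z = (z - w) ^ n * G z) \<and> G w \<noteq> (0 :: complex)"
proof -
  have "\<not> F constant_on UNIV" using w nc unfolding constant_on_def by (metis UNIV_I)
  then obtain g r n where g: "0 < n" "0 < r" "g holomorphic_on ball w r"
      "\<And>z. z \<in> ball w r \<Longrightarrow> F z = (z - w) ^ n * g z" "\<And>z. z \<in> ball w r \<Longrightarrow> g z \<noteq> 0"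
    using holomorphic_factor_zero_nonconstant[OF F open_UNIV connected_UNIV UNIV_I w] by metis
  define G where "G z = (if z \<in> ball w r then g z else F z / (z - w) ^ n)" for z
  have G: "G z = F z / (z - w) ^ n" if "z \<noteq> w" for z
    using that g(4)[of z] by (auto simp: G_def)
  have "G holomorphic_on ball w r \<union> (UNIV - {w})"
  proof (rule holomorphic_on_Un)
    show "G holomorphic_on ball w r"
      using g(3) by (rule holomorphic_transform) (simp add: G_def)
    have "(\<lambda>z. F z / (z - w) ^ n) holomorphic_on UNIV - {w}"
      using F by (intro holomorphic_intros) (auto intro: holomorphic_on_subset)
    then show "G holomorphic_on UNIV - {w}" by (rule holomorphic_transform) (simp add: G)
  qed auto
  moreover have "ball w r \<union> (UNIV - {w}) = UNIV" using g(2) by auto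
  moreover have "F z = (z - w) ^ n * G z" for z
    using g(4)[of z] G[of z] w g(1) by (cases "z = w") auto
  moreover have "G w \<noteq> 0" using g(2) g(5)[of w] by (simp add: G_def)
  ultimately show ?thesis using g(1) by auto
qed

text \<open>Induction on the number of distinct zeros in the disc, finite because F is not constant;
  each step removes one zero with its full multiplicity. The bound \<open>1 / R \<le> r\<close>
  records that the removed zeros lie in the disc.\<close>

lemma entire_divide_zeros:
  assumes "F holomorphic_on UNIV" "F 0 = (1::complex)" and R: "0 < R"
    and "\<And>z. F z = 0 \<Longrightarrow> z \<in> of_real ` {..<0}"
  shows "\<exists>rs H. (\<forall>r\<in>set rs. 1 / R \<le> r) \<and> H holomorphic_on UNIV \<and>
    (\<forall>z. F z = cpoly (linear_prod rs) z * H z) \<and> (\<forall>z\<in>cball 0 R. H z \<noteq> 0)"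
  using assms(1,2,4)
proof (induction "card {z \<in> cball 0 R. F z = 0}" arbitrary: F rule: less_induct)
  case (less F)
  show ?case
  proof (cases "\<exists>w\<in>cball 0 R. F w = 0")
    case False
    then show ?thesis using less by (intro exI[of _ "[]"] exI[of _ F]) auto
  next
    case True
    then obtain w where w: "w \<in> cball 0 R" "F w = 0" by blast
    obtain t where t: "w = of_real t" "t < 0" using less(4)[OF w(2)] by auto
    define s where "s = - t"
    have s: "w = of_real (- s)" "0 < s" using t by (simp_all add: s_def)
    have sR: "s \<le> R" using w s by simp
    obtain n G where G: "0 < n" "G holomorphic_on UNIV" "\<And>z. F z = (z - w) ^ n * G z" "G w \<noteq> 0"
      using entire_remove_zero[OF less(2) w(2), of 0] less(3) by (auto simp del: of_real_minus)
    \<comment> \<open>The factor s^n normalises (z + s)^n to (1 + z / s)^n, so that the quotient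
      again takes the value 1 at 0.\<close>
    define H where "H z = of_real s ^ n * G z" for z
    have FH: "F z = (1 + of_real (1 / s) * z) ^ n * H z" for z
    proof -
      have "z - w = of_real s * (1 + of_real (1 / s) * z)" using s by (simp add: field_simps)
      then show ?thesis unfolding G(3) H_def by (simp add: power_mult_distrib)
    qed
    have "{z \<in> cball 0 R. H z = 0} \<subset> {z \<in> cball 0 R. F z = 0}"
    proof
      show "{z \<in> cball 0 R. H z = 0} \<subseteq> {z \<in> cball 0 R. F z = 0}" by (auto simp: FH)
      show "{z \<in> cball 0 R. H z = 0} \<noteq> {z \<in> cball 0 R. F z = 0}"
      proof -
        have "w \<in> {z \<in> cball 0 R. F z = 0}" using w by simp
        moreover have "w \<notin> {z \<in> cball 0 R. H z = 0}" using G(4) s(2) by (simp add: H_def)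
        ultimately show ?thesis by metis
      qed
    qed
    moreover have "finite {z \<in> cball 0 R. F z = 0}"
    proof (rule holomorphic_compact_finite_zeros[OF less(2)])
      show "\<not> F constant_on UNIV"
        using w(2) less(3) unfolding constant_on_def by (metis UNIV_I zero_neq_one)
    qed auto
    ultimately have "card {z \<in> cball 0 R. H z = 0} < card {z \<in> cball 0 R. F z = 0}"
      by (rule psubset_card_mono[rotated])
    then have ex: "\<exists>rs K. (\<forall>r\<in>set rs. 1 / R \<le> r) \<and> K holomorphic_on UNIV \<and>
        (\<forall>z. H z = cpoly (linear_prod rs) z * K z) \<and> (\<forall>z\<in>cball 0 R. K z \<noteq> 0)"
    proof (rule less(1))
      show "H holomorphic_on UNIV" unfolding H_def using G(2) by (intro holomorphic_intros)
      show "H 0 = 1" using FH[of 0] less(3) by simp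
      show "z \<in> of_real ` {..<0}" if "H z = 0" for z using that FH[of z] by (intro less(4)) simp
    qed
    from ex obtain rs K where K: "\<forall>r\<in>set rs. 1 / R \<le> r" "K holomorphic_on UNIV"
        "\<forall>z. H z = cpoly (linear_prod rs) z * K z" "\<forall>z\<in>cball 0 R. K z \<noteq> 0"
      by (elim exE conjE)
    have "1 / R \<le> 1 / s" using sR s(2) by (simp add: frac_le)
    then have "\<forall>r\<in>set (replicate n (1 / s) @ rs). 1 / R \<le> r" using K(1) by auto
    moreover have "F z = cpoly (linear_prod (replicate n (1 / s) @ rs)) z * K z" for z
      unfolding FH K(3)[rule_format] by (simp add: poly_linear_prod_factor prod_list_replicate)
    ultimately show ?thesis
      using K(2,4) by (intro exI[of _ "replicate n (1 / s) @ rs"] exI[of _ K] conjI allI) simp_all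
  qed
qed

text \<open>Borel--Caratheodory, via the Schwarz lemma for \<open>h / (2 A - h)\<close>.\<close>

lemma borel_caratheodory:
  assumes h: "h holomorphic_on ball 0 R" "h 0 = 0" and R: "0 < R" and A: "0 < A"
    and re: "\<And>z. norm z < R \<Longrightarrow> Re (h z) < A" and z: "norm z < R"
  shows "norm (h z) * (R - norm z) \<le> 2 * A * norm z"
proof -
  define \<phi> where "\<phi> w = h (of_real R * w) / (2 * of_real A - h (of_real R * w))" for w
  have nw: "norm (of_real R * w) < R" if "norm w < 1" for w :: complex
    using that R by (simp add: norm_mult)
  have nz: "2 * of_real A - h u \<noteq> 0" if "norm u < R" for u
  proof
    assume "2 * of_real A - h u = 0"
    then have "Re (h u) = 2 * A" by (simp add: complex_eq_iff)
    then show False using re[OF that] A by linarith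
  qed
  have "norm (\<phi> (z / of_real R)) \<le> norm (z / of_real R)"
  proof (rule Schwarz_Lemma(1))
    show "\<phi> holomorphic_on ball 0 1"
    proof -
      have "(h \<circ> (\<lambda>w. of_real R * w)) holomorphic_on ball 0 1"
        by (rule holomorphic_on_compose_gen[OF _ h(1)]) (use nw in \<open>auto intro!: holomorphic_intros\<close>)
      then have "(\<lambda>w. h (of_real R * w)) holomorphic_on ball 0 1" by (simp add: comp_def)
      then show ?thesis unfolding \<phi>_def using nz nw by (intro holomorphic_intros) auto
    qed
    show "\<phi> 0 = 0" by (simp add: \<phi>_def h(2))
    show "norm (\<phi> w) < 1" if "norm w < 1" for w
    proof -
      let ?u = "h (of_real R * w)"
      have "(norm ?u)\<^sup>2 < (norm (2 * of_real A - ?u))\<^sup>2"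
        unfolding cmod_power2 using mult_strict_left_mono[OF re[OF nw[OF that]] A]
        by (simp add: power2_eq_square algebra_simps)
      then have "norm ?u < norm (2 * of_real A - ?u)" by (rule power2_less_imp_less) simp
      then show ?thesis using nz[OF nw[OF that]] by (simp add: \<phi>_def norm_divide)
    qed
    show "norm (z / of_real R) < 1" using z R by (simp add: norm_divide)
  qed
  then have "norm (h z) * R \<le> norm z * norm (2 * of_real A - h z)"
    using nz[OF z] R by (simp add: \<phi>_def norm_divide field_simps)
  also have "\<dots> \<le> norm z * (2 * A + norm (h z))"
    using norm_triangle_ineq4[of "2 * of_real A" "h z"] A by (intro mult_left_mono) (auto simp: norm_mult)
  finally show ?thesis by (simp add: algebra_simps)
qed

lemma norm_exp_minus_1_le: "norm (exp z - 1) \<le> exp (norm z) - (1::real)" for z :: complex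
proof -
  have s: "(\<lambda>n. z ^ Suc n /\<^sub>R fact (Suc n)) sums (exp z - 1)"
    using sums_split_initial_segment[OF exp_converges[of z], of 1] by simp
  have t: "(\<lambda>n. norm z ^ Suc n /\<^sub>R fact (Suc n)) sums (exp (norm z) - 1)"
    using sums_split_initial_segment[OF exp_converges[of "norm z"], of 1] by simp
  show ?thesis
    unfolding sums_unique[OF s] sums_unique[OF t]
    by (rule norm_suminf_le[OF _ sums_summable[OF t]]) (simp add: norm_mult norm_power)
qed

text \<open>The zeros inside radius R are divided out, but the quotient H is estimated on the circle
  of radius 2 R: there the product of the removed factors has modulus at least 1, so H inherits the
  bound for F, and the maximum principle carries it inside. The constant 4 K / R is 2 K divided by R
  - K, with R - K replaced by its lower bound R / 2.\<close>

lemma entire_order_less_1_approx: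
  assumes F: "F holomorphic_on UNIV" "F 0 = (1::complex)"
    and zeros: "\<And>z. F z = 0 \<Longrightarrow> z \<in> of_real ` {..<0}"
    and growth: "\<And>z. norm (F z) \<le> C * exp (norm z powr a)" and C: "1 \<le> C"
    and R: "0 < R" and K: "0 < K" "2 * K \<le> R"
  shows "\<exists>rs. (\<forall>r\<in>set rs. 0 < r) \<and> (\<forall>z\<in>cball 0 K.
    norm (cpoly (linear_prod rs) z - F z) \<le>
      norm (F z) * (exp (4 * K * ((1 + ln C + (2 * R) powr a) / R)) - 1))"
proof -
  have "\<exists>rs H. (\<forall>r\<in>set rs. 1 / R \<le> r) \<and> H holomorphic_on UNIV \<and>
    (\<forall>z. F z = cpoly (linear_prod rs) z * H z) \<and> (\<forall>z\<in>cball 0 R. H z \<noteq> 0)"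
    by (rule entire_divide_zeros[OF F R]) (rule zeros)
  then obtain rs H where rs': "\<forall>r\<in>set rs. 1 / R \<le> r" and H: "H holomorphic_on UNIV"
      "\<forall>z. F z = cpoly (linear_prod rs) z * H z" "\<forall>z\<in>cball 0 R. H z \<noteq> 0"
    by (elim exE conjE)
  have rs: "1 / R \<le> r" if "r \<in> set rs" for r using rs' that by blast
  note H = H(1) spec[OF H(2)] bspec[OF H(3)]
  let ?P = "\<lambda>z. cpoly (linear_prod rs) z"
  \<comment> \<open>The bound for log |H| is A - 1; the extra 1 makes A positive and the inequality
    Re h < A strict.\<close>
  define A where "A = 1 + ln C + (2 * R) powr a"
  have A: "0 < A" using C R by (simp add: A_def add_nonneg_pos)
  have expA: "exp (A - 1) = C * exp ((2 * R) powr a)" using C by (simp add: A_def exp_add)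
  have bd: "norm (H z) \<le> exp (A - 1)" if "z \<in> cball 0 (2 * R)" for z
  proof (rule maximum_modulus_frontier[OF _ _ _ _ that])
    show "H holomorphic_on interior (cball 0 (2 * R))" using H(1) by (rule holomorphic_on_subset) simp
    show "continuous_on (closure (cball 0 (2 * R))) H"
      using H(1) by (intro holomorphic_on_imp_continuous_on) (rule holomorphic_on_subset, auto)
    fix u assume "u \<in> frontier (cball 0 (2 * R) :: complex set)"
    then have u: "norm u = 2 * R" using R by (simp add: frontier_cball)
    \<comment> \<open>The removed zeros have modulus at most R, so each factor satisfies |1 + r u|
      \<ge> r |u| - 1 \<ge> 2 - 1.\<close>
    have "1 \<le> norm (?P u)"
      unfolding poly_linear_prod_factor using rs
    proof (induction rs)
      case (Cons r rs)
      have r: "1 / R \<le> r" using Cons(2)[of r] by simp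
      have r0: "0 < r" using less_le_trans[OF _ r] R by simp
      have "1 = 1 / R * (2 * R) - 1" using R by simp
      also have "\<dots> \<le> r * (2 * R) - 1" using r R by (intro diff_right_mono mult_right_mono) simp_all
      also have "\<dots> = norm (of_real r * u) - norm (- 1 :: complex)" using u r0 R by (simp add: norm_mult)
      also have "\<dots> \<le> norm (1 + of_real r * u)"
        using norm_triangle_ineq2[of "of_real r * u" "- 1"] by (simp add: add.commute)
      finally have "1 \<le> norm (1 + of_real r * u)" .
      moreover have "1 \<le> norm (\<Prod>r\<leftarrow>rs. 1 + of_real r * u)" using Cons by simp
      ultimately have "1 * 1 \<le> norm (1 + of_real r * u) * norm (\<Prod>r\<leftarrow>rs. 1 + of_real r * u)"
        by (intro mult_mono) auto
      then show ?case by (simp add: norm_mult)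
    qed simp
    then have "norm (H u) \<le> norm (?P u) * norm (H u)" using mult_right_mono[of 1 "norm (?P u)" "norm (H u)"] by simp
    also have "\<dots> = norm (F u)" by (simp add: H(2) norm_mult)
    also have "\<dots> \<le> exp (A - 1)" using growth[of u] u by (simp add: expA)
    finally show "norm (H u) \<le> exp (A - 1)" .
  qed simp
  have holH: "H holomorphic_on ball 0 R" using H(1) by (rule holomorphic_on_subset) simp
  have con: "contractible (ball (0::complex) R)" by (intro convex_imp_contractible convex_ball)
  have nzH: "H z \<noteq> 0" if "z \<in> ball 0 R" for z using H(3)[of z] that by simp
  have "\<exists>g. g holomorphic_on ball 0 R \<and> (\<forall>z\<in>ball 0 R. H z = exp (g z))"
  proof (rule contractible_imp_holomorphic_log[OF holH con])
    fix g assume g: "g holomorphic_on ball 0 R" "\<And>z. z \<in> ball 0 R \<Longrightarrow> H z = exp (g z)"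
    show ?thesis by (intro exI[of _ g] conjI ballI g)
  qed (fact nzH)
  then obtain g where g: "g holomorphic_on ball 0 R" "\<forall>z\<in>ball 0 R. H z = exp (g z)" by (elim exE conjE)
  have "H 0 = 1" using F(2) H(2)[of 0] by (simp add: poly_0_coeff_0 coeff_map_poly linear_prod_coeff_0)
  then have g0: "exp (g 0) = 1" using bspec[OF g(2), of 0] R by simp
  define h where "h z = g z - g 0" for z
  have h: "H z = exp (h z)" if "z \<in> ball 0 R" for z
    using bspec[OF g(2) that] g0 by (simp add: h_def exp_diff)
  have small: "norm (h z) \<le> 4 * K * (A / R)" if z: "z \<in> cball 0 K" for z
  proof -
    have zK: "norm z \<le> K" "norm z < R" using z K by auto
    have "norm (h z) * (R - norm z) \<le> 2 * A * norm z"
    proof (rule borel_caratheodory[OF _ _ R A _ zK(2)])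
      show "h holomorphic_on ball 0 R" unfolding h_def using g(1) by (intro holomorphic_intros)
      show "Re (h u) < A" if "norm u < R" for u
      proof -
        have "exp (Re (h u)) = norm (H u)" using h[of u] that by (simp add: norm_exp_eq_Re)
        also have "\<dots> \<le> exp (A - 1)" using that R by (intro bd) simp
        also have "\<dots> < exp A" by simp
        finally show ?thesis by simp
      qed
    qed (simp add: h_def)
    moreover have "norm (h z) * (R / 2) \<le> norm (h z) * (R - norm z)"
      using zK K by (intro mult_left_mono) auto
    moreover have "2 * A * norm z \<le> 2 * A * K" using zK A by (intro mult_left_mono) auto
    ultimately have "norm (h z) * (R / 2) \<le> 2 * A * K" by linarith
    then show ?thesis using R by (simp add: field_simps)
  qed
  have "norm (?P z - F z) \<le> norm (F z) * (exp (4 * K * (A / R)) - 1)" if z: "z \<in> cball 0 K" for z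
  proof -
    have zR: "z \<in> ball 0 R" using z K by auto
    have "?P z = F z * exp (- h z)" unfolding H(2) h[OF zR] by (simp add: exp_minus)
    then have "?P z - F z = F z * (exp (- h z) - 1)" by (simp add: algebra_simps)
    then have "norm (?P z - F z) = norm (F z) * norm (exp (- h z) - 1)" by (simp add: norm_mult)
    also have "\<dots> \<le> norm (F z) * (exp (4 * K * (A / R)) - 1)"
    proof (rule mult_left_mono)
      have "norm (exp (- h z) - 1) \<le> exp (norm (- h z)) - 1" by (rule norm_exp_minus_1_le)
      also have "\<dots> \<le> exp (4 * K * (A / R)) - 1" using small[OF z] by simp
      finally show "norm (exp (- h z) - 1) \<le> exp (4 * K * (A / R)) - 1" .
    qed simp
    finally show ?thesis .
  qed
  moreover have "0 < r" if "r \<in> set rs" for r using less_le_trans[OF _ rs[OF that]] R by simp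
  ultimately show ?thesis unfolding A_def[symmetric] by (intro exI[of _ rs] conjI ballI) simp_all
qed

lemma entire_order_less_1_limit:
  assumes F: "F holomorphic_on UNIV" "F 0 = (1::complex)"
    and zeros: "\<And>z. F z = 0 \<Longrightarrow> z \<in> of_real ` {..<0}"
    and growth: "\<And>z. norm (F z) \<le> C * exp (norm z powr (3 / 4))" and C: "1 \<le> C"
  shows "\<exists>rs. (\<forall>n. \<forall>r\<in>set (rs n). 0 < r) \<and> (\<forall>K. compact K \<longrightarrow>
    uniform_limit K (\<lambda>n z. cpoly (linear_prod (rs n)) z) F sequentially)"
proof -
  \<comment> \<open>The radii must tend to infinity while k (2 R)^(3/4) / R tends to 0. With R of
    order n any exponent in (0, 1/4) would do; 1/8 is its midpoint.\<close>
  define k where "k n = real (Suc n) powr (1 / 8)" for n :: nat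
  define R where "R n = 2 * real (Suc n)" for n :: nat
  have k: "0 < k n" "2 * k n \<le> R n" for n
  proof -
    have "k n \<le> real (Suc n) powr 1" unfolding k_def by (intro powr_mono) auto
    then show "2 * k n \<le> R n" by (simp add: R_def)
  qed (simp add: k_def)
  define e where "e n = exp (4 * k n * ((1 + ln C + (2 * R n) powr (3 / 4)) / R n)) - 1" for n
  have "\<forall>n. \<exists>rs. (\<forall>r\<in>set rs. 0 < r) \<and> (\<forall>z\<in>cball 0 (k n).
      norm (cpoly (linear_prod rs) z - F z) \<le> norm (F z) * e n)"
    unfolding e_def
  proof (intro allI entire_order_less_1_approx[OF F])
    show "0 < R n" for n by (simp add: R_def)
  qed (use zeros growth C k in simp_all)
  then obtain rs where rs: "\<And>n r. r \<in> set (rs n) \<Longrightarrow> 0 < r"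
    "\<And>n z. z \<in> cball 0 (k n) \<Longrightarrow> norm (cpoly (linear_prod (rs n)) z - F z) \<le> norm (F z) * e n"
    by metis
  have "(\<lambda>n. 4 * k n / R n * (1 + ln C) + 4 * k n * (2 * R n) powr (3 / 4) / R n) \<longlonglongrightarrow> 0 * (1 + ln C) + 0"
    unfolding k_def R_def by (intro tendsto_add tendsto_mult tendsto_const; real_asymp)
  then have "(\<lambda>n. 4 * k n * ((1 + ln C + (2 * R n) powr (3 / 4)) / R n)) \<longlonglongrightarrow> 0"
    by (simp add: add_divide_distrib ring_distribs mult.assoc)
  then have "e \<longlonglongrightarrow> exp 0 - 1" unfolding e_def by (intro tendsto_diff tendsto_exp tendsto_const)
  then have e: "e \<longlonglongrightarrow> 0" by simp
  have kinf: "filterlim k at_top sequentially" unfolding k_def by real_asymp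
  have "uniform_limit S (\<lambda>n z. cpoly (linear_prod (rs n)) z) F sequentially"
    if S: "compact S" for S
  proof -
    have "bounded (F ` S)"
      using S F(1) by (intro compact_imp_bounded compact_continuous_image holomorphic_on_imp_continuous_on)
        (auto intro: holomorphic_on_subset)
    then obtain B where B: "0 < B" "\<And>z. z \<in> S \<Longrightarrow> norm (F z) \<le> B" unfolding bounded_pos by auto
    obtain L where L: "\<And>z. z \<in> S \<Longrightarrow> norm z \<le> L" using compact_imp_bounded[OF S] unfolding bounded_iff by blast
    show ?thesis
    proof (rule uniform_limitI)
      fix \<epsilon> :: real assume \<epsilon>: "0 < \<epsilon>"
      have "eventually (\<lambda>n. e n < \<epsilon> / B) sequentially" using e \<epsilon> B by (intro order_tendstoD) auto
      moreover have "eventually (\<lambda>n. L \<le> k n) sequentially" using kinf by (simp add: filterlim_at_top)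
      ultimately show "\<forall>\<^sub>F n in sequentially. \<forall>z\<in>S. dist (cpoly (linear_prod (rs n)) z) (F z) < \<epsilon>"
      proof eventually_elim
        case (elim n)
        show ?case
        proof
          fix z assume z: "z \<in> S"
          have "norm (cpoly (linear_prod (rs n)) z - F z) \<le> norm (F z) * e n"
            using L[OF z] elim by (intro rs(2)) simp
          also have "\<dots> < \<epsilon>"
          proof (cases "e n \<le> 0")
            case True
            then show ?thesis using \<epsilon> mult_nonneg_nonpos[of "norm (F z)" "e n"] by simp
          next
            case False
            then have "norm (F z) * e n \<le> B * e n" using B(2)[OF z] by (intro mult_right_mono) auto
            also have "\<dots> < \<epsilon>" using elim(1) B by (simp add: field_simps)
            finally show ?thesis .
          qed
          finally show "dist (cpoly (linear_prod (rs n)) z) (F z) < \<epsilon>" by (simp add: dist_norm)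
        qed
      qed
    qed
  qed
  with rs(1) show ?thesis by (intro exI[of _ rs] conjI allI ballI impI) auto
qed

subsection \<open>The theta transformation\<close>

abbreviation kcos :: "nat \<Rightarrow> real \<Rightarrow> real" where
  "kcos k y \<equiv> cos (2 * pi * real k * y)"

text \<open>An even D on the period is a continuous function of cos (2 pi y), so Weierstrass
  approximation by polynomials in the cosine is available. Its moments against powers of the cosine
  vanish as well, and the integral of D^2 is then at most e times the integral of |D| for every e >
  0.\<close>

lemma even_function_zero_of_cos_moments:
  fixes D :: "real \<Rightarrow> real"
  assumes cont: "continuous_on {-1/2..1/2} D" and even: "\<And>y. D (- y) = D y"
    and mom: "\<And>k::nat. ((\<lambda>y. D y * kcos k y) has_integral 0) {-1/2..1/2}"
    and y: "y \<in> {-1/2..1/2}"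
  shows "D y = 0"
proof -
  \<comment> \<open>The formula cos a cos (k a) = (cos ((k+1) a) + cos ((k-1) a)) / 2 links
    different k, so the induction on the power i must run over all k simultaneously.\<close>
  have pow: "((\<lambda>y. D y * (cos (2 * pi * y)) ^ i * kcos k y) has_integral 0) {-1/2..1/2}" for i k
  proof (induction i arbitrary: k)
    case 0
    then show ?case using mom[of k] by simp
  next
    case (Suc i)
    show ?case
    proof (cases k)
      case 0
      then show ?thesis using Suc[of 1] by (simp add: mult_ac)
    next
      case (Suc l)
      have "((\<lambda>y. (D y * (cos (2 * pi * y)) ^ i * kcos (Suc k) y +
          D y * (cos (2 * pi * y)) ^ i * kcos l y) / 2) has_integral (0 + 0) / 2) {-1/2..1/2}"
        by (intro has_integral_divide has_integral_add Suc.IH)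
      moreover have "(D y * (cos (2 * pi * y)) ^ i * kcos (Suc k) y +
          D y * (cos (2 * pi * y)) ^ i * kcos l y) / 2 =
          D y * (cos (2 * pi * y)) ^ Suc i * kcos k y" for y
      proof -
        have a: "2 * pi * real (Suc k) * y = 2 * pi * real k * y + 2 * pi * y"
          "2 * pi * real l * y = 2 * pi * real k * y - 2 * pi * y"
          unfolding Suc by (simp_all add: algebra_simps)
        show ?thesis unfolding a cos_add cos_diff by (simp add: algebra_simps)
      qed
      ultimately show ?thesis by simp
    qed
  qed
  define f where "f c = D (arccos c / (2 * pi))" for c
  have fcos: "f (cos (2 * pi * y)) = D y" if "y \<in> {-1/2..1/2}" for y
  proof (cases "y \<ge> 0")
    case True
    then have "arccos (cos (2 * pi * y)) = 2 * pi * y" using that by (intro arccos_cos) auto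
    then show ?thesis by (simp add: f_def)
  next
    case False
    have "arccos (cos (2 * pi * (- y))) = 2 * pi * (- y)"
      using that False mult_left_mono[of "- y" "1/2" "2 * pi"]
      by (intro arccos_cos) (auto simp: mult_le_0_iff)
    then show ?thesis using even[of y] by (simp add: f_def)
  qed
  have contf: "continuous_on {-1..1} f"
  proof -
    have "continuous_on {-1..1} (\<lambda>c. arccos c / (2 * pi))"
      by (intro continuous_intros continuous_on_arccos) auto
    moreover have "(\<lambda>c. arccos c / (2 * pi)) ` {-1..1} \<subseteq> {-1/2..1/2}"
    proof
      fix x assume "x \<in> (\<lambda>c. arccos c / (2 * pi)) ` {-1..1}"
      then obtain c where c: "c \<in> {-1..1}" "x = arccos c / (2 * pi)" by blast
      have "0 \<le> arccos c" "arccos c \<le> pi" using c arccos_bounded[of c] by auto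
      then show "x \<in> {-1/2..1/2}" unfolding c(2) by (auto simp: field_simps intro: order.trans[of _ 0])
    qed
    ultimately show ?thesis unfolding f_def by (rule continuous_on_compose2[OF cont])
  qed
  define I where "I = integral {-1/2..1/2} (\<lambda>y. \<bar>D y\<bar>)"
  have intD: "(\<lambda>y. \<bar>D y\<bar>) integrable_on {-1/2..1/2}"
    by (intro integrable_continuous_real continuous_intros cont)
  have int2: "(\<lambda>y. D y * D y) integrable_on {-1/2..1/2}"
    by (intro integrable_continuous_real continuous_intros cont)
  have I0: "0 \<le> I" unfolding I_def using intD by (intro integral_nonneg) auto
  have "integral {-1/2..1/2} (\<lambda>y. D y * D y) \<le> e * I" if e: "0 < e" for e
  proof -
    obtain g where g: "real_polynomial_function g" "\<And>c. c \<in> {-1..1} \<Longrightarrow> \<bar>f c - g c\<bar> < e"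
      using Stone_Weierstrass_real_polynomial_function[of "{-1..1}" f e] contf e by auto
    then obtain a n where gs: "g = (\<lambda>x. \<Sum>i\<le>n. a i * x ^ i)" by (auto simp: real_polynomial_function_iff_sum)
    have "((\<lambda>y. \<Sum>i\<le>n. a i * (D y * (cos (2 * pi * y)) ^ i * kcos 0 y)) has_integral
        (\<Sum>i\<le>n. a i * 0)) {-1/2..1/2}"
      by (intro has_integral_sum has_integral_mult_right pow) simp
    then have "((\<lambda>y. D y * g (cos (2 * pi * y))) has_integral 0) {-1/2..1/2}"
      by (simp add: gs sum_distrib_left mult_ac)
    then have "((\<lambda>y. D y * D y - D y * g (cos (2 * pi * y))) has_integral
        integral {-1/2..1/2} (\<lambda>y. D y * D y) - 0) {-1/2..1/2}"
      using int2 by (intro has_integral_diff integrable_integral)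
    moreover have "((\<lambda>y. e * \<bar>D y\<bar>) has_integral e * I) {-1/2..1/2}"
      unfolding I_def using intD by (intro has_integral_mult_right integrable_integral)
    moreover have "D y * D y - D y * g (cos (2 * pi * y)) \<le> e * \<bar>D y\<bar>" if y: "y \<in> {-1/2..1/2}" for y
    proof -
      have "\<bar>D y - g (cos (2 * pi * y))\<bar> < e" using g(2)[of "cos (2 * pi * y)"] fcos[OF y] by simp
      then have "\<bar>D y\<bar> * \<bar>D y - g (cos (2 * pi * y))\<bar> \<le> \<bar>D y\<bar> * e" by (intro mult_left_mono) auto
      moreover have "D y * (D y - g (cos (2 * pi * y))) \<le> \<bar>D y\<bar> * \<bar>D y - g (cos (2 * pi * y))\<bar>"
        by (metis abs_ge_self abs_mult)
      ultimately show ?thesis by (simp add: algebra_simps)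
    qed
    ultimately have "integral {-1/2..1/2} (\<lambda>y. D y * D y) - 0 \<le> e * I" by (rule has_integral_le)
    then show ?thesis by simp
  qed
  note le = this
  have "integral {-1/2..1/2} (\<lambda>y. D y * D y) \<le> 0"
  proof (rule field_le_epsilon)
    fix e :: real assume e: "0 < e"
    have "integral {-1/2..1/2} (\<lambda>y. D y * D y) \<le> e / (I + 1) * I" using e I0 by (intro le) simp
    also have "\<dots> \<le> e" using e I0 by (simp add: field_simps)
    finally show "integral {-1/2..1/2} (\<lambda>y. D y * D y) \<le> 0 + e" by simp
  qed
  moreover have "0 \<le> integral {-1/2..1/2} (\<lambda>y. D y * D y)" using int2 by (intro integral_nonneg) auto
  ultimately have "integral {-1/2..1/2} (\<lambda>y. D y * D y) = 0" by simp
  moreover have "continuous_on {-1/2..1/2} (\<lambda>y. D y * D y)" by (intro continuous_intros cont)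
  ultimately have "\<forall>y\<in>{-1/2..1/2}. D y * D y = 0"
    using integral_eq_0_iff[of "-1/2" "1/2" "\<lambda>y. D y * D y"] by simp
  then have "D y * D y = 0" using y by blast
  then show ?thesis by simp
qed

text \<open>The real part of the characteristic function of the standard normal law at 2 pi k / c.
  The rescaling c = sqrt (2 pi x) turns u^2 / 2 into pi x u^2.\<close>

lemma gaussian_cos_integral:
  assumes x: "0 < x"
  shows "integrable lborel (\<lambda>u. exp (- pi * x * u\<^sup>2) * cos (2 * pi * k * u))"
    and "(LBINT u. exp (- pi * x * u\<^sup>2) * cos (2 * pi * k * u)) = exp (- pi * k\<^sup>2 / x) / sqrt x"
proof -
  define c where "c = sqrt (2 * pi * x)"
  have c: "0 < c" "c\<^sup>2 = 2 * pi * x" using x by (auto simp: c_def)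
  let ?t = "2 * pi * k / c"
  let ?f = "\<lambda>u. std_normal_density u * cos (?t * u)"
  have f: "integrable lborel ?f"
  proof (rule Bochner_Integration.integrable_bound)
    show "integrable lborel std_normal_density" by (rule integrable_normal_density) simp
    show "AE u in lborel. norm (?f u) \<le> norm (std_normal_density u)"
      by (auto simp: abs_mult mult_left_le)
  qed measurable
  have "exp (- (?t\<^sup>2) / 2) = Re (char std_normal_distribution ?t)"
    by (simp add: char_std_normal_distribution)
  also have "\<dots> = (LBINT u. Re (std_normal_density u *\<^sub>R iexp (?t * u)))"
  proof -
    have i: "integrable lborel (\<lambda>u. std_normal_density u *\<^sub>R iexp (?t * u))"
    proof (rule Bochner_Integration.integrable_bound)
      show "integrable lborel std_normal_density" by (rule integrable_normal_density) simp
    qed (auto simp: norm_mult)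
    have "char std_normal_distribution ?t = (CLBINT u. std_normal_density u *\<^sub>R iexp (?t * u))"
      unfolding char_def by (rule integral_density) auto
    then show ?thesis using integral_Re[OF i] by simp
  qed
  also have "\<dots> = (LBINT u. ?f u)"
    by (intro Bochner_Integration.integral_cong) (auto simp: Re_exp)
  also have "\<dots> = \<bar>c\<bar> *\<^sub>R (LBINT v. ?f (0 + c * v))"
    using c by (intro lborel_integral_real_affine) simp
  finally have e: "exp (- (?t\<^sup>2) / 2) = c * (LBINT v. ?f (0 + c * v))" using c by simp
  have g: "?f (0 + c * v) = (exp (- pi * x * v\<^sup>2) * cos (2 * pi * k * v)) / sqrt (2 * pi)" for v
    using c by (simp add: std_normal_density_def power_mult_distrib field_simps)
  have "integrable lborel (\<lambda>v. ?f (0 + c * v))"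
    using f c by (intro lborel_integrable_real_affine) auto
  then have "integrable lborel (\<lambda>v. ?f (0 + c * v) * sqrt (2 * pi))" by (rule integrable_mult_left)
  then show "integrable lborel (\<lambda>u. exp (- pi * x * u\<^sup>2) * cos (2 * pi * k * u))"
    unfolding g by simp
  have "?t\<^sup>2 / 2 = pi * k\<^sup>2 / x" using x by (simp add: power_divide c(2) power_mult_distrib power2_eq_square[of pi])
  then have "exp (- pi * k\<^sup>2 / x) = c * (LBINT u. exp (- pi * x * u\<^sup>2) * cos (2 * pi * k * u)) / sqrt (2 * pi)"
    using e unfolding g by simp
  also have "\<dots> = sqrt x * (LBINT u. exp (- pi * x * u\<^sup>2) * cos (2 * pi * k * u))"
    using x by (simp add: c_def real_sqrt_mult)
  finally show "(LBINT u. exp (- pi * x * u\<^sup>2) * cos (2 * pi * k * u)) = exp (- pi * k\<^sup>2 / x) / sqrt x"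
    using x by (simp add: field_simps)
qed

text \<open>The endpoints are half-integers so that the interval consists of 2 N + 1 translates of
  the period.\<close>

lemma integral_expanding_interval:
  fixes h :: "real \<Rightarrow> real"
  assumes h: "integrable lborel h"
  shows "(\<lambda>N. integral {- (real N + 1/2)..real N + 1/2} h) \<longlonglongrightarrow> (LBINT u. h u)"
proof -
  have "(\<lambda>N. LBINT u. indicator {- (real N + 1/2)..real N + 1/2} u *\<^sub>R h u) \<longlonglongrightarrow> (LBINT u. h u)"
  proof (rule integral_dominated_convergence[where w = "\<lambda>u. norm (h u)"])
    show "AE u in lborel. (\<lambda>N. indicator {- (real N + 1/2)..real N + 1/2} u *\<^sub>R h u) \<longlonglongrightarrow> h u"
    proof (rule AE_I2)
      fix u :: real
      obtain M where M: "\<bar>u\<bar> \<le> real M" using real_arch_simple by blast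
      have "indicator {- (real N + 1/2)..real N + 1/2} u *\<^sub>R h u = h u" if "M \<le> N" for N
        using M that by (auto simp: indicator_def)
      then have "eventually (\<lambda>N. indicator {- (real N + 1/2)..real N + 1/2} u *\<^sub>R h u = h u) sequentially"
        by (auto simp: eventually_sequentially)
      then show "(\<lambda>N. indicator {- (real N + 1/2)..real N + 1/2} u *\<^sub>R h u) \<longlonglongrightarrow> h u"
        by (rule tendsto_eventually)
    qed
  qed (use h in \<open>auto simp: indicator_def\<close>)
  moreover have "(LBINT u. indicator {- (real N + 1/2)..real N + 1/2} u *\<^sub>R h u) =
      integral {- (real N + 1/2)..real N + 1/2} h" for N
  proof -
    have "set_integrable lborel {- (real N + 1/2)..real N + 1/2} h"
      unfolding set_integrable_def using h by (intro integrable_mult_indicator) auto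
    from set_borel_integral_eq_integral(2)[OF this] show ?thesis
      by (simp add: set_lebesgue_integral_def)
  qed
  ultimately show ?thesis by simp
qed

lemma cos_moment_uniform_limit:
  fixes f :: "nat \<Rightarrow> real \<Rightarrow> real"
  assumes ul: "uniform_limit {-1/2..1/2} f g sequentially"
    and f: "\<And>N. continuous_on {-1/2..1/2} (f N)"
    and I: "\<And>N. ((\<lambda>y. f N y * kcos k y) has_integral I N) {-1/2..1/2}"
    and J: "I \<longlonglongrightarrow> J"
  shows "((\<lambda>y. g y * kcos k y) has_integral J) {-1/2..1/2}"
proof -
  have ul': "uniform_limit {-1/2..1/2} (\<lambda>N y. f N y * kcos k y)
      (\<lambda>y. g y * kcos k y) sequentially"
  proof (rule uniform_lim_mult[OF ul uniform_limit_const])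
    have "continuous_on {-1/2..1/2} g"
      by (rule uniform_limit_theorem[OF _ ul]) (use f in \<open>auto intro!: always_eventually\<close>)
    then show "bounded (g ` {-1/2..1/2})" by (intro compact_imp_bounded compact_continuous_image) auto
    show "bounded ((\<lambda>y. kcos k y) ` {-1/2..1/2})"
      by (intro compact_imp_bounded compact_continuous_image continuous_intros) auto
  qed
  obtain I' J' where I': "\<And>N. ((\<lambda>y. f N y * kcos k y) has_integral I' N) {-1/2..1/2}"
      "((\<lambda>y. g y * kcos k y) has_integral J') {-1/2..1/2}" "I' \<longlonglongrightarrow> J'"
    by (rule uniform_limit_integral[OF ul']) (intro continuous_intros f, simp, rule that, assumption+)
  have "I' = I" using has_integral_unique[OF I'(1) I] by auto
  then show ?thesis using I'(2,3) J LIMSEQ_unique by blast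
qed

text \<open>After the product-to-sum formula only zero frequencies survive. Both terms contribute at
  j = k = 0, where the integral is 1 instead of 1/2.\<close>

lemma cos_integral_unit:
  "((\<lambda>y. kcos j y * kcos k y) has_integral
    (of_bool (j + k = 0) + of_bool (j = k)) / 2) {-1/2..1/2}"
proof -
  have c: "((\<lambda>y. cos (2 * pi * of_int m * y)) has_integral of_bool (m = 0)) {-1/2..1/2}" for m :: int
  proof (cases "m = 0")
    case True
    have "((\<lambda>y. 1 :: real) has_integral 1) {-1/2..1/2::real}"
      using has_integral_const_real[of "1::real" "-1/2" "1/2"] by simp
    then show ?thesis using True by simp
  next
    case False
    define w where "w = 2 * pi * of_int m"
    have w: "w \<noteq> 0" using False by (simp add: w_def)
    have "((\<lambda>y. cos (w * y)) has_integral (sin (w * (1/2)) / w - sin (w * (-1/2)) / w)) {-1/2..1/2}"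
      by (rule fundamental_theorem_of_calculus)
        (use w in \<open>auto intro!: derivative_eq_intros simp flip: has_real_derivative_iff_has_vector_derivative\<close>)
    moreover have "sin (w * (1/2)) = 0" "sin (w * (-1/2)) = 0"
      using sin_npi_int[of m] by (simp_all add: w_def mult_ac)
    ultimately show ?thesis using False by (simp add: w_def)
  qed
  have "((\<lambda>y. (cos (2 * pi * of_int (int j + int k) * y) + cos (2 * pi * of_int (int j - int k) * y)) / 2)
      has_integral (of_bool (int j + int k = 0) + of_bool (int j - int k = 0)) / 2) {-1/2..1/2}"
    by (intro has_integral_divide has_integral_add c)
  moreover have "(cos (2 * pi * of_int (int j + int k) * y) + cos (2 * pi * of_int (int j - int k) * y)) / 2 =
      kcos j y * kcos k y" for y
  proof -
    have "2 * pi * of_int (int j + int k) * y = 2 * pi * real j * y + 2 * pi * real k * y"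
      "2 * pi * of_int (int j - int k) * y = 2 * pi * real j * y - 2 * pi * real k * y"
      by (simp_all add: algebra_simps)
    then show ?thesis by (simp add: cos_add cos_diff)
  qed
  moreover have "int j + int k = 0 \<longleftrightarrow> j + k = 0" "int j - int k = 0 \<longleftrightarrow> j = k" by auto
  ultimately show ?thesis by simp
qed

abbreviation theta_exp :: "real \<Rightarrow> nat \<Rightarrow> real" where
  "theta_exp x n \<equiv> exp (- pi * x * (real (Suc n))\<^sup>2)"

lemma theta_series_summable:
  assumes x: "0 < (x::real)"
  shows "summable (\<lambda>n. theta_exp x n)"
proof (rule summable_comparison_test'[of "\<lambda>n. exp (- pi * x) ^ n" 0])
  show "summable (\<lambda>n. exp (- pi * x) ^ n)" using x by (intro summable_geometric) simp
  fix n :: nat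
  have "pi * x * real n \<le> pi * x * (real (Suc n))\<^sup>2"
    using x by (intro mult_left_mono) (auto simp: power2_eq_square algebra_simps)
  then show "norm (theta_exp x n) \<le> exp (- pi * x) ^ n"
    by (simp add: exp_of_nat_mult[symmetric] mult_ac)
qed

text \<open>Poisson summation on the period \<open>[-1/2, 1/2]\<close>: both sides of the transformation,
  as functions of the shift \<open>y\<close>, are even and have the same cosine moments.\<close>

lemma theta_transformation:
  assumes x: "0 < x"
  shows "1 + 2 * (\<Sum>n. theta_exp x n) =
    (1 + 2 * (\<Sum>n. exp (- pi * (real (Suc n))\<^sup>2 / x))) / sqrt x"
proof -
  define g where "g u = exp (- pi * x * u\<^sup>2)" for u
  \<comment> \<open>Translates by n + 1 and -(n + 1) are paired, so that the bilateral sum becomes a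
    series over the natural numbers with even terms.\<close>
  define p where "p n y = g (y + real (Suc n)) + g (y - real (Suc n))" for n y
  define A where "A y = g y + (\<Sum>n. p n y)" for y
  define c where "c n = exp (- pi * (real (Suc n))\<^sup>2 / x)" for n
  define b where "b n y = c n * kcos (Suc n) y" for n y
  define B where "B y = (1 + 2 * (\<Sum>n. b n y)) / sqrt x" for y
  let ?I = "{-1/2..1/2::real}"
  have contg: "continuous_on S g" for S unfolding g_def by (intro continuous_intros)
  have contp: "continuous_on S (p n)" for S n
    unfolding p_def g_def by (intro continuous_intros)
  have contb: "continuous_on S (b n)" for S n
    unfolding b_def by (intro continuous_intros)
  \<comment> \<open>On the period |y \<plusminus> (n + 1)| is at least n + 1/2, and (n + 1/2)^2
    \<ge> n, which leaves a geometric majorant.\<close>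
  have bd: "norm (p n y) \<le> 2 * exp (- pi * x) ^ n" if y: "y \<in> ?I" for n y
  proof -
    have "g u \<le> exp (- pi * x) ^ n" if u: "real n + 1/2 \<le> \<bar>u\<bar>" for u
    proof -
      have "real n \<le> (real n + 1/2)\<^sup>2" by (simp add: power2_eq_square algebra_simps)
      also have "\<dots> \<le> \<bar>u\<bar>\<^sup>2" using u by (intro power_mono) auto
      finally have "pi * x * real n \<le> pi * x * u\<^sup>2" using x by (intro mult_left_mono) auto
      then show ?thesis by (simp add: g_def exp_of_nat_mult[symmetric] mult_ac)
    qed
    from this[of "y + real (Suc n)"] this[of "y - real (Suc n)"] show ?thesis
      using y by (simp add: p_def) (simp add: g_def)
  qed
  have geo: "summable (\<lambda>n. 2 * exp (- pi * x) ^ n)"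
    using x by (intro summable_mult summable_geometric) simp
  have ulA: "uniform_limit ?I (\<lambda>N y. g y + (\<Sum>n<N. p n y)) A sequentially"
    unfolding A_def
    by (intro uniform_limit_intros Weierstrass_m_test[where M = "\<lambda>n. 2 * exp (- pi * x) ^ n"] bd geo)
  have "0 < 1 / x" using x by simp
  from theta_series_summable[OF this] have sc: "summable c" by (simp add: c_def[abs_def])
  have bb: "norm (b n y) \<le> c n" for n y by (simp add: b_def abs_mult mult_left_le c_def)
  have ulB: "uniform_limit ?I (\<lambda>N y. (1 + 2 * (\<Sum>n<N. b n y)) / sqrt x) B sequentially"
  proof -
    have "uniform_limit ?I (\<lambda>N y. \<Sum>n<N. b n y) (\<lambda>y. \<Sum>n. b n y) sequentially"
      by (rule Weierstrass_m_test[OF bb sc])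
    from bounded_linear.uniform_limit[OF bounded_linear_mult_right[of "2::real"] this]
    have "uniform_limit ?I (\<lambda>N y. 1 + 2 * (\<Sum>n<N. b n y)) (\<lambda>y. 1 + 2 * (\<Sum>n. b n y)) sequentially"
      by (rule uniform_limit_add[OF uniform_limit_const])
    from bounded_linear.uniform_limit[OF bounded_linear_divide[of "sqrt x"] this]
    show ?thesis unfolding B_def .
  qed
  have contA: "continuous_on ?I (\<lambda>y. g y + (\<Sum>n<N. p n y))" for N
    by (intro continuous_intros contg contp)
  have contB: "continuous_on ?I (\<lambda>y. (1 + 2 * (\<Sum>n<N. b n y)) / sqrt x)" for N
    using x by (intro continuous_intros contb) auto
  have mA: "((\<lambda>y. A y * kcos k y) has_integral exp (- pi * (real k)\<^sup>2 / x) / sqrt x) ?I" for k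
  proof -
    define h where "h u = g u * cos (2 * pi * real k * u)" for u
    have conth: "continuous_on S h" for S unfolding h_def g_def by (intro continuous_intros)
    have per: "h (y + of_int m) = g (y + of_int m) * kcos k y" for y m
    proof -
      have "2 * pi * real k * (y + of_int m) = 2 * pi * real k * y + 2 * pi * of_int (int k * m)"
        by (simp add: algebra_simps)
      then have "cos (2 * pi * real k * (y + of_int m)) = kcos k y"
        by (simp only: cos_add cos_int_2pin sin_int_2pin mult_1_right mult_zero_right diff_zero)
      then show ?thesis by (simp add: h_def)
    qed
    \<comment> \<open>Because the cosine has integer period, the moment of the N-th partial sum
      unfolds to the integral of h over 2 N + 1 adjacent unit intervals.\<close>
    have partial: "((\<lambda>y. (g y + (\<Sum>n<N. p n y)) * kcos k y) has_integral
        integral {- (real N + 1/2)..real N + 1/2} h) ?I" for N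
    proof (induction N)
      case 0
      have "(h has_integral integral ?I h) ?I"
        by (intro integrable_integral integrable_continuous_real conth)
      then show ?case by (simp add: h_def[abs_def])
    next
      case (Suc N)
      have 1: "((\<lambda>y. h (y + of_int (int (Suc N)))) has_integral integral {real N + 1/2..real N + 3/2} h) ?I"
        using has_integral_shift_real_ivl[of h "integral {real N + 1/2..real N + 3/2} h" "real N + 1/2" "real N + 3/2" "real (Suc N)"]
        by (simp add: integrable_integral integrable_continuous_real conth)
      have 2: "((\<lambda>y. h (y + of_int (- int (Suc N)))) has_integral integral {- (real N + 3/2)..- (real N + 1/2)} h) ?I"
        using has_integral_shift_real_ivl[of h "integral {- (real N + 3/2)..- (real N + 1/2)} h" "- (real N + 3/2)" "- (real N + 1/2)" "- real (Suc N)"]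
        by (simp add: integrable_integral integrable_continuous_real conth)
      have c1: "integral {- (real N + 3/2)..- (real N + 1/2)} h + integral {- (real N + 1/2)..real N + 1/2} h
          = integral {- (real N + 3/2)..real N + 1/2} h"
        by (rule Henstock_Kurzweil_Integration.integral_combine) (auto intro: integrable_continuous_real conth)
      have c2: "integral {- (real N + 3/2)..real N + 1/2} h + integral {real N + 1/2..real N + 3/2} h
          = integral {- (real N + 3/2)..real N + 3/2} h"
        by (rule Henstock_Kurzweil_Integration.integral_combine) (auto intro: integrable_continuous_real conth)
      have e: "real (Suc N) + 1/2 = real N + 3/2" by simp
      have s: "integral {- (real (Suc N) + 1/2)..real (Suc N) + 1/2} h =
          integral {- (real N + 1/2)..real N + 1/2} h + (integral {real N + 1/2..real N + 3/2} h +
          integral {- (real N + 3/2)..- (real N + 1/2)} h)"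
        unfolding e using c1 c2 by linarith
      have "((\<lambda>y. (g y + (\<Sum>n<N. p n y)) * kcos k y +
          (h (y + of_int (int (Suc N))) + h (y + of_int (- int (Suc N))))) has_integral
          integral {- (real (Suc N) + 1/2)..real (Suc N) + 1/2} h) ?I"
        unfolding s by (intro has_integral_add Suc 1 2)
      then show ?case unfolding per by (simp add: p_def algebra_simps)
    qed
    have "(\<lambda>N. integral {- (real N + 1/2)..real N + 1/2} h) \<longlonglongrightarrow> exp (- pi * (real k)\<^sup>2 / x) / sqrt x"
      using integral_expanding_interval[of h] gaussian_cos_integral[OF x, of "real k"]
      unfolding h_def g_def by simp
    then show ?thesis by (rule cos_moment_uniform_limit[OF ulA contA partial])
  qed
  have mB: "((\<lambda>y. B y * kcos k y) has_integral exp (- pi * (real k)\<^sup>2 / x) / sqrt x) ?I" for k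
  proof -
    have partial: "((\<lambda>y. (1 + 2 * (\<Sum>n<N. b n y)) / sqrt x * kcos k y) has_integral
        (of_bool (k = 0) + (\<Sum>n<N. c n * of_bool (Suc n = k))) / sqrt x) ?I" for N
    proof -
      have 0: "((\<lambda>y. kcos 0 y * kcos k y) has_integral of_bool (k = 0)) ?I"
        using cos_integral_unit[of 0 k] by (cases "k = 0") auto
      have 1: "((\<lambda>y. 2 * c n * (kcos (Suc n) y * kcos k y)) has_integral
          2 * c n * (of_bool (Suc n = k) / 2)) ?I" for n
        using cos_integral_unit[of "Suc n" k] by (intro has_integral_mult_right) simp
      have H: "((\<lambda>y. (kcos 0 y * kcos k y +
          (\<Sum>n<N. 2 * c n * (kcos (Suc n) y * kcos k y))) / sqrt x) has_integral
          (of_bool (k = 0) + (\<Sum>n<N. 2 * c n * (of_bool (Suc n = k) / 2))) / sqrt x) ?I"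
        by (intro has_integral_divide has_integral_add has_integral_sum 0 1) simp
      have E: "(kcos 0 y * kcos k y +
          (\<Sum>n<N. 2 * c n * (kcos (Suc n) y * kcos k y))) / sqrt x =
          (1 + 2 * (\<Sum>n<N. b n y)) / sqrt x * kcos k y" for y
      proof -
        have "(\<Sum>n<N. 2 * c n * (kcos (Suc n) y * kcos k y)) =
            2 * (\<Sum>n<N. b n y) * kcos k y"
          unfolding b_def sum_distrib_left sum_distrib_right by (intro sum.cong refl) (simp only: mult_ac)
        then show ?thesis by (simp add: distrib_right)
      qed
      have V: "(\<Sum>n<N. 2 * c n * (of_bool (Suc n = k) / 2)) = (\<Sum>n<N. c n * of_bool (Suc n = k))"
        by (intro sum.cong) auto
      show ?thesis using H unfolding E V .
    qed
    have "(of_bool (k = 0) + (\<Sum>n<N. c n * of_bool (Suc n = k))) / sqrt x = exp (- pi * (real k)\<^sup>2 / x) / sqrt x"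
      if "k \<le> N" for N
    proof (cases k)
      case (Suc l)
      have "(\<Sum>n<N. c n * of_bool (Suc n = k)) = (\<Sum>n\<in>{l}. c n * of_bool (Suc n = k))"
        using that Suc by (intro sum.mono_neutral_right) auto
      then show ?thesis using Suc by (simp add: c_def)
    qed simp
    note ev = this
    have "(\<lambda>N. (of_bool (k = 0) + (\<Sum>n<N. c n * of_bool (Suc n = k))) / sqrt x) \<longlonglongrightarrow>
        exp (- pi * (real k)\<^sup>2 / x) / sqrt x"
      by (rule tendsto_eventually, rule eventually_sequentiallyI[of k]) (rule ev)
    then show ?thesis by (rule cos_moment_uniform_limit[OF ulB contB partial])
  qed
  have "A 0 - B 0 = 0"
  proof (rule even_function_zero_of_cos_moments[of "\<lambda>y. A y - B y"])
    have "continuous_on ?I A" by (rule uniform_limit_theorem[OF _ ulA]) (use contA in \<open>auto intro!: always_eventually\<close>)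
    moreover have "continuous_on ?I B"
      by (rule uniform_limit_theorem[OF _ ulB]) (use contB in \<open>auto intro!: always_eventually\<close>)
    ultimately show "continuous_on ?I (\<lambda>y. A y - B y)" by (intro continuous_intros)
    show "A (- y) - B (- y) = A y - B y" for y
    proof -
      have ge: "g (- u) = g u" for u by (simp add: g_def)
      have "p n (- y) = p n y" for n
      proof -
        have "- y + real (Suc n) = - (y - real (Suc n))" "- y - real (Suc n) = - (y + real (Suc n))"
          by simp_all
        then show ?thesis unfolding p_def by (simp only: ge add.commute)
      qed
      moreover note ge[of y]
      moreover have "b n (- y) = b n y" for n by (simp add: b_def)
      ultimately show ?thesis by (simp add: A_def B_def)
    qed
    show "((\<lambda>y. (A y - B y) * kcos k y) has_integral 0) ?I" for k
      using has_integral_diff[OF mA[of k] mB[of k]] by (simp add: algebra_simps)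
  qed auto
  moreover have "A 0 = 1 + 2 * (\<Sum>n. theta_exp x n)"
  proof -
    have "p n 0 = 2 * theta_exp x n" for n
      by (simp only: p_def g_def diff_0 add_0 power2_minus mult_2)
    then show ?thesis using suminf_mult[OF theta_series_summable[OF x], of 2]
      by (simp add: A_def g_def)
  qed
  moreover have "B 0 = (1 + 2 * (\<Sum>n. exp (- pi * (real (Suc n))\<^sup>2 / x))) / sqrt x"
    by (simp add: B_def b_def c_def)
  ultimately show ?thesis by simp
qed

subsection \<open>The kernel is even\<close>

text \<open>For x > 0, (-pi)^j times \<open>theta_moment (2 * j)\<close> is the j-th derivative of
  the half theta series, the sum of exp (- pi n^2 x) over n \<ge> 1.\<close>

definition theta_moment :: "nat \<Rightarrow> real \<Rightarrow> real" where
  "theta_moment k x = (\<Sum>n. real (Suc n) ^ k * theta_exp x n)"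

lemma power_div_fact_le_exp:
  fixes x :: real
  assumes "0 \<le> x"
  shows "x ^ k / fact k \<le> exp x"
proof -
  have s: "(\<lambda>k. x ^ k /\<^sub>R fact k) sums exp x" by (rule exp_converges)
  have "x ^ k /\<^sub>R fact k \<le> (\<Sum>k. x ^ k /\<^sub>R fact k)"
    using sum_le_suminf[OF sums_summable[OF s], of "{k}"] assms by simp
  then show ?thesis using sums_unique[OF s] by (simp add: field_simps)
qed

text \<open>Half of the exponent, with rate a = pi x / 2, absorbs the power m^k; the other half
  leaves the theta series at x / 2.\<close>

lemma theta_moment_summable:
  assumes x: "0 < (x::real)"
  shows "summable (\<lambda>n. real (Suc n) ^ k * theta_exp x n)"
proof -
  define a where "a = pi * x / 2"
  have a: "0 < a" using x by (simp add: a_def)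
  show ?thesis
  proof (rule summable_comparison_test'[of "\<lambda>n. fact k / a ^ k * theta_exp (x / 2) n" 0])
    show "summable (\<lambda>n. fact k / a ^ k * theta_exp (x / 2) n)"
      using x by (intro summable_mult theta_series_summable) simp
    fix n :: nat
    define m where "m = real (Suc n)"
    have m: "1 \<le> m" by (simp add: m_def)
    have "(a * m) ^ k / fact k \<le> exp (a * m)" using a m by (intro power_div_fact_le_exp) simp
    also have "\<dots> \<le> exp (a * m\<^sup>2)" using a m by (simp add: power2_eq_square)
    finally have "m ^ k \<le> fact k / a ^ k * exp (a * m\<^sup>2)"
      using a by (simp add: power_mult_distrib field_simps)
    then have "m ^ k * exp (- pi * x * m\<^sup>2) \<le> fact k / a ^ k * exp (a * m\<^sup>2) * exp (- pi * x * m\<^sup>2)"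
      by (intro mult_right_mono) auto
    also have "\<dots> = fact k / a ^ k * exp (- pi * (x / 2) * m\<^sup>2)"
      by (simp add: mult.assoc exp_add[symmetric] a_def)
    finally show "norm (real (Suc n) ^ k * theta_exp x n) \<le>
        fact k / a ^ k * theta_exp (x / 2) n"
      unfolding m_def[symmetric] using m by simp
  qed
qed

lemma theta_moment_deriv:
  assumes x: "0 < x"
  shows "(theta_moment k has_real_derivative - pi * theta_moment (k + 2) x) (at x)"
proof -
  define S where "S = {x/2<..}"
  let ?f = "\<lambda>n x. real (Suc n) ^ k * theta_exp x n"
  let ?f' = "\<lambda>n x. - pi * (real (Suc n) ^ (k + 2) * theta_exp x n)"
  have "((\<lambda>x. \<Sum>n. ?f n x) has_field_derivative (\<Sum>n. ?f' n x)) (at x)"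
  proof (rule has_field_derivative_series'(2)[where S = S])
    show "convex S" by (simp add: S_def)
    show "(?f n has_field_derivative ?f' n y) (at y within S)" if "y \<in> S" for n y
      by (auto intro!: derivative_eq_intros simp: power_add power2_eq_square)
    show "uniformly_convergent_on S (\<lambda>n y. \<Sum>i<n. ?f' i y)"
    proof (rule Weierstrass_m_test'[where M = "\<lambda>n. pi * (real (Suc n) ^ (k + 2) * theta_exp (x/2) n)"])
      show "summable (\<lambda>n. pi * (real (Suc n) ^ (k + 2) * theta_exp (x/2) n))"
        using x by (intro summable_mult theta_moment_summable) simp
      show "norm (?f' n y) \<le> pi * (real (Suc n) ^ (k + 2) * theta_exp (x/2) n)"
        if "y \<in> S" for n y
      proof -
        have "pi * (x/2) * (real (Suc n))\<^sup>2 \<le> pi * y * (real (Suc n))\<^sup>2"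
          using that by (intro mult_right_mono mult_left_mono) (auto simp: S_def)
        then show ?thesis by (simp add: abs_mult)
      qed
    qed
    show "summable (\<lambda>n. ?f n x)" using x by (rule theta_moment_summable)
    show "x \<in> S" "x \<in> interior S" using x by (auto simp: S_def interior_open)
  qed
  moreover have "(\<Sum>n. ?f' n x) = - pi * theta_moment (k + 2) x"
    unfolding theta_moment_def using x by (intro suminf_mult theta_moment_summable)
  ultimately show ?thesis unfolding theta_moment_def[abs_def] by simp
qed

definition phi_term :: "nat \<Rightarrow> real \<Rightarrow> real" where
  "phi_term i t = (2 * real (Suc i) ^ 4 * pi\<^sup>2 * exp (9 * t) - 3 * (real (Suc i))\<^sup>2 * pi * exp (5 * t)) *
     exp (- (real (Suc i))\<^sup>2 * pi * exp (4 * t))"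

lemma phi_term_sums: "(\<lambda>i. phi_term i t) sums Phi t"
  and Phi_theta_moment: "Phi t = 2 * pi\<^sup>2 * exp (9 * t) * theta_moment 4 (exp (4 * t)) -
    3 * pi * exp (5 * t) * theta_moment 2 (exp (4 * t))"
proof -
  have s: "(\<lambda>i. real (Suc i) ^ k * theta_exp (exp (4 * t)) i) sums theta_moment k (exp (4 * t))" for k
    unfolding theta_moment_def by (intro summable_sums theta_moment_summable) simp
  have "(\<lambda>i. 2 * pi\<^sup>2 * exp (9 * t) * (real (Suc i) ^ 4 * theta_exp (exp (4 * t)) i) -
      3 * pi * exp (5 * t) * ((real (Suc i))\<^sup>2 * theta_exp (exp (4 * t)) i)) sums
      (2 * pi\<^sup>2 * exp (9 * t) * theta_moment 4 (exp (4 * t)) - 3 * pi * exp (5 * t) * theta_moment 2 (exp (4 * t)))"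
    by (intro sums_diff sums_mult s)
  also have "(\<lambda>i. 2 * pi\<^sup>2 * exp (9 * t) * (real (Suc i) ^ 4 * theta_exp (exp (4 * t)) i) -
      3 * pi * exp (5 * t) * ((real (Suc i))\<^sup>2 * theta_exp (exp (4 * t)) i)) = (\<lambda>i. phi_term i t)"
    by (rule ext) (simp add: phi_term_def algebra_simps)
  finally have *: "(\<lambda>i. phi_term i t) sums
      (2 * pi\<^sup>2 * exp (9 * t) * theta_moment 4 (exp (4 * t)) - 3 * pi * exp (5 * t) * theta_moment 2 (exp (4 * t)))" .
  have "Phi t = (\<Sum>i. phi_term i t)" by (simp add: Phi_def phi_term_def Let_def)
  with * show "(\<lambda>i. phi_term i t) sums Phi t"
    "Phi t = 2 * pi\<^sup>2 * exp (9 * t) * theta_moment 4 (exp (4 * t)) -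
      3 * pi * exp (5 * t) * theta_moment 2 (exp (4 * t))"
    by (simp_all add: sums_iff)
qed

lemma DERIV_even:
  assumes "\<And>t. (G has_real_derivative G' t) (at t)" and "\<And>t. G (- t) = c * G t"
  shows "G' (- t) = - c * G' t"
proof -
  have "((\<lambda>t. G (- t)) has_real_derivative G' (- t) * (- 1)) (at t)"
    by (rule DERIV_chain2[OF assms(1)]) (auto intro!: derivative_eq_intros)
  moreover have "((\<lambda>t. c * G t) has_real_derivative c * G' t) (at t)"
    by (intro DERIV_cmult assms)
  moreover have "(\<lambda>t. G (- t)) = (\<lambda>t. c * G t)" by (rule ext) (rule assms(2))
  ultimately have "G' (- t) * (- 1) = c * G' t" using DERIV_unique by metis
  then show ?thesis by simp
qed

text \<open>With \<open>G t = e\<^sup>t \<theta> (e\<^sup>4\<^sup>t)\<close>, which is even by the theta transformation, one has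
  \<open>16 \<Phi> = G'' - G\<close>.\<close>

lemma Phi_even: "Phi (- t) = Phi t"
proof -
  let ?T = "\<lambda>k t. theta_moment k (exp (4 * t))"
  define G where "G t = exp t * (1 + 2 * ?T 0 t)" for t
  define G1 where "G1 t = G t - 8 * pi * exp (5 * t) * ?T 2 t" for t
  have T: "(?T k has_real_derivative (- pi * ?T (k + 2) t) * (exp (4 * t) * 4)) (at t)" for k t
    by (rule DERIV_chain2[OF theta_moment_deriv]) (auto intro!: derivative_eq_intros)
  have e: "exp t * exp (4 * t) = exp (5 * t)" "exp (5 * t) * exp (4 * t) = exp (9 * t)" for t :: real
    by (simp_all add: exp_add[symmetric])
  have G: "(G has_real_derivative G1 t) (at t)" for t
  proof -
    have "(G has_real_derivative exp t * (1 + 2 * ?T 0 t) +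
        exp t * (2 * ((- pi * ?T (0 + 2) t) * (exp (4 * t) * 4)))) (at t)"
      unfolding G_def by (rule derivative_eq_intros T refl)+ simp
    moreover have "exp t * (1 + 2 * ?T 0 t) +
        exp t * (2 * ((- pi * ?T (0 + 2) t) * (exp (4 * t) * 4))) = G1 t"
      unfolding G1_def G_def e(1)[symmetric] by (simp add: numeral_2_eq_2 algebra_simps)
    ultimately show ?thesis by simp
  qed
  have G1: "(G1 has_real_derivative G t + 16 * Phi t) (at t)" for t
  proof -
    have "(G1 has_real_derivative G1 t - (8 * pi * (exp (5 * t) * 5) * ?T 2 t +
        8 * pi * exp (5 * t) * ((- pi * ?T (2 + 2) t) * (exp (4 * t) * 4)))) (at t)"
      unfolding G1_def by (rule derivative_eq_intros T G[unfolded G1_def] refl | simp)+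
    moreover have "G1 t - (8 * pi * (exp (5 * t) * 5) * ?T 2 t +
        8 * pi * exp (5 * t) * ((- pi * ?T (2 + 2) t) * (exp (4 * t) * 4))) = G t + 16 * Phi t"
      unfolding G1_def Phi_theta_moment e(2)[symmetric] by (simp add: power2_eq_square algebra_simps)
    ultimately show ?thesis by simp
  qed
  have even: "G (- t) = 1 * G t" for t
  proof -
    \<comment> \<open>The theta transformation at x = e^(4t): passing to 1/x means passing to -t,
      and sqrt x = e^(2t) is what changes the weight e^t into e^(-t).\<close>
    have "1 + 2 * ?T 0 t = (1 + 2 * ?T 0 (- t)) / sqrt (exp (4 * t))"
      using theta_transformation[of "exp (4 * t)"] by (simp add: theta_moment_def exp_minus field_simps)
    also have "sqrt (exp (4 * t)) = exp (2 * t)"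
      using real_sqrt_abs[of "exp (2 * t)"] by (simp add: power2_eq_square exp_add[symmetric])
    finally have "G t = exp t * ((1 + 2 * ?T 0 (- t)) / exp (2 * t))" by (simp add: G_def)
    also have "\<dots> = exp (- t) * (1 + 2 * ?T 0 (- t))"
    proof -
      have "exp t / exp (2 * t) = exp (- t)" by (simp add: exp_diff[symmetric])
      then show ?thesis by (metis times_divide_eq_left times_divide_eq_right)
    qed
    finally show ?thesis by (simp add: G_def)
  qed
  have 1: "G1 (- t) = - 1 * G1 t" for t by (rule DERIV_even[OF G even])
  have "G (- t) + 16 * Phi (- t) = - (- 1) * (G t + 16 * Phi t)" by (rule DERIV_even[OF G1 1])
  then show ?thesis using even[of t] by simp
qed

subsection \<open>The Mellin transform of the kernel\<close>

text \<open>The substitution u = c e^(4t) in Euler's integral, with du = 4 u dt; hence the factor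
  1/4 and the power of c.\<close>

lemma exp_Gamma_integral:
  fixes z :: complex
  assumes c: "0 < c" and z: "0 < Re z"
  shows "has_bochner_integral lborel (\<lambda>t. exp (4 * z * of_real t) * of_real (exp (- c * exp (4 * t))))
    (of_real c powr (- z) * Gamma z / 4)"
proof -
  define g where "g t = c * exp (4 * t)" for t
  define f where "f u = complex_of_real u powr (z - 1) / of_real (exp u)" for u
  let ?h = "\<lambda>t. exp (4 * z * of_real t) * of_real (exp (- c * exp (4 * t)))"
  have img: "g ` UNIV = {0<..}"
  proof
    show "g ` UNIV \<subseteq> {0<..}" using c by (auto simp: g_def)
    show "{0<..} \<subseteq> g ` UNIV"
    proof
      fix u :: real assume "u \<in> {0<..}"
      then have "u = g (ln (u / c) / 4)" using c by (simp add: g_def)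
      then show "u \<in> g ` UNIV" by blast
    qed
  qed
  have "(\<lambda>t. \<bar>4 * g t\<bar> *\<^sub>R f (g t)) absolutely_integrable_on UNIV \<and>
      integral UNIV (\<lambda>t. \<bar>4 * g t\<bar> *\<^sub>R f (g t)) = Gamma z"
  proof (subst has_absolute_integral_change_of_variables_real)
    show "(g has_field_derivative 4 * g t) (at t within UNIV)" for t
      unfolding g_def by (auto intro!: derivative_eq_intros)
    show "inj_on g UNIV" using c by (auto simp: inj_on_def g_def)
    show "f absolutely_integrable_on g ` UNIV \<and> integral (g ` UNIV) f = Gamma z"
      unfolding img f_def using absolutely_integrable_Gamma_integral'[OF z] Gamma_integral_complex'[OF z]
      by (auto intro: integral_unique)
  qed simp
  moreover have "\<bar>4 * g t\<bar> *\<^sub>R f (g t) = 4 * of_real c powr z * ?h t" for t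
  proof -
    have gp: "0 < g t" using c by (simp add: g_def)
    have "of_real (g t) * (of_real (g t) powr (z - 1)) = of_real (g t) powr z"
      using gp by (simp add: powr_diff)
    moreover have "complex_of_real (g t) powr z = of_real c powr z * exp (4 * z * of_real t)"
    proof -
      have "complex_of_real (g t) powr z = exp (z * of_real (ln c + 4 * t))"
      proof -
        have "ln (g t) = ln c + 4 * t" using c by (simp add: g_def ln_mult)
        then have "Ln (complex_of_real (g t)) = of_real (ln c + 4 * t)" using Ln_of_real[OF gp] by simp
        then show ?thesis using gp by (simp add: powr_def)
      qed
      also have "\<dots> = exp (z * of_real (ln c)) * exp (4 * z * of_real t)"
        by (simp add: exp_add[symmetric] algebra_simps)
      also have "exp (z * of_real (ln c)) = of_real c powr z"
        using c by (simp add: powr_def Ln_of_real)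
      finally show ?thesis .
    qed
    moreover have "1 / complex_of_real (exp (g t)) = of_real (exp (- c * exp (4 * t)))"
      by (simp add: g_def exp_minus field_simps)
    ultimately show ?thesis using gp
      by (simp add: f_def scaleR_conv_of_real divide_inverse mult_ac)
  qed
  ultimately have A: "(\<lambda>t. 4 * of_real c powr z * ?h t) absolutely_integrable_on UNIV"
      "integral UNIV (\<lambda>t. 4 * of_real c powr z * ?h t) = Gamma z" by simp_all
  have K: "4 * complex_of_real c powr z \<noteq> 0" using c by (simp add: powr_def)
  have si: "set_integrable lborel UNIV (\<lambda>t. 4 * of_real c powr z * ?h t)"
    using A(1) unfolding set_integrable_def by (subst (asm) integrable_completion) auto
  have L: "integrable lborel (\<lambda>t. 4 * of_real c powr z * ?h t)"
    using si unfolding set_integrable_def by simp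
  have I: "(LINT t|lborel. 4 * of_real c powr z * ?h t) = Gamma z"
    using set_borel_integral_eq_integral(2)[OF si] unfolding A(2) set_lebesgue_integral_def by simp
  have "has_bochner_integral lborel (\<lambda>t. 4 * of_real c powr z * ?h t) (Gamma z)"
    unfolding has_bochner_integral_iff by (intro conjI L I)
  from has_bochner_integral_mult_right[OF this, of "1 / (4 * of_real c powr z)"] K
  show ?thesis by (simp add: powr_minus field_simps)
qed

text \<open>The summands of Phi with an adjustable sign: e = -1 gives \<open>phi_term\<close>, and e
  = 1 gives a majorant of its absolute value. Both signs are thus covered by one
  computation.\<close>

definition phi_gen :: "real \<Rightarrow> nat \<Rightarrow> real \<Rightarrow> real" where
  "phi_gen e i t = 2 * real (Suc i) ^ 4 * pi\<^sup>2 * (exp (9 * t) * exp (- ((real (Suc i))\<^sup>2 * pi) * exp (4 * t))) +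
    e * (3 * (real (Suc i))\<^sup>2 * pi) * (exp (5 * t) * exp (- ((real (Suc i))\<^sup>2 * pi) * exp (4 * t)))"

lemma phi_term_eq_phi_gen: "phi_term i t = phi_gen (- 1) i t"
  by (simp add: phi_term_def phi_gen_def algebra_simps)

text \<open>The exponents combine as 9 + (2 s - 1) = 4 (s/2 + 2) and 5 + (2 s - 1) = 4 (s/2 + 1).
  With c = m^2 pi the powers m^4 and m^2 cancel against those of c, so both terms scale with m = i +
  1 as m^(-s) and the Dirichlet series appears.\<close>

lemma phi_gen_integral:
  assumes s: "0 < Re s"
  shows "has_bochner_integral lborel (\<lambda>t. of_real (phi_gen e i t) * exp ((2 * s - 1) * of_real t))
    (of_real pi powr (- s / 2) * (2 * Gamma (s / 2 + 2) + of_real e * 3 * Gamma (s / 2 + 1)) / 4 *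
      of_nat (Suc i) powr (- s))"
proof -
  define m where "m = real (Suc i)"
  define c where "c = m\<^sup>2 * pi"
  have m: "0 < m" by (simp add: m_def)
  have c: "0 < c" using m by (simp add: c_def)
  let ?e = "\<lambda>z t. exp (4 * z * of_real t) * complex_of_real (exp (- c * exp (4 * t)))"
  have H: "has_bochner_integral lborel (\<lambda>t. of_real (2 * m ^ 4 * pi\<^sup>2) * ?e (s / 2 + 2) t +
      of_real (e * (3 * m\<^sup>2 * pi)) * ?e (s / 2 + 1) t)
      (of_real (2 * m ^ 4 * pi\<^sup>2) * (of_real c powr (- (s / 2 + 2)) * Gamma (s / 2 + 2) / 4) +
       of_real (e * (3 * m\<^sup>2 * pi)) * (of_real c powr (- (s / 2 + 1)) * Gamma (s / 2 + 1) / 4))" (is "has_bochner_integral _ ?f ?I")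
    by (intro has_bochner_integral_add has_bochner_integral_mult_right exp_Gamma_integral c) (use s in auto)
  have F: "?f = (\<lambda>t. of_real (phi_gen e i t) * exp ((2 * s - 1) * of_real t))"
  proof
    fix t
    have "exp (4 * (s / 2 + 2) * of_real t) = of_real (exp (9 * t)) * exp ((2 * s - 1) * of_real t)"
      "exp (4 * (s / 2 + 1) * of_real t) = of_real (exp (5 * t)) * exp ((2 * s - 1) * of_real t)"
      unfolding exp_of_real[symmetric] exp_add[symmetric] by (simp_all add: algebra_simps)
    then show "?f t = of_real (phi_gen e i t) * exp ((2 * s - 1) * of_real t)"
      unfolding phi_gen_def m_def[symmetric] c_def by (simp add: algebra_simps)
  qed
  have E: "?I = of_real pi powr (- s / 2) * (2 * Gamma (s / 2 + 2) + of_real e * 3 * Gamma (s / 2 + 1)) / 4 *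
      of_nat (Suc i) powr (- s)"
  proof -
    have c0: "complex_of_real c \<noteq> 0" using c by simp
    have p2: "of_real c powr (- (s / 2 + 2)) = of_real c powr (- s / 2) / of_real c ^ 2"
      and p1: "of_real c powr (- (s / 2 + 1)) = of_real c powr (- s / 2) / of_real c"
      using c0 by (simp_all add: powr_diff[of _ "- s / 2" 2, simplified] powr_diff[of _ "- s / 2" 1, simplified] powr_numeral)
    have cp: "of_real c powr (- s / 2) = of_real pi powr (- s / 2) * of_nat (Suc i) powr (- s)"
    proof -
      have lc: "ln c = 2 * ln m + ln pi" using m by (simp add: c_def ln_mult ln_realpow)
      have "of_real c powr (- s / 2) = exp (- s / 2 * of_real (ln c))"
        using c by (simp add: powr_def Ln_of_real)
      also have "\<dots> = exp (- s / 2 * of_real (ln pi)) * exp (- s * of_real (ln m))"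
        unfolding lc exp_add[symmetric] by (simp add: algebra_simps)
      also have "exp (- s / 2 * of_real (ln pi)) = of_real pi powr (- s / 2)"
        by (simp add: powr_def Ln_of_real)
      also have "exp (- s * of_real (ln m)) = of_real m powr (- s)"
        using m by (simp add: powr_def Ln_of_real)
      also have "complex_of_real m = of_nat (Suc i)" by (simp add: m_def)
      finally show ?thesis .
    qed
    have e: "of_real (2 * m ^ 4 * pi\<^sup>2) / of_real c ^ 2 = (2 :: complex)"
      "of_real (e * (3 * m\<^sup>2 * pi)) / of_real c = (of_real e * 3 :: complex)"
      using m by (simp_all add: c_def power_mult_distrib field_simps flip: power_mult)
    have "?I = of_real (2 * m ^ 4 * pi\<^sup>2) / of_real c ^ 2 * of_real c powr (- s / 2) * Gamma (s / 2 + 2) / 4 +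
        of_real (e * (3 * m\<^sup>2 * pi)) / of_real c * of_real c powr (- s / 2) * Gamma (s / 2 + 1) / 4"
      unfolding p1 p2 by (simp only: times_divide_eq_left times_divide_eq_right mult_ac)
    then show ?thesis unfolding e cp by (simp add: field_simps)
  qed
  show ?thesis using H unfolding F E .
qed

text \<open>A quarter of the factor that turns zeta into the Riemann xi function.\<close>

abbreviation xi_factor :: "complex \<Rightarrow> complex" where
  "xi_factor s \<equiv> s * (s - 1) * of_real pi powr (- s / 2) * Gamma (s / 2) / 8"

lemma Re_pos_not_nonpos_Int: "0 < Re u \<Longrightarrow> u \<notin> \<int>\<^sub>\<le>\<^sub>0"
  by (auto elim!: nonpos_Ints_cases)

text \<open>Here the coefficients 2 and 3 of Phi pay off: reduced to Gamma (s/2), the combination is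
  (s/2) (s + 2 - 3).\<close>

lemma xi_Gamma_identity:
  assumes s: "0 < Re (s :: complex)"
  shows "2 * Gamma (s / 2 + 2) - 3 * Gamma (s / 2 + 1) = s * (s - 1) * Gamma (s / 2) / 2"
proof -
  have G1: "Gamma (s / 2 + 1) = s / 2 * Gamma (s / 2)" using s by (intro Gamma_plus1 Re_pos_not_nonpos_Int) simp
  have "s / 2 + 1 \<notin> \<int>\<^sub>\<le>\<^sub>0" using s by (intro Re_pos_not_nonpos_Int) simp
  then have "Gamma (s / 2 + 1 + 1) = (s / 2 + 1) * Gamma (s / 2 + 1)" by (rule Gamma_plus1)
  then have G2: "Gamma (s / 2 + 2) = (s / 2 + 1) * (s / 2 * Gamma (s / 2))" by (simp add: G1 add.assoc)
  show ?thesis unfolding G1 G2 by (simp add: field_simps)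
qed

lemma dirichlet_series_summable:
  assumes "1 < x"
  shows "summable (\<lambda>i. norm (of_nat (Suc i) powr (- of_real x) :: complex))"
proof -
  have "norm (of_nat (Suc i) powr (- of_real x) :: complex) = real (Suc i) powr (- x)" for i
    by (subst norm_powr_real_powr) auto
  moreover have "summable (\<lambda>i. real (Suc i) powr (- x))"
    using assms by (subst summable_Suc_iff) (simp add: summable_real_powr_iff)
  ultimately show ?thesis by simp
qed

text \<open>Integration term by term. The summands change sign for negative t, so absolute
  convergence is obtained from the majorant \<open>phi_gen 1\<close> at the real part x of s: its
  integrals are a constant times n^(-x), which is summable.\<close>

lemma Phi_mellin:
  assumes s: "1 < Re s"
  shows "has_bochner_integral lborel (\<lambda>t. of_real (Phi t) * exp ((2 * s - 1) * of_real t))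
    (xi_factor s * (\<Sum>i. of_nat (Suc i) powr (- s)))"
    and "summable (\<lambda>i. of_nat (Suc i) powr (- s))"
proof -
  define x where "x = Re s"
  define f where "f i t = of_real (phi_gen (- 1) i t) * exp ((2 * s - 1) * of_real t)" for i t
  define g where "g i t = phi_gen 1 i t * exp ((2 * x - 1) * t)" for i t
  define K where "K = xi_factor s"
  have np: "norm (of_nat (Suc i) powr (- s) :: complex) = norm (of_nat (Suc i) powr (- of_real x) :: complex)" for i
    unfolding x_def by (subst (1 2) norm_powr_real_powr) auto
  have sn: "summable (\<lambda>i. norm (of_nat (Suc i) powr (- s) :: complex))"
    unfolding np using s by (intro dirichlet_series_summable) (simp add: x_def)
  then show sm: "summable (\<lambda>i. of_nat (Suc i) powr (- s))" by (rule summable_norm_cancel)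
  have fint: "has_bochner_integral lborel (f i) (K * of_nat (Suc i) powr (- s))" for i
  proof -
    have "of_real pi powr (- s / 2) * (2 * Gamma (s / 2 + 2) + of_real (- 1) * 3 * Gamma (s / 2 + 1)) / 4 = K"
    proof -
      have "2 * Gamma (s / 2 + 2) + of_real (- 1) * 3 * Gamma (s / 2 + 1) = s * (s - 1) * Gamma (s / 2) / 2"
        using xi_Gamma_identity[of s] s by simp
      then show ?thesis unfolding K_def by (simp only:) (simp add: field_simps)
    qed
    then show ?thesis unfolding f_def using phi_gen_integral[of s "- 1" i] s by simp
  qed
  have fg: "norm (f i t) \<le> g i t" for i t
  proof -
    have "\<bar>phi_gen (- 1) i t\<bar> \<le> phi_gen 1 i t"
      unfolding phi_gen_def by (intro order.trans[OF abs_triangle_ineq]) (simp add: abs_mult)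
    moreover have e: "norm (exp ((2 * s - 1) * of_real t)) = exp ((2 * x - 1) * t)"
      by (simp add: norm_exp_eq_Re x_def)
    ultimately show ?thesis
      unfolding f_def g_def norm_mult e norm_of_real by (intro mult_right_mono) auto
  qed
  define L where "L = norm (of_real pi powr (- of_real x / 2) *
    (2 * Gamma (of_real x / 2 + 2) + of_real 1 * 3 * Gamma (of_real x / 2 + 1)) / 4 :: complex)"
  have gint: "integrable lborel (g i)"
    and gle: "(LINT t|lborel. g i t) \<le> L * norm (of_nat (Suc i) powr (- of_real x) :: complex)" for i
  proof -
    have "has_bochner_integral lborel (\<lambda>t. of_real (phi_gen 1 i t) * exp ((2 * of_real x - 1) * of_real t))
      (of_real pi powr (- of_real x / 2) * (2 * Gamma (of_real x / 2 + 2) + of_real 1 * 3 * Gamma (of_real x / 2 + 1)) / 4 *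
      of_nat (Suc i) powr (- of_real x) :: complex)" (is "has_bochner_integral _ _ ?V")
      using s by (intro phi_gen_integral) (simp add: x_def)
    moreover have "of_real (phi_gen 1 i t) * exp ((2 * of_real x - 1) * of_real t) = complex_of_real (g i t)" for t
      by (simp add: g_def exp_of_real[symmetric])
    ultimately have *: "has_bochner_integral lborel (\<lambda>t. complex_of_real (g i t)) ?V" by simp
    then have "integrable lborel (\<lambda>t. complex_of_real (g i t))" by (simp add: has_bochner_integral_iff)
    then show "integrable lborel (g i)" unfolding complex_of_real_integrable_eq .
    have "of_real (LINT t|lborel. g i t) = ?V" using * by (simp add: has_bochner_integral_iff)
    then have "\<bar>LINT t|lborel. g i t\<bar> = norm ?V" by (metis norm_of_real)
    then show "(LINT t|lborel. g i t) \<le> L * norm (of_nat (Suc i) powr (- of_real x) :: complex)"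
      unfolding L_def norm_mult[symmetric] by linarith
  qed
  have sint: "summable (\<lambda>i. LINT t|lborel. norm (f i t))"
  proof (rule summable_comparison_test'[of "\<lambda>i. L * norm (of_nat (Suc i) powr (- of_real x) :: complex)" 0])
    show "summable (\<lambda>i. L * norm (of_nat (Suc i) powr (- of_real x) :: complex))"
      using s by (intro summable_mult dirichlet_series_summable) (simp add: x_def)
    show "norm (LINT t|lborel. norm (f i t)) \<le> L * norm (of_nat (Suc i) powr (- of_real x) :: complex)" for i
    proof -
      have "(LINT t|lborel. norm (f i t)) \<le> (LINT t|lborel. g i t)"
        using fint[of i] fg gint by (intro integral_mono) (auto simp: has_bochner_integral_iff)
      moreover have "0 \<le> (LINT t|lborel. norm (f i t))" by (intro integral_nonneg_AE) simp
      ultimately show ?thesis using gle[of i] by simp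
    qed
  qed
  have spt: "summable (\<lambda>i. norm (f i t))" for t
  proof (rule summable_comparison_test'[of "\<lambda>i. g i t" 0])
    have *: "summable (\<lambda>i. real (Suc i) ^ k * exp (- ((real (Suc i))\<^sup>2 * pi) * exp (4 * t)))" for k
      using theta_moment_summable[of "exp (4 * t)" k] by (simp add: mult_ac)
    have "summable (\<lambda>i. 2 * pi\<^sup>2 * exp (9 * t) * (real (Suc i) ^ 4 * exp (- ((real (Suc i))\<^sup>2 * pi) * exp (4 * t))) +
        3 * pi * exp (5 * t) * ((real (Suc i))\<^sup>2 * exp (- ((real (Suc i))\<^sup>2 * pi) * exp (4 * t))))"
      by (intro summable_add summable_mult *)
    also have "(\<lambda>i. 2 * pi\<^sup>2 * exp (9 * t) * (real (Suc i) ^ 4 * exp (- ((real (Suc i))\<^sup>2 * pi) * exp (4 * t))) +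
        3 * pi * exp (5 * t) * ((real (Suc i))\<^sup>2 * exp (- ((real (Suc i))\<^sup>2 * pi) * exp (4 * t)))) = (\<lambda>i. phi_gen 1 i t)"
      by (rule ext) (simp add: phi_gen_def mult_ac)
    finally show "summable (\<lambda>i. g i t)" unfolding g_def by (rule summable_mult2)
  qed (use fg in simp)
  have lim: "(\<Sum>i. f i t) = of_real (Phi t) * exp ((2 * s - 1) * of_real t)" for t
  proof -
    have "(\<lambda>i. of_real (phi_term i t) * exp ((2 * s - 1) * of_real t)) sums
        (of_real (Phi t) * exp ((2 * s - 1) * of_real t))"
      by (intro sums_mult2 sums_of_real phi_term_sums)
    then show ?thesis by (simp add: f_def sums_iff phi_term_eq_phi_gen)
  qed
  have fi: "integrable lborel (f i)" "integral\<^sup>L lborel (f i) = K * of_nat (Suc i) powr (- s)" for i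
    using fint[of i] by (simp_all add: has_bochner_integral_iff)
  have AE: "AE t in lborel. summable (\<lambda>i. norm (f i t))" using spt by simp
  have "integrable lborel (\<lambda>t. \<Sum>i. f i t)" by (rule integrable_suminf[OF fi(1) AE sint])
  moreover have "(LINT t|lborel. (\<Sum>i. f i t)) = (\<Sum>i. K * of_nat (Suc i) powr (- s))"
    using integral_suminf[OF fi(1) AE sint] by (simp add: fi(2))
  moreover have "(\<Sum>i. K * of_nat (Suc i) powr (- s)) = K * (\<Sum>i. of_nat (Suc i) powr (- s))"
    using sm by (rule suminf_mult)
  ultimately show "has_bochner_integral lborel (\<lambda>t. of_real (Phi t) * exp ((2 * s - 1) * of_real t))
    (xi_factor s * (\<Sum>i. of_nat (Suc i) powr (- s)))"
    unfolding has_bochner_integral_iff lim K_def by simp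
qed

section \<open>Positivity and decay of the kernel on the half-line\<close>

lemma Phi_borel_measurable [measurable]: "Phi \<in> borel_measurable borel"
proof -
  have e: "Phi = (\<lambda>t. \<Sum>i. phi_term i t)" by (rule ext) (rule sums_unique[OF phi_term_sums])
  have "phi_term i \<in> borel_measurable borel" for i
    unfolding phi_term_def[abs_def] by measurable
  then show ?thesis unfolding e by (rule borel_measurable_suminf)
qed

lemma phi_term_pos:
  assumes t: "0 \<le> t"
  shows "0 < phi_term i t"
proof -
  let ?m = "real (Suc i)"
  have "3 < 2 * pi" using pi_gt3 by simp
  also have "\<dots> \<le> 2 * pi * (?m\<^sup>2 * exp (4 * t))"
  proof -
    have "1 * 1 \<le> ?m\<^sup>2 * exp (4 * t)" using t by (intro mult_mono) auto
    then show ?thesis using mult_left_mono[of 1 "?m\<^sup>2 * exp (4 * t)" "2 * pi"] by simp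
  qed
  finally have "0 < (2 * pi * (?m\<^sup>2 * exp (4 * t)) - 3) * (?m\<^sup>2 * pi * exp (5 * t))" by simp
  also have "\<dots> = 2 * ?m ^ 4 * pi\<^sup>2 * exp (9 * t) - 3 * ?m\<^sup>2 * pi * exp (5 * t)"
  proof -
    have "exp (9 * t) = exp (4 * t) * exp (5 * t)" by (simp add: exp_add[symmetric])
    moreover have "?m ^ 4 = ?m\<^sup>2 * ?m\<^sup>2" by (simp flip: power_add)
    ultimately show ?thesis by (simp add: algebra_simps power2_eq_square[of pi])
  qed
  finally show ?thesis by (simp add: phi_term_def)
qed

lemma Phi_pos: "0 \<le> t \<Longrightarrow> 0 < Phi t"
  unfolding sums_unique[OF phi_term_sums[of t]]
  by (intro suminf_pos sums_summable[OF phi_term_sums] phi_term_pos)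

text \<open>The true decay is doubly exponential. A cubic exponent is enough to bring the order of F
  below 1, whereas a quadratic one would only give order 1; the additional e^(-t) is kept for
  integrability.\<close>

lemma Phi_decay: "\<exists>K>0. \<forall>t\<ge>0. Phi t \<le> K * exp (- (t ^ 3) - t)"
proof -
  \<comment> \<open>The exponent is just -(i+1)^2, written with pi * (1 / pi) so that it matches the
    theta series at x = 1 / pi.\<close>
  define c where "c i = 2 * pi\<^sup>2 * (real (Suc i) ^ 4 * exp (- pi * (1 / pi) * (real (Suc i))\<^sup>2))" for i
  have c: "summable c" unfolding c_def by (intro summable_mult theta_moment_summable) simp
  have c0: "0 < c i" for i by (simp add: c_def)
  have le: "phi_term i t \<le> c i * exp (- (t ^ 3) - t)" if t: "0 \<le> t" for i t
  proof -
    let ?m = "real (Suc i)"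
    have E: "1 \<le> exp (4 * t)" using t by simp
    have m1: "1 \<le> ?m\<^sup>2" by simp
    have "(1 + t) ^ 4 \<le> exp (4 * t)"
      using exp_ge_one_plus_x_over_n_power_n[of 4 "4 * t"] t by simp
    moreover have "t ^ 3 + 10 * t \<le> 2 * (1 + t) ^ 4"
    proof -
      \<comment> \<open>The 10 t collects the 9 t of the factor e^(9t) in the summand and the t of
        the desired e^(-t).\<close>
      have "2 * (1 + t) ^ 4 - (t ^ 3 + 10 * t) = 2 + 12 * t\<^sup>2 - 2 * t + 7 * t ^ 3 + 2 * t ^ 4"
        by (simp add: power_numeral_reduce algebra_simps)
      moreover have "2 + 12 * t\<^sup>2 - 2 * t = (t - 1)\<^sup>2 + 11 * t\<^sup>2 + 1"
        by (simp add: power2_eq_square algebra_simps)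
      moreover have "0 \<le> (t - 1)\<^sup>2" "0 \<le> 11 * t\<^sup>2" by simp_all
      moreover have "0 \<le> 7 * t ^ 3" "0 \<le> 2 * t ^ 4" using t by simp_all
      ultimately show ?thesis by linarith
    qed
    ultimately have poly: "t ^ 3 + 10 * t \<le> 2 * exp (4 * t)" by linarith
    have "?m\<^sup>2 + 2 * exp (4 * t) \<le> ?m\<^sup>2 * exp (4 * t) + 2 * (?m\<^sup>2 * exp (4 * t))"
    proof -
      have "?m\<^sup>2 * 1 \<le> ?m\<^sup>2 * exp (4 * t)" by (rule mult_left_mono[OF E]) simp
      moreover have "1 * exp (4 * t) \<le> ?m\<^sup>2 * exp (4 * t)" by (rule mult_right_mono[OF m1]) simp
      ultimately show ?thesis by linarith
    qed
    \<comment> \<open>Since pi > 3, the exponent can be split into one share that pays for (i+1)^2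
      and two shares that pay for 2 e^(4t), hence for the polynomial in t.\<close>
    also have "\<dots> \<le> pi * (?m\<^sup>2 * exp (4 * t))"
    proof -
      have "3 * (?m\<^sup>2 * exp (4 * t)) \<le> pi * (?m\<^sup>2 * exp (4 * t))"
        using pi_gt3 by (intro mult_right_mono) auto
      then show ?thesis by linarith
    qed
    finally have ex: "9 * t - ?m\<^sup>2 * pi * exp (4 * t) \<le> - ?m\<^sup>2 + (- (t ^ 3) - t)"
    proof -
      assume "?m\<^sup>2 + 2 * exp (4 * t) \<le> pi * (?m\<^sup>2 * exp (4 * t))"
      moreover have "pi * (?m\<^sup>2 * exp (4 * t)) = ?m\<^sup>2 * pi * exp (4 * t)" by (simp only: mult_ac)
      ultimately show ?thesis using poly by linarith
    qed
    have "phi_term i t \<le> 2 * ?m ^ 4 * pi\<^sup>2 * exp (9 * t) * exp (- ?m\<^sup>2 * pi * exp (4 * t))"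
      unfolding phi_term_def by (intro mult_right_mono) auto
    also have "\<dots> = 2 * ?m ^ 4 * pi\<^sup>2 * exp (9 * t - ?m\<^sup>2 * pi * exp (4 * t))"
      by (simp add: mult.assoc exp_add[symmetric])
    also have "\<dots> \<le> 2 * ?m ^ 4 * pi\<^sup>2 * exp (- ?m\<^sup>2 + (- (t ^ 3) - t))"
      using ex by (intro mult_left_mono) auto
    also have "\<dots> = c i * exp (- (t ^ 3) - t)" unfolding exp_add c_def by (simp add: mult_ac del: of_nat_Suc)
    finally show ?thesis .
  qed
  have "Phi t \<le> suminf c * exp (- (t ^ 3) - t)" if t: "0 \<le> t" for t
  proof -
    have "Phi t = (\<Sum>i. phi_term i t)" by (rule sums_unique[OF phi_term_sums])
    also have "\<dots> \<le> (\<Sum>i. c i * exp (- (t ^ 3) - t))"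
      by (intro suminf_le le t summable_mult2 c sums_summable[OF phi_term_sums])
    also have "\<dots> = suminf c * exp (- (t ^ 3) - t)" using c by (rule suminf_mult2[symmetric])
    finally show ?thesis .
  qed
  moreover have "0 < suminf c" using c c0 by (rule suminf_pos)
  ultimately show ?thesis by blast
qed

lemma exp_neg_integral: "has_bochner_integral lborel (\<lambda>t. indicator {0..} t * exp (- t)) (1::real)"
proof (rule has_bochner_integral_nn_integral)
  have "(\<integral>\<^sup>+ t. ennreal (indicator {0..} t * exp (- t)) \<partial>lborel) =
      (\<integral>\<^sup>+ t. ennreal (t ^ 0 * exp (- t)) * indicator {0..} t \<partial>lborel)"
    by (intro nn_integral_cong) (auto simp: indicator_def)
  also have "\<dots> = ennreal 1" using nn_intergal_power_times_exp_Ici[of 0] by simp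
  finally show "(\<integral>\<^sup>+ t. ennreal (indicator {0..} t * exp (- t)) \<partial>lborel) = ennreal 1" .
qed auto

lemma mult_le_cubic:
  fixes r t :: real
  assumes "0 \<le> r" "0 \<le> t"
  shows "r * t \<le> t ^ 3 + r powr (3 / 2)"
proof (cases "r \<le> t\<^sup>2")
  case True
  then have "r * t \<le> t\<^sup>2 * t" using assms by (intro mult_right_mono)
  then show ?thesis by (simp add: power2_eq_square power3_eq_cube add_increasing2)
next
  case False
  then have "t < sqrt r" using assms by (simp add: real_less_rsqrt)
  then have "r * t \<le> r * sqrt r" using assms by (intro mult_left_mono) auto
  also have "\<dots> = r powr (3 / 2)"
  proof (cases "r = 0")
    case False
    have "r powr (3 / 2) = r powr (1 + 1 / 2)" by simp
    also have "\<dots> = r powr 1 * r powr (1 / 2)" by (rule powr_add)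
    finally show ?thesis using assms False by (simp add: powr_half_sqrt)
  qed simp
  finally show ?thesis using assms by (simp add: add_increasing)
qed

abbreviation Phi_exp :: "real \<Rightarrow> real \<Rightarrow> real" where
  "Phi_exp r t \<equiv> indicator {0..} t * (Phi t * exp (r * t))"

lemma Phi_exp_integrable:
  "\<exists>K>0. \<forall>r\<ge>0. integrable lborel (\<lambda>t. Phi_exp r t) \<and>
    (LINT t|lborel. Phi_exp r t) \<le> K * exp (r powr (3 / 2))"
proof -
  obtain K where K: "0 < K" "\<And>t. 0 \<le> t \<Longrightarrow> Phi t \<le> K * exp (- (t ^ 3) - t)" using Phi_decay by blast
  have le: "Phi_exp r t \<le> K * exp (r powr (3 / 2)) * (indicator {0..} t * exp (- t))"
    if r: "0 \<le> r" for r t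
  proof (cases "0 \<le> t")
    case True
    have "Phi t * exp (r * t) \<le> K * exp (- (t ^ 3) - t) * exp (t ^ 3 + r powr (3 / 2))"
      using K(2)[OF True] K(1) mult_le_cubic[OF r True] by (intro mult_mono) auto
    also have "\<dots> = K * exp (r powr (3 / 2)) * exp (- t)"
      by (simp add: mult.assoc exp_add[symmetric])
    finally show ?thesis using True by simp
  qed simp
  have e: "integrable lborel (\<lambda>t. indicator {0..} t * exp (- t) :: real)"
    "(LINT t|lborel. indicator {0..} t * exp (- t) :: real) = 1"
    using exp_neg_integral by (simp_all add: has_bochner_integral_iff)
  have "integrable lborel (\<lambda>t. Phi_exp r t) \<and>
    (LINT t|lborel. Phi_exp r t) \<le> K * exp (r powr (3 / 2))" if r: "0 \<le> r" for r
  proof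
    have ei: "integrable lborel (\<lambda>t. K * exp (r powr (3 / 2)) * (indicator {0..} t * exp (- t)))"
      by (intro integrable_mult_right e)
    show i: "integrable lborel (\<lambda>t. Phi_exp r t)"
    proof (rule Bochner_Integration.integrable_bound[OF ei])
      have "0 \<le> Phi_exp r t" for t
        using Phi_pos[of t] by (auto simp: indicator_def)
      then show "AE t in lborel. norm (Phi_exp r t) \<le>
          norm (K * exp (r powr (3 / 2)) * (indicator {0..} t * exp (- t)))"
        using le[OF r] by (intro AE_I2) (metis abs_ge_self abs_of_nonneg order.trans real_norm_def)
    qed measurable
    have "(LINT t|lborel. Phi_exp r t) \<le>
        (LINT t|lborel. K * exp (r powr (3 / 2)) * (indicator {0..} t * exp (- t)))"
      by (intro integral_mono i ei le r)
    also have "\<dots> = K * exp (r powr (3 / 2))" by (simp add: e)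
    finally show "(LINT t|lborel. Phi_exp r t) \<le> K * exp (r powr (3 / 2))" .
  qed
  with K(1) show ?thesis by blast
qed

section \<open>Even moments as Taylor coefficients of a cosh transform\<close>

lemma cosh_even_series: "(\<lambda>n. x ^ (2 * n) / fact (2 * n)) sums cosh (x :: 'a :: {banach, real_normed_field})"
proof -
  let ?f = "\<lambda>n. if even n then x ^ n /\<^sub>R fact n else 0"
  have "(\<lambda>n. ?f (2 * n)) sums cosh x \<longleftrightarrow> ?f sums cosh x"
  proof (rule sums_mono_reindex)
    show "strict_mono ((*) (2::nat))" by (simp add: strict_mono_def)
    show "?f n = 0" if "n \<notin> range ((*) 2)" for n using that by (auto elim!: evenE)
  qed
  moreover have "?f (2 * n) = x ^ (2 * n) / fact (2 * n)" for n
    by (simp add: scaleR_conv_of_real divide_inverse mult.commute)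
  ultimately show ?thesis using cosh_converges[of x] by simp
qed

abbreviation Phi_cosh :: "complex \<Rightarrow> real \<Rightarrow> complex" where
  "Phi_cosh w t \<equiv> of_real (indicator {0..} t * Phi t) * cosh (w * of_real t)"

text \<open>The even part of the exponential series has the even powers of t over (2 n)!, so
  termwise integration produces the moments, as a series in w^2. On the half-line all terms are
  dominated through cosh (|w| t) \<le> exp (|w| t).\<close>

lemma b_hat_cosh:
  fixes w :: complex
  shows "(\<lambda>n. of_real (b_hat n / fact (2 * n)) * (w\<^sup>2) ^ n) sums
      (LINT t|lborel. Phi_cosh w t)"
    and "norm (LINT t|lborel. Phi_cosh w t) \<le>
      (LINT t|lborel. Phi_exp (norm w) t)"
    and "integrable lborel (\<lambda>t. Phi_cosh w t)"
proof -
  let ?P = "\<lambda>t. indicator {0..} t * Phi t"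
  have P0: "0 \<le> ?P t" for t using Phi_pos[of t] by (auto simp: indicator_def)
  define f where "f n t = complex_of_real (?P t) * ((w * of_real t) ^ (2 * n) / fact (2 * n))" for n t
  define h where "h n t = ?P t * ((norm w * t) ^ (2 * n) / fact (2 * n))" for n t
  have E: "integrable lborel (\<lambda>t. Phi_exp (norm w) t)"
    using Phi_exp_integrable norm_ge_zero[of w] by blast
  have nf: "norm (f n t) = h n t" for n t
  proof -
    have "norm ((w * of_real t) ^ (2 * n)) = (norm w * t) ^ (2 * n)"
      by (simp add: norm_power norm_mult power_mult power_mult_distrib)
    moreover have "norm (complex_of_real (?P t)) = ?P t" using P0[of t] by (simp only: norm_of_real abs_of_nonneg)
    ultimately show ?thesis unfolding f_def h_def norm_mult norm_divide by simp
  qed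
  have hs: "(\<lambda>n. h n t) sums (?P t * cosh (norm w * t))" for t
    unfolding h_def by (intro sums_mult cosh_even_series)
  have fs: "(\<lambda>n. f n t) sums (Phi_cosh w t)" for t
    unfolding f_def by (intro sums_mult cosh_even_series)
  have h0: "0 \<le> h n t" for n t unfolding nf[symmetric] by simp
  have ch: "?P t * cosh (norm w * t) \<le> Phi_exp (norm w) t" for t
  proof (cases "0 \<le> t")
    case True
    then have "exp (- (norm w * t)) \<le> exp (norm w * t)" by simp
    then have "cosh (norm w * t) \<le> exp (norm w * t)" by (simp add: cosh_def)
    then show ?thesis using True Phi_pos[OF True] by simp
  qed simp
  have hsum: "(\<Sum>n<N. h n t) \<le> Phi_exp (norm w) t" for N t
  proof -
    have "(\<Sum>n<N. h n t) \<le> (\<Sum>n. h n t)"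
      using h0 by (intro sum_le_suminf sums_summable[OF hs]) auto
    then show ?thesis using ch[of t] sums_unique[OF hs[of t]] by simp
  qed
  have fm: "f n \<in> borel_measurable lborel" and hm: "h n \<in> borel_measurable lborel" for n
    unfolding f_def h_def by measurable
  have hi: "integrable lborel (h n)" for n
  proof (rule Bochner_Integration.integrable_bound[OF E hm])
    have "h n t \<le> (\<Sum>k<Suc n. h k t)" for t using h0 by (simp add: sum_nonneg)
    then have "h n t \<le> Phi_exp (norm w) t" for t using hsum[where N = "Suc n" and t = t] order_trans by blast
    then show "AE t in lborel. norm (h n t) \<le> norm (Phi_exp (norm w) t)"
      using h0 by (intro AE_I2) (metis abs_ge_self abs_of_nonneg order.trans real_norm_def)
  qed
  have fi: "integrable lborel (f n)" for n
    by (rule Bochner_Integration.integrable_bound[OF hi[of n] fm]) (use nf h0 in simp)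
  have sint: "summable (\<lambda>n. LINT t|lborel. norm (f n t))"
  proof (rule summableI_nonneg_bounded)
    show "0 \<le> (LINT t|lborel. norm (f n t))" for n by (intro integral_nonneg_AE) simp
    show "(\<Sum>n<N. LINT t|lborel. norm (f n t)) \<le> (LINT t|lborel. Phi_exp (norm w) t)" for N
    proof -
      have "(\<Sum>n<N. LINT t|lborel. norm (f n t)) = (LINT t|lborel. (\<Sum>n<N. h n t))"
        unfolding nf using hi by (intro Bochner_Integration.integral_sum[symmetric])
      also have "\<dots> \<le> (LINT t|lborel. Phi_exp (norm w) t)"
        using hi by (intro integral_mono hsum E Bochner_Integration.integrable_sum)
      finally show ?thesis .
    qed
  qed
  have AE: "AE t in lborel. summable (\<lambda>n. norm (f n t))" unfolding nf using hs by (auto simp: sums_iff)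
  have lim: "(\<Sum>n. f n t) = Phi_cosh w t" for t using fs by (simp add: sums_iff)
  have fint: "integral\<^sup>L lborel (f n) = of_real (b_hat n / fact (2 * n)) * (w\<^sup>2) ^ n" for n
  proof -
    have "f n t = (w\<^sup>2) ^ n / fact (2 * n) * complex_of_real (indicator {0..} t *\<^sub>R (t ^ (2 * n) * Phi t))" for t
    proof -
      have "(w * of_real t) ^ (2 * n) = (w\<^sup>2) ^ n * of_real (t ^ (2 * n))"
        by (simp add: power_mult_distrib flip: power_mult)
      then show ?thesis by (simp add: f_def mult_ac)
    qed
    then have fe: "f n = (\<lambda>t. (w\<^sup>2) ^ n / fact (2 * n) * complex_of_real (indicator {0..} t *\<^sub>R (t ^ (2 * n) * Phi t)))"
      by (rule ext)
    have "integral\<^sup>L lborel (f n) = (w\<^sup>2) ^ n / fact (2 * n) * of_real (b_hat n)"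
      unfolding fe b_hat_def set_lebesgue_integral_def by (simp only: integral_mult_right_zero integral_complex_of_real)
    then show ?thesis by simp
  qed
  show "(\<lambda>n. of_real (b_hat n / fact (2 * n)) * (w\<^sup>2) ^ n) sums
      (LINT t|lborel. Phi_cosh w t)"
    using sums_integral[OF fi AE sint] unfolding lim fint .
  show gi: "integrable lborel (\<lambda>t. Phi_cosh w t)"
    using integrable_suminf[OF fi AE sint] unfolding lim .
  have "norm (LINT t|lborel. Phi_cosh w t) \<le>
      (LINT t|lborel. norm (Phi_cosh w t))" by (rule integral_norm_bound)
  also have "\<dots> \<le> (LINT t|lborel. Phi_exp (norm w) t)"
  proof (rule integral_mono[OF _ E])
    show "integrable lborel (\<lambda>t. norm (Phi_cosh w t))"
      using gi by (rule integrable_norm)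
    fix t
    have "norm (\<Sum>n. f n t) \<le> (\<Sum>n. norm (f n t))"
      by (rule summable_norm) (use nf hs in \<open>auto simp: sums_iff\<close>)
    also have "\<dots> = ?P t * cosh (norm w * t)" unfolding nf using hs by (simp add: sums_iff)
    finally show "norm (Phi_cosh w t) \<le> Phi_exp (norm w) t"
      using ch[of t] unfolding lim by simp
  qed
  finally show "norm (LINT t|lborel. Phi_cosh w t) \<le>
      (LINT t|lborel. Phi_exp (norm w) t)" .
qed

subsection \<open>The zeta function\<close>

definition b_hat_fun :: "complex \<Rightarrow> complex" where
  "b_hat_fun z = (\<Sum>n. of_real (b_hat n / fact (2 * n)) * z ^ n)"

lemma b_hat_fun_square:
  "b_hat_fun (w\<^sup>2) = (LINT t|lborel. Phi_cosh w t)"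
  unfolding b_hat_fun_def by (rule sums_unique[symmetric]) (rule b_hat_cosh(1))

lemma b_hat_fun_sums: "(\<lambda>n. of_real (b_hat n / fact (2 * n)) * z ^ n) sums b_hat_fun z"
  using b_hat_cosh(1)[of "csqrt z"] unfolding b_hat_fun_square[symmetric] by simp

lemma b_hat_fun_holomorphic: "b_hat_fun holomorphic_on UNIV"
  by (rule power_series_holomorphic_UNIV[OF b_hat_fun_sums])

lemma b_hat_nonneg: "0 \<le> b_hat n"
proof -
  have "0 \<le> indicator {0..} t *\<^sub>R (t ^ (2 * n) * Phi t)" for t
    using Phi_pos[of t] by (auto simp: indicator_def)
  then show ?thesis unfolding b_hat_def set_lebesgue_integral_def by (intro integral_nonneg_AE) auto
qed

lemma b_hat_0_pos: "0 < b_hat 0"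
proof -
  have P0: "0 \<le> indicator {0..} t * Phi t" for t using Phi_pos[of t] by (auto simp: indicator_def)
  have "\<exists>K>0. \<forall>r\<ge>0. integrable lborel (\<lambda>t. Phi_exp r t) \<and>
    (LINT t|lborel. Phi_exp r t) \<le> K * exp (r powr (3 / 2))"
    by (rule Phi_exp_integrable)
  then have i: "integrable lborel (\<lambda>t. indicator {0..} t * Phi t)"
    by (metis (no_types, lifting) exp_zero mult.right_neutral mult_zero_left order_refl Bochner_Integration.integrable_cong)
  have "(LINT t|lborel. indicator {0..} t * Phi t) \<noteq> 0"
  proof
    assume "(LINT t|lborel. indicator {0..} t * Phi t) = 0"
    then have "AE t in lborel. indicator {0..} t * Phi t = 0"
      using integral_nonneg_eq_0_iff_AE[OF i] P0 by simp
    then have "AE t in lborel. t \<notin> {0..(1::real)}"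
      by eventually_elim (use Phi_pos in \<open>force simp: indicator_def\<close>)
    then have "{0..(1::real)} \<in> null_sets lborel" by (subst (asm) AE_iff_null_sets[symmetric]) auto
    then show False by (simp add: null_sets_def)
  qed
  then have "b_hat 0 \<noteq> 0" by (simp add: b_hat_def set_lebesgue_integral_def)
  then show ?thesis using b_hat_nonneg[of 0] by simp
qed

lemma b_hat_fun_0: "b_hat_fun 0 = of_real (b_hat 0)"
  using powser_sums_zero_iff[of "\<lambda>n. of_real (b_hat n / fact (2 * n)) :: complex"] b_hat_fun_sums[of 0]
  by (auto dest: sums_unique2)

text \<open>The value 1 of (2 s - 1)^2 belongs to the pole s = 1, where a zero of F could not be
  read off from zeta. Nonnegative coefficients with a positive first one rule it out.\<close>

lemma b_hat_fun_1_nonzero: "b_hat_fun 1 \<noteq> 0"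
proof -
  have s: "(\<lambda>n. complex_of_real (b_hat n / fact (2 * n))) sums b_hat_fun 1"
    using b_hat_fun_sums[of 1] by simp
  then have r: "(\<lambda>n. b_hat n / fact (2 * n)) sums Re (b_hat_fun 1)"
    using sums_Re[OF s] by (simp only: Re_complex_of_real)
  have "0 < b_hat 0 / fact (2 * 0)" using b_hat_0_pos by simp
  also have "\<dots> \<le> (\<Sum>n. b_hat n / fact (2 * n))"
    using sum_le_suminf[OF sums_summable[OF r], of "{0}"] b_hat_nonneg by simp
  also have "\<dots> = Re (b_hat_fun 1)" using sums_unique[OF r] by simp
  finally show ?thesis by auto
qed

text \<open>Evenness of Phi allows the exponential on the whole line to be replaced by cosh, and the
  line is then folded onto the half-line, which doubles the integral.\<close>

lemma b_hat_fun_mellin: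
  assumes s: "1 < Re s"
  shows "2 * b_hat_fun ((2 * s - 1)\<^sup>2) =
    xi_factor s * (\<Sum>i. of_nat (Suc i) powr (- s))"
proof -
  define w where "w = 2 * s - 1"
  define f where "f t = of_real (Phi t) * exp (w * of_real t)" for t
  define e where "e t = of_real (Phi t) * cosh (w * of_real t)" for t
  define h where "h t = Phi_cosh w t" for t
  have fi: "integrable lborel f" and fv: "integral\<^sup>L lborel f = xi_factor s * (\<Sum>i. of_nat (Suc i) powr (- s))"
    using Phi_mellin(1)[OF s] unfolding f_def[abs_def] w_def has_bochner_integral_iff by auto
  have refl: "integral\<^sup>L lborel (\<lambda>t. u (- t)) = integral\<^sup>L lborel u" for u :: "real \<Rightarrow> complex"
    using lborel_integral_real_affine[of "-1" u 0] by simp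
  have refli: "integrable lborel (\<lambda>t. u (- t))" if "integrable lborel u" for u :: "real \<Rightarrow> complex"
    using lborel_integrable_real_affine[OF that, of "-1" 0] by simp
  have ff: "f t + f (- t) = 2 * e t" for t
    by (simp add: f_def e_def Phi_even cosh_def scaleR_conv_of_real algebra_simps)
  have "integral\<^sup>L lborel (\<lambda>t. f t + f (- t)) = integral\<^sup>L lborel f + integral\<^sup>L lborel f"
    using refl[of f] Bochner_Integration.integral_add[OF fi refli[OF fi]] by simp
  then have ef: "integral\<^sup>L lborel e = integral\<^sup>L lborel f" unfolding ff by simp
  have hi: "integrable lborel h" unfolding h_def[abs_def] by (rule b_hat_cosh(3))
  have "integral\<^sup>L lborel e = integral\<^sup>L lborel (\<lambda>t. h t + h (- t))"
  proof (rule integral_cong_AE)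
    show "e \<in> borel_measurable lborel" unfolding e_def[abs_def] cosh_def by measurable
    show "(\<lambda>t. h t + h (- t)) \<in> borel_measurable lborel" using hi refli[OF hi] by measurable
    \<comment> \<open>The point 0 belongs to both closed half-lines, so the decomposition holds only
      almost everywhere.\<close>
    have "AE t in lborel. t \<noteq> (0::real)" by (rule AE_lborel_singleton)
    then show "AE t in lborel. e t = h t + h (- t)"
      by eventually_elim (auto simp: e_def h_def indicator_def Phi_even)
  qed
  also have "\<dots> = integral\<^sup>L lborel h + integral\<^sup>L lborel h"
    using refl[of h] Bochner_Integration.integral_add[OF hi refli[OF hi]] by simp
  also have "integral\<^sup>L lborel h = b_hat_fun (w\<^sup>2)"
    unfolding h_def[abs_def] b_hat_fun_square ..
  finally show ?thesis using ef fv by (simp add: w_def)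
qed

text \<open>The Mellin identity solved for zeta, after s Gamma (s/2) = 2 Gamma (s/2 + 1). In this
  form the reciprocal Gamma function is entire and the only denominator is s - 1.\<close>

definition zeta_continuation :: "complex \<Rightarrow> complex" where
  "zeta_continuation s =
     8 * b_hat_fun ((2 * s - 1)\<^sup>2) * of_real pi powr (s / 2) * rGamma (s / 2 + 1) / (s - 1)"

lemma zeta_continuation_holomorphic: "zeta_continuation holomorphic_on (- {1})"
proof -
  have "(b_hat_fun \<circ> (\<lambda>s. (2 * s - 1)\<^sup>2)) holomorphic_on - {1}"
    by (rule holomorphic_on_compose_gen[OF _ b_hat_fun_holomorphic]) (auto intro!: holomorphic_intros)
  then have "(\<lambda>s. b_hat_fun ((2 * s - 1)\<^sup>2)) holomorphic_on - {1}" by (simp add: comp_def)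
  then show ?thesis unfolding zeta_continuation_def[abs_def]
    by (intro holomorphic_intros) auto
qed

lemma zeta_continuation_series:
  assumes s: "1 < Re s"
  shows "(\<lambda>n. of_nat (Suc n) powr (- s)) sums zeta_continuation s"
proof -
  define D where "D = (\<Sum>i. of_nat (Suc i) powr (- s) :: complex)"
  have G1: "Gamma (s / 2 + 1) = s / 2 * Gamma (s / 2)" using s by (intro Gamma_plus1 Re_pos_not_nonpos_Int) simp
  have Gnz: "Gamma (s / 2 + 1) \<noteq> 0" using s by (intro Gamma_nonzero Re_pos_not_nonpos_Int) simp
  have s1: "s - 1 \<noteq> 0" using s by auto
  have "2 * b_hat_fun ((2 * s - 1)\<^sup>2) = (s / 2 * Gamma (s / 2)) * (s - 1) * of_real pi powr (- s / 2) / 4 * D"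
    unfolding b_hat_fun_mellin[OF s] D_def by simp
  then have b: "8 * b_hat_fun ((2 * s - 1)\<^sup>2) = Gamma (s / 2 + 1) * (s - 1) * of_real pi powr (- s / 2) * D"
    unfolding G1 by simp
  have p: "of_real pi powr (- s / 2) * of_real pi powr (s / 2) = (1 :: complex)"
    by (simp add: powr_minus)
  have "zeta_continuation s = Gamma (s / 2 + 1) * (s - 1) * of_real pi powr (- s / 2) * D * of_real pi powr (s / 2) * rGamma (s / 2 + 1) / (s - 1)"
    unfolding zeta_continuation_def b ..
  also have "\<dots> = (of_real pi powr (- s / 2) * of_real pi powr (s / 2)) * (Gamma (s / 2 + 1) * rGamma (s / 2 + 1)) * D"
    using s1 by simp
  also have "\<dots> = D" using p Gnz by (simp add: rGamma_inverse_Gamma)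
  finally show ?thesis using Phi_mellin(2)[OF s] unfolding D_def by (simp add: sums_iff)
qed

text \<open>The explicit continuation shows that the choice defining \<open>zeta\<close> has a
  witness. The chosen function agrees with it by the identity theorem, as the punctured plane is
  connected.\<close>

lemma zeta_eq_continuation:
  assumes "s \<noteq> 1"
  shows "zeta s = zeta_continuation s"
proof -
  have "zeta holomorphic_on (- {1}) \<and> (\<forall>s. Re s > 1 \<longrightarrow> (\<lambda>n. of_nat (Suc n) powr (- s)) sums zeta s)"
    unfolding zeta_def
    by (rule someI[of _ zeta_continuation]) (use zeta_continuation_holomorphic zeta_continuation_series in blast)
  then have z: "zeta holomorphic_on (- {1})" "\<And>s. Re s > 1 \<Longrightarrow> (\<lambda>n. of_nat (Suc n) powr (- s)) sums zeta s" by auto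
  show ?thesis
  proof (rule analytic_continuation_open[of "{s. 1 < Re s}" "- {1}" zeta zeta_continuation])
    show "open {s. 1 < Re s}" by (rule open_halfspace_Re_gt)
    show "connected (- {1 :: complex})" by (rule connected_punctured_universe) simp
    have "2 \<in> {s. 1 < Re s}" by simp
    then show "{s. 1 < Re s} \<noteq> {}" by blast
    show "zeta u = zeta_continuation u" if "u \<in> {s. 1 < Re s}" for u
      using sums_unique2[OF z(2) zeta_continuation_series] that by simp
  qed (use z zeta_continuation_holomorphic assms in auto)
qed

section \<open>Zeros and polynomial approximation of F under the Riemann Conjecture\<close>

lemma b_hat_fun_zeros:
  assumes "Riemann_conjecture" and z: "b_hat_fun z = 0"
  shows "z \<in> of_real ` {..<0}"
proof -
  define w where "w = csqrt z"
  define s where "s = (1 + w) / 2"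
  have w: "w\<^sup>2 = z" "0 \<le> Re w"
    unfolding w_def using csqrt_principal[of z] by (simp, metis less_eq_real_def)
  have ws: "2 * s - 1 = w" unfolding s_def by (simp add: field_simps)
  have Re_s: "Re s = (1 + Re w) / 2" by (simp add: s_def)
  have s1: "s \<noteq> 1"
  proof
    assume "s = 1"
    then have "z = 1" using ws w by auto
    then show False using z b_hat_fun_1_nonzero by simp
  qed
  have "zeta s = 0"
    unfolding zeta_eq_continuation[OF s1] zeta_continuation_def ws w z by simp
  moreover have "\<nexists>n::nat. s = - 2 * of_nat (Suc n)"
  proof
    assume "\<exists>n::nat. s = - 2 * of_nat (Suc n)"
    then obtain n :: nat where "s = - 2 * of_nat (Suc n)" by blast
    then have "Re s = - 2 * real (Suc n)" by simp
    then show False using Re_s w(2) by simp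
  qed
  ultimately have "Re s = 1 / 2" using assms(1) s1 unfolding Riemann_conjecture_def by blast
  then have "Re w = 0" using Re_s by simp
  \<comment> \<open>On the critical line w is purely imaginary, so z = w^2 is real and at most 0;
    F(0) = \<open>b_hat 0\<close> > 0 makes it strictly negative.\<close>
  then have "w = \<i> * of_real (Im w)" by (simp add: complex_eq_iff)
  then have "z = (\<i> * of_real (Im w))\<^sup>2" using w(1) by simp
  then have zz: "z = of_real (- (Im w)\<^sup>2)" by (simp add: power_mult_distrib)
  moreover have "z \<noteq> 0" using z b_hat_fun_0 b_hat_0_pos by auto
  ultimately have "- (Im w)\<^sup>2 < 0" by auto
  then show ?thesis using zz by blast
qed

lemma b_hat_fun_growth: "\<exists>K>0. \<forall>z. norm (b_hat_fun z) \<le> K * exp (norm z powr (3 / 4))"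
proof -
  obtain K where K: "0 < K" "\<And>r. 0 \<le> r \<Longrightarrow>
    (LINT t|lborel. Phi_exp r t) \<le> K * exp (r powr (3 / 2))"
    using Phi_exp_integrable by blast
  have "norm (b_hat_fun z) \<le> K * exp (norm z powr (3 / 4))" for z
  proof -
    define w where "w = csqrt z"
    have w: "w\<^sup>2 = z" by (simp add: w_def)
    have "norm (b_hat_fun z) \<le> (LINT t|lborel. Phi_exp (norm w) t)"
      unfolding w[symmetric] b_hat_fun_square by (rule b_hat_cosh(2))
    also have "\<dots> \<le> K * exp (norm w powr (3 / 2))" by (intro K) simp
    also have "norm w powr (3 / 2) = norm z powr (3 / 4)"
    proof -
      have e: "norm z = norm w powr 2" unfolding w[symmetric] by (simp add: norm_power powr_numeral)
      show ?thesis unfolding e powr_powr by simp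
    qed
    finally show ?thesis .
  qed
  with K(1) show ?thesis by blast
qed

lemma b_hat_fun_approx:
  assumes "Riemann_conjecture"
  shows "\<exists>rs. (\<forall>n. \<forall>r\<in>set (rs n). 0 < r) \<and> (\<forall>K. compact K \<longrightarrow>
    uniform_limit K (\<lambda>n z. cpoly (linear_prod (rs n)) z)
      (\<lambda>z. b_hat_fun z / of_real (b_hat 0)) sequentially)"
proof -
  obtain K where K: "0 < K" "\<And>z. norm (b_hat_fun z) \<le> K * exp (norm z powr (3 / 4))"
    using b_hat_fun_growth by blast
  show ?thesis
  proof (rule entire_order_less_1_limit[where C = "max 1 (K / b_hat 0)"])
    show "(\<lambda>z. b_hat_fun z / of_real (b_hat 0)) holomorphic_on UNIV"
      using b_hat_0_pos by (intro holomorphic_intros b_hat_fun_holomorphic) auto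
    show "b_hat_fun 0 / of_real (b_hat 0) = 1" using b_hat_0_pos by (simp add: b_hat_fun_0)
    show "z \<in> of_real ` {..<0}" if "b_hat_fun z / of_real (b_hat 0) = 0" for z
      using that b_hat_0_pos by (intro b_hat_fun_zeros assms) simp
    show "norm (b_hat_fun z / of_real (b_hat 0)) \<le> max 1 (K / b_hat 0) * exp (norm z powr (3 / 4))" for z
    proof -
      have "norm (b_hat_fun z / of_real (b_hat 0)) \<le> (K / b_hat 0) * exp (norm z powr (3 / 4))"
        using K(2)[of z] b_hat_0_pos by (simp add: norm_divide divide_right_mono)
      also have "\<dots> \<le> max 1 (K / b_hat 0) * exp (norm z powr (3 / 4))" by (intro mult_right_mono) auto
      finally show ?thesis .
    qed
  qed simp
qed

theorem theorem9:
  assumes "Riemann_conjecture"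
  shows "\<forall>q::real. 0 < q \<and> q \<le> 1 \<longrightarrow>
    Abs_fps (\<lambda>n. fact n * b_hat n / fact (2 * n)) \<in> PN_bar q \<and> PN_bar q \<subseteq> LC_plus_bar"
proof (intro allI impI conjI)
  fix q :: real assume q: "0 < q \<and> q \<le> 1"
  show "PN_bar q \<subseteq> LC_plus_bar" using q by (intro PN_bar_subset_LC_plus_bar) auto
  obtain rs where rs: "\<And>n r. r \<in> set (rs n) \<Longrightarrow> 0 < r"
    and lim: "\<And>K. compact K \<Longrightarrow> uniform_limit K (\<lambda>n z. cpoly (linear_prod (rs n)) z)
      (\<lambda>z. b_hat_fun z / of_real (b_hat 0)) sequentially"
    using b_hat_fun_approx[OF assms] by blast
  show "Abs_fps (\<lambda>n. fact n * b_hat n / fact (2 * n)) \<in> PN_bar q"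
  proof (cases "q = 1")
    case True
    \<comment> \<open>The approximating products are normalised to 1 at the origin; the factor F(0)
      is restored here.\<close>
    define P where "P n = smult (b_hat 0) (linear_prod (rs n))" for n
    have P: "cpoly (P n) z = of_real (b_hat 0) * cpoly (linear_prod (rs n)) z"
      for n and z :: complex
      by (simp add: P_def map_poly_smult)
    have "P n \<in> nonpos_rooted_polys" for n
    proof -
      have "z \<in> of_real ` {..0}" if "cpoly (P n) z = 0" for z :: complex
      proof -
        have "(\<Prod>r\<leftarrow>rs n. 1 + of_real r * z) = 0"
          using that b_hat_0_pos unfolding P poly_linear_prod_factor by simp
        then obtain r where r: "r \<in> set (rs n)" "1 + of_real r * z = 0" by (auto simp: prod_list_zero_iff)
        then have "z = of_real (- 1 / r)" using rs[OF r(1)] by (simp add: field_simps eq_neg_iff_add_eq_0)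
        moreover have "- 1 / r \<in> {..0}" using rs[OF r(1)] by simp
        ultimately show ?thesis by blast
      qed
      then show ?thesis by (auto simp: nonpos_rooted_polys_def)
    qed
    moreover have "uniform_limit K (\<lambda>n z. cpoly (P n) z) b_hat_fun sequentially"
      if K: "compact K" for K
      using bounded_linear.uniform_limit[OF bounded_linear_mult_right[of "complex_of_real (b_hat 0)"] lim[OF K]] b_hat_0_pos
      unfolding P by simp
    ultimately have "b_hat_fun \<in> N_bar 1" unfolding N_bar_def N_bar_1_def by auto
    \<comment> \<open>For q = 1 the weight 1/k! cancels the factor k!, so the weighted series is F
      itself.\<close>
    moreover have "(\<lambda>k. of_real (C_inf 1 k * fps_nth (Abs_fps (\<lambda>n. fact n * b_hat n / fact (2 * n))) k) * z ^ k) sums b_hat_fun z" for z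
      using b_hat_fun_sums[of z] by (simp add: C_inf_def)
    ultimately show ?thesis unfolding True PN_bar_def by blast
  next
    case False
    \<comment> \<open>The Taylor coefficients of F / F(0), the limits of the coefficients of the
      normalised products.\<close>
    define f where "f k = b_hat k / fact (2 * k) / b_hat 0" for k
    have "(\<lambda>n. coeff (linear_prod (rs n)) k) \<longlonglongrightarrow> f k" for k
    proof -
      have s: "(\<lambda>k. of_real (f k) * z ^ k) sums (b_hat_fun z / of_real (b_hat 0))" for z
        using sums_divide[OF b_hat_fun_sums[of z], of "of_real (b_hat 0)"] by (simp add: f_def)
      have "(\<lambda>n. coeff (map_poly complex_of_real (linear_prod (rs n))) k) \<longlonglongrightarrow> of_real (f k)"
        by (rule power_series_coeffs_tendsto[OF poly_sums s]) (simp add: lim)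
      then show ?thesis by (simp add: coeff_map_poly tendsto_of_real_iff)
    qed
    then have "Abs_fps (\<lambda>k. b_hat 0 * (fact k * f k)) \<in> PN_bar q"
      using q False rs by (intro PN_bar_less_1I) auto
    also have "(\<lambda>k. b_hat 0 * (fact k * f k)) = (\<lambda>n. fact n * b_hat n / fact (2 * n))"
      using b_hat_0_pos by (simp add: f_def fun_eq_iff)
    finally show ?thesis .
  qed
qed

end
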